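(* Let $T$ be a (closed, nondegenerate) triangle in a two-dimensional real vector space $\mathbb V$, with vertices $V_0,V_1,V_2$, let $W$ be a point in the interior of $T$, and let $\mathcal R$ be the subdivision of $T$ into three triangles obtained by joining $W$ to $V_0,V_1,V_2$. For each edge $E$ of $T$ fix a point $W_E$ in the interior of $E$ and a vector $\nu_E\in\mathbb V$ transverse to $E$, and for a continuous $1$-form $u$ set $\mu_E(u)=u(W_E)(\nu_E)$. Then the sequence $$0\to\mathbb R\to \mathrm C^1\mathrm P^3\Lambda^0(\mathcal R)\xrightarrow{\ \mathrm d\ }\mathrm C^0_{\mathrm d}\mathrm P^2\Lambda^1(\mathcal R)\xrightarrow{\ \mathrm d\ }\mathrm C^0\mathrm P^1\Lambda^2(\mathcal R)\to 0$$ (the first map being the inclusion of constant functions) is exact. Moreover: (a) $\mathrm C^1\mathrm P^3\Lambda^0(\mathcal R)$ has dimension $12$, and any element $u$ is determined by the following data: for each vertex $V$, the value $u(V)$ (one degree of freedom) and $\mathrm d u(V)$ (two degrees of freedom); for each edge $E$, the number $\mu_E(\mathrm d u)$. (b) $\mathrm C^0_{\mathrm d}\mathrm P^2\Lambda^1(\mathcal R)$ has dimension $15$, and any element $u$ is determined by: for each vertex $V$, $u(V)$ (two degrees of freedom) and $\mathrm d u(V)$ (one degree of freedom); for each edge $E$, the two numbers $\mu_E(u)$ and $\int_E u$. (c) $\mathrm C^0\mathrm P^1\Lambda^2(\mathcal R)$ has dimension $4$, and any element $u$ is determined by: for each vertex $V$, $u(V)$ (one degree of freedom); and the integral $\int_T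 u$. (d) These degrees of freedom provide commuting interpolators: if $I^0,I^1,I^2$ denote the maps sending, respectively, a $0$-form of class $\mathrm C^1$ on $T$, a continuous $1$-form on $T$ with continuous exterior derivative, and a continuous $2$-form on $T$, to the unique element of the corresponding space above with the same degrees of freedom, then $\mathrm d I^0u=I^1\mathrm d u$ and $\mathrm d I^1 u=I^2\mathrm d u$ for all such $u$.
   Context: $\mathrm C^1\mathrm P^3\Lambda^0(\mathcal R)$ is the space of functions on $T$ of class $\mathrm C^1(T)$ whose restriction to each of the three small triangles of $\mathcal R$ is a polynomial of degree at most $3$. $\mathrm C^0_{\mathrm d}\mathrm P^2\Lambda^1(\mathcal R)$ is the space of $1$-forms on $T$ which on each small triangle have polynomial coefficients of degree at most $2$, which are continuous on $T$ (all components) and whose exterior derivative is continuous on $T$. $\mathrm C^0\mathrm P^1\Lambda^2(\mathcal R)$ is the space of continuous $2$-forms on $T$ which on each small triangle have affine coefficient. $\int_E u$ is the integral over the (oriented) edge $E$ of the pullback of the $1$-form $u$. *)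

theory Defs
  imports "HOL-Analysis.Analysis" "HOL-Library.Function_Algebras"
begin

text \<open>
  Pointwise scalar multiplication (addition comes from \<open>Function_Algebras\<close>), so that
  \<^const>\<open>subspace\<close> and \<^const>\<open>dim\<close> apply to sets of functions.
\<close>

instantiation "fun" :: (type, real_vector) real_vector
begin

definition scaleR_fun :: "real \<Rightarrow> ('a \<Rightarrow> 'b) \<Rightarrow> 'a \<Rightarrow> 'b"
  where "scaleR_fun c f = (\<lambda>x. c *\<^sub>R f x)"

instance
  by standard (auto simp: scaleR_fun_def fun_eq_iff scaleR_add_right scaleR_add_left)

end

definition linear_between ::
    "'a::real_vector set \<Rightarrow> 'b::real_vector set \<Rightarrow> ('a \<Rightarrow> 'b) \<Rightarrow> bool"
  where "linear_between U V f \<longleftrightarrow>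
    subspace U \<and> subspace V \<and> f ` U \<subseteq> V \<and>
    (\<forall>x\<in>U. \<forall>y\<in>U. f (x + y) = f x + f y) \<and>
    (\<forall>c. \<forall>x\<in>U. f (c *\<^sub>R x) = c *\<^sub>R f x)"

text \<open>
  The plane is a Euclidean space of dimension 2; its inner product only provides the topology
  and coordinates. A triangle is given by its vertices \<open>V 0\<close>, \<open>V 1\<close>, \<open>V 2\<close>, indexed by the type
  \<open>3\<close> of integers modulo 3. Edge \<open>i\<close> is the one opposite to \<open>V i\<close>, oriented from \<open>V (i + 1)\<close> to
  \<open>V (i + 2)\<close>; the triangle carries the orientation of the basis \<open>V 1 - V 0\<close>, \<open>V 2 - V 0\<close>.
\<close>

definition closed_triangle :: "(3 \<Rightarrow> 'a::euclidean_space) \<Rightarrow> 'a set"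
  where "closed_triangle V = convex hull (range V)"

definition subtriangles :: "(3 \<Rightarrow> 'a::euclidean_space) \<Rightarrow> 'a \<Rightarrow> 'a set set"
  where "subtriangles V W = range (\<lambda>i. convex hull {W, V (i + 1), V (i + 2)})"

text \<open>
  A form on a set \<open>T\<close> is represented by its extension by zero outside \<open>T\<close>, so that forms on \<open>T\<close>
  correspond bijectively to their representatives. The values of a 2-form lie in
  \<open>alternating\<close>.
\<close>

type_synonym 'a form0 = "'a \<Rightarrow> real"
type_synonym 'a form1 = "'a \<Rightarrow> 'a \<Rightarrow>\<^sub>L real"
type_synonym 'a form2 = "'a \<Rightarrow> 'a \<Rightarrow>\<^sub>L 'a \<Rightarrow>\<^sub>L real"

definition alternating :: "('a::euclidean_space \<Rightarrow>\<^sub>L 'a \<Rightarrow>\<^sub>L real) set"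
  where "alternating = {B. \<forall>v. blinfun_apply (blinfun_apply B v) v = 0}"

definition zero_off :: "'a set \<Rightarrow> ('a \<Rightarrow> 'b::zero) \<Rightarrow> bool"
  where "zero_off T u \<longleftrightarrow> (\<forall>x. x \<notin> T \<longrightarrow> u x = 0)"

definition const_form :: "'a set \<Rightarrow> real \<Rightarrow> 'a form0"
  where "const_form T c = (\<lambda>x. if x \<in> T then c else 0)"

definition edge_integral :: "(3 \<Rightarrow> 'a::euclidean_space) \<Rightarrow> 3 \<Rightarrow> 'a form1 \<Rightarrow> real"
  where "edge_integral V i u =
    integral {0..1} (\<lambda>t. blinfun_apply (u (linepath (V (i + 1)) (V (i + 2)) t))
                            (V (i + 2) - V (i + 1)))"

definition tri_integral ::
    "(3 \<Rightarrow> 'a::euclidean_space) \<Rightarrow> ('a \<Rightarrow> 'a \<Rightarrow> 'a \<Rightarrow> real) \<Rightarrow> real"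
  where "tri_integral V w =
    integral {p :: real \<times> real. 0 \<le> fst p \<and> 0 \<le> snd p \<and> fst p + snd p \<le> 1}
      (\<lambda>p. w (V 0 + fst p *\<^sub>R (V 1 - V 0) + snd p *\<^sub>R (V 2 - V 0)) (V 1 - V 0) (V 2 - V 0))"

definition integral2 :: "(3 \<Rightarrow> 'a::euclidean_space) \<Rightarrow> 'a form2 \<Rightarrow> real"
  where "integral2 V w = tri_integral V (\<lambda>x v v'. blinfun_apply (blinfun_apply (w x) v) v')"

definition d0 :: "'a::euclidean_space set \<Rightarrow> 'a form0 \<Rightarrow> 'a form1"
  where "d0 T u = (\<lambda>x. if x \<in> T then Blinfun (frechet_derivative u (at x within T)) else 0)"

definition C1_form0 :: "'a::euclidean_space set \<Rightarrow> 'a form0 set"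
  where "C1_form0 T = {u. zero_off T u \<and> u differentiable_on T \<and> continuous_on T (d0 T u)}"

text \<open>
  For a \<open>C\<^sup>1\<close> function \<open>f\<close> the form \<open>d f\<close> is merely continuous, so the exterior derivative of
  continuous 1-forms is taken in the sense of distributions on the interior of the triangle:
  \<open>w = d u\<close> iff \<open>\<integral> \<phi> w = \<integral> u \<and> d\<phi>\<close> for all test functions \<open>\<phi>\<close>
  (from \<open>d (\<phi> u) = d\<phi> \<and> u + \<phi> d u\<close>).
\<close>

primrec C_k :: "nat \<Rightarrow> ('a::euclidean_space \<Rightarrow> real) \<Rightarrow> bool" where
  "C_k 0 f \<longleftrightarrow> continuous_on UNIV f"
| "C_k (Suc k) f \<longleftrightarrow>
    (\<forall>x. f differentiable (at x)) \<and> (\<forall>v. C_k k (\<lambda>x. frechet_derivative f (at x) v))"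

definition test_functions :: "'a::euclidean_space set \<Rightarrow> ('a \<Rightarrow> real) set"
  where "test_functions S =
    {\<phi>. (\<forall>k. C_k k \<phi>) \<and> compact (closure {x. \<phi> x \<noteq> 0}) \<and> closure {x. \<phi> x \<noteq> 0} \<subseteq> S}"

definition wedge :: "('a \<Rightarrow> real) \<Rightarrow> ('a \<Rightarrow> real) \<Rightarrow> 'a \<Rightarrow> 'a \<Rightarrow> real"
  where "wedge \<alpha> \<beta> = (\<lambda>v v'. \<alpha> v * \<beta> v' - \<alpha> v' * \<beta> v)"

definition C0_form2 :: "'a::euclidean_space set \<Rightarrow> 'a form2 set"
  where "C0_form2 T = {w. zero_off T w \<and> continuous_on T w \<and> range w \<subseteq> alternating}"

definition has_d1 :: "(3 \<Rightarrow> 'a::euclidean_space) \<Rightarrow> 'a form1 \<Rightarrow> 'a form2 \<Rightarrow> bool"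
  where "has_d1 V u w \<longleftrightarrow>
    w \<in> C0_form2 (closed_triangle V) \<and>
    (\<forall>\<phi> \<in> test_functions (interior (closed_triangle V)).
      tri_integral V (\<lambda>x v v'. \<phi> x * blinfun_apply (blinfun_apply (w x) v) v') =
      tri_integral V (\<lambda>x. wedge (blinfun_apply (u x)) (frechet_derivative \<phi> (at x))))"

definition d1 :: "(3 \<Rightarrow> 'a::euclidean_space) \<Rightarrow> 'a form1 \<Rightarrow> 'a form2"
  where "d1 V u = (THE w. has_d1 V u w)"

definition C0d_form1 :: "(3 \<Rightarrow> 'a::euclidean_space) \<Rightarrow> 'a form1 set"
  where "C0d_form1 V =
    {u. zero_off (closed_triangle V) u \<and> continuous_on (closed_triangle V) u \<and> (\<exists>w. has_d1 V u w)}"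

definition polynomials :: "nat \<Rightarrow> ('a::euclidean_space \<Rightarrow> real) set"
  where "polynomials k =
    span {\<lambda>x. \<Prod>b\<in>Basis. (x \<bullet> b) ^ m b |m. (\<Sum>b\<in>Basis. m b) \<le> k}"

definition piecewise_poly :: "nat \<Rightarrow> 'a::euclidean_space set set \<Rightarrow> ('a \<Rightarrow> real) \<Rightarrow> bool"
  where "piecewise_poly k R f \<longleftrightarrow> (\<forall>K\<in>R. \<exists>p\<in>polynomials k. \<forall>x\<in>K. f x = p x)"

definition C1P3_form0 :: "(3 \<Rightarrow> 'a::euclidean_space) \<Rightarrow> 'a \<Rightarrow> 'a form0 set"
  where "C1P3_form0 V W =
    {u \<in> C1_form0 (closed_triangle V). piecewise_poly 3 (subtriangles V W) u}"

definition C0dP2_form1 :: "(3 \<Rightarrow> 'a::euclidean_space) \<Rightarrow> 'a \<Rightarrow> 'a form1 set"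
  where "C0dP2_form1 V W =
    {u \<in> C0d_form1 V.
      \<forall>v. piecewise_poly 2 (subtriangles V W) (\<lambda>x. blinfun_apply (u x) v)}"

definition C0P1_form2 :: "(3 \<Rightarrow> 'a::euclidean_space) \<Rightarrow> 'a \<Rightarrow> 'a form2 set"
  where "C0P1_form2 V W =
    {w \<in> C0_form2 (closed_triangle V).
      \<forall>v v'. piecewise_poly 1 (subtriangles V W) (\<lambda>x. blinfun_apply (blinfun_apply (w x) v) v')}"

definition edge_eval ::
    "(3 \<Rightarrow> 'a::euclidean_space) \<Rightarrow> (3 \<Rightarrow> 'a) \<Rightarrow> 3 \<Rightarrow> 'a form1 \<Rightarrow> real"
  where "edge_eval WE \<nu> i u = blinfun_apply (u (WE i)) (\<nu> i)"

definition dof0 ::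
    "(3 \<Rightarrow> 'a::euclidean_space) \<Rightarrow> (3 \<Rightarrow> 'a) \<Rightarrow> (3 \<Rightarrow> 'a) \<Rightarrow> 'a form0 \<Rightarrow>
      (3 \<Rightarrow> real) \<times> (3 \<Rightarrow> 'a \<Rightarrow>\<^sub>L real) \<times> (3 \<Rightarrow> real)"
  where "dof0 V WE \<nu> u =
    (\<lambda>i. u (V i), \<lambda>i. d0 (closed_triangle V) u (V i), \<lambda>i. edge_eval WE \<nu> i (d0 (closed_triangle V) u))"

definition dof1 ::
    "(3 \<Rightarrow> 'a::euclidean_space) \<Rightarrow> (3 \<Rightarrow> 'a) \<Rightarrow> (3 \<Rightarrow> 'a) \<Rightarrow> 'a form1 \<Rightarrow>
      (3 \<Rightarrow> 'a \<Rightarrow>\<^sub>L real) \<times> (3 \<Rightarrow> 'a \<Rightarrow>\<^sub>L 'a \<Rightarrow>\<^sub>L real) \<times> (3 \<Rightarrow> real) \<times> (3 \<Rightarrow> real)"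
  where "dof1 V WE \<nu> u =
    (\<lambda>i. u (V i), \<lambda>i. d1 V u (V i), \<lambda>i. edge_eval WE \<nu> i u, \<lambda>i. edge_integral V i u)"

definition dof2 ::
    "(3 \<Rightarrow> 'a::euclidean_space) \<Rightarrow> 'a form2 \<Rightarrow> (3 \<Rightarrow> 'a \<Rightarrow>\<^sub>L 'a \<Rightarrow>\<^sub>L real) \<times> real"
  where "dof2 V w = (\<lambda>i. w (V i), integral2 V w)"

definition I0 ::
    "(3 \<Rightarrow> 'a::euclidean_space) \<Rightarrow> 'a \<Rightarrow> (3 \<Rightarrow> 'a) \<Rightarrow> (3 \<Rightarrow> 'a) \<Rightarrow> 'a form0 \<Rightarrow> 'a form0"
  where "I0 V W WE \<nu> u = (THE v. v \<in> C1P3_form0 V W \<and> dof0 V WE \<nu> v = dof0 V WE \<nu> u)"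

definition I1 ::
    "(3 \<Rightarrow> 'a::euclidean_space) \<Rightarrow> 'a \<Rightarrow> (3 \<Rightarrow> 'a) \<Rightarrow> (3 \<Rightarrow> 'a) \<Rightarrow> 'a form1 \<Rightarrow> 'a form1"
  where "I1 V W WE \<nu> u = (THE v. v \<in> C0dP2_form1 V W \<and> dof1 V WE \<nu> v = dof1 V WE \<nu> u)"

definition I2 :: "(3 \<Rightarrow> 'a::euclidean_space) \<Rightarrow> 'a \<Rightarrow> 'a form2 \<Rightarrow> 'a form2"
  where "I2 V W u = (THE v. v \<in> C0P1_form2 V W \<and> dof2 V v = dof2 V u)"

end

theory Submission
  imports Defs
begin

text \<open>
  Everything is written in the barycentric coordinates \<open>\<lambda>\<^sub>i\<close> of the triangle. With \<open>a\<^sub>i = \<lambda>\<^sub>i(W) > 0\<close> the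
  subtriangle opposite to \<open>V\<^sub>l\<close> is the part of \<open>T\<close> where \<open>\<lambda>\<^sub>l/a\<^sub>l\<close> is the smallest of the three quotients,
  and the minimum \<open>m\<close> of the quotients is the hat function of \<open>W\<close>. The kinks of \<open>m\<close> lie on the interior
  edges, and \<open>\<lambda>\<^sub>i - a\<^sub>i m\<close> is the nodal function of \<open>V\<^sub>i\<close>.

  \<^bold>\<open>0-forms.\<close> For the edge opposite to \<open>V\<^sub>k\<close>, with end points \<open>V\<^sub>i\<close> and \<open>V\<^sub>j\<close>, the function
  \<open>\<integral>\<^sub>0\<^sup>m (\<lambda>\<^sub>i - a\<^sub>i s)(\<lambda>\<^sub>j - a\<^sub>j s) ds\<close> is a piecewise cubic whose partial derivative in \<open>m\<close> is the product of
  two nodal functions. This product vanishes outside the subtriangle at the edge, hence wherever the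
  gradient of \<open>m\<close> jumps, and so the function is of class \<open>C\<^sup>1\<close>. These three edge bubbles
  (\<open>bubble_local\<close>) and a cubic Hermite interpolant realise all values of the twelve degrees of freedom
  (\<open>dof0_surj\<close>). Conversely, vanishing degrees of freedom make the element divisible by \<open>m\<^sup>2\<close> on each
  subtriangle, so it is \<open>m\<^sup>2 \<Lambda> + E m\<^sup>3\<close> with a globally affine \<open>\<Lambda>\<close>; continuity of the gradient at \<open>W\<close>
  and at the midpoints of the interior edges forces \<open>\<Lambda> = 0\<close> and \<open>E = 0\<close> (\<open>unisolvence0\<close>).

  \<^bold>\<open>2-forms.\<close> Continuous piecewise affine functions are the combinations of \<open>\<lambda>\<^sub>0\<close>, \<open>\<lambda>\<^sub>1\<close>, \<open>\<lambda>\<^sub>2\<close> and \<open>m\<close>. The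
  vertex values give the first three coefficients, and the integral gives the last one because \<open>m\<close> has
  positive integral (\<open>dof2_bij\<close>).

  \<^bold>\<open>Exactness.\<close> A closed piecewise quadratic 1-form is integrated along the segments from \<open>W\<close>; Simpson's
  rule does this exactly and gives the primitive in closed form (\<open>d0_exact\<close>). A piecewise affine 2-form
  is a constant plus a function that is homogeneous of degree 1 about \<open>W\<close>, and for a density \<open>g\<close> that is
  homogeneous of degree \<open>k\<close> about \<open>W\<close> one has \<open>d(g \<iota>\<^sub>y vol) = (k + 2) g vol\<close>, where \<open>y = x - W\<close>
  (\<open>has_d1_koszul\<close>, \<open>d1_surj\<close>).

  \<^bold>\<open>1-forms.\<close> Their degrees of freedom are handled by the two other spaces: the exterior derivative is
  found from its vertex values and its integral, which by Stokes' theorem is the sum of the edge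
  integrals, and what remains is the gradient of an element of the first space (\<open>dof1_bij\<close>).

  \<^bold>\<open>Analysis.\<close> Exterior derivatives of 1-forms are weak. They are unique, and on a subtriangle they agree
  with the pointwise ones, because smooth bump functions exist (\<open>has_d1_unique\<close>, \<open>has_d1_local\<close>).
  Gradients are weakly closed because second derivatives of test functions are symmetric (\<open>has_d1_d0\<close>).
  Stokes' theorem holds for every continuous 1-form with continuous weak derivative (\<open>stokes\<close>): it is the
  limit of the defining identity for cut-off functions that converge to the indicator of \<open>T\<close>. Stokes'
  theorem is also the reason why the interpolators commute with the exterior derivatives.
\<close>

section \<open>Dimensions and derivatives\<close>

text \<open>
  The hypotheses on \<open>F\<close> are confined to \<open>S\<close> because exterior derivatives are linear only on the forms
  that have one. The inverse of \<open>F\<close>, in contrast, is linear on the whole Euclidean space and carries its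
  standard basis to a basis of \<open>S\<close>.
\<close>

lemma dim_linear_bij:
  fixes F :: "'b::real_vector \<Rightarrow> 'c::euclidean_space"
  assumes S: "subspace S"
    and add: "\<And>x y. x \<in> S \<Longrightarrow> y \<in> S \<Longrightarrow> F (x + y) = F x + F y"
    and scale: "\<And>c x. x \<in> S \<Longrightarrow> F (c *\<^sub>R x) = c *\<^sub>R F x"
    and bij: "bij_betw F S UNIV"
  shows "dim S = DIM('c)"
proof -
  define g where "g = inv_into S F"
  have gS: "g y \<in> S" for y using bij by (simp add: g_def bij_betw_def inv_into_into)
  have Fg: "F (g y) = y" for y using bij by (simp add: g_def bij_betw_def f_inv_into_f)
  have gF: "g (F x) = x" if "x \<in> S" for x
    using bij that by (simp add: g_def bij_betw_def)
  have lin: "linear g"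
  proof (rule linearI)
    fix a b c
    show "g (a + b) = g a + g b"
      using gF[of "g a + g b"] by (simp add: add gS Fg subspace_add[OF S])
    show "g (c *\<^sub>R a) = c *\<^sub>R g a"
      using gF[of "c *\<^sub>R g a"] by (simp add: scale gS Fg subspace_scale[OF S])
  qed
  have inj: "inj g" by (metis Fg injI)
  have rng: "range g = S" using gS gF by (metis image_subset_iff subsetI subset_antisym rangeI)
  have ind: "independent (g ` Basis)"
    using linear_independent_injective_image[OF lin independent_Basis] inj
    by (auto intro: inj_on_subset)
  have "span (g ` Basis) = S" using linear_span_image[OF lin, of Basis] rng by simp
  then have "dim S = card (g ` Basis)" using dim_span_eq_card_independent[OF ind] by simp
  also have "\<dots> = DIM('c)" using inj by (meson card_image inj_on_subset subset_UNIV)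
  finally show ?thesis .
qed

text \<open>
  Directional derivatives towards points of a convex set are determined by the values on the set, and
  the directions towards the points of a ball span the space. Boundary points of \<open>S\<close> are included, as
  is needed at the vertices of a triangle.
\<close>

lemma has_derivative_unique_within_convex:
  fixes f :: "'b::real_normed_vector \<Rightarrow> 'c::real_normed_vector"
  assumes S: "convex S" and ne: "interior S \<noteq> {}" and x: "x \<in> S"
    and f1: "(f has_derivative f1) (at x within S)"
    and f2: "(f has_derivative f2) (at x within S)"
  shows "f1 = f2"
proof -
  define d where "d = (\<lambda>v. f1 v - f2 v)"
  have d: "((\<lambda>_. 0) has_derivative d) (at x within S)"
    using has_derivative_diff[OF f1 f2] by (simp add: d_def)
  then have lin: "linear d" using has_derivative_linear by blast
  have zero: "d (y - x) = 0" if y: "y \<in> S" for y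
  proof -
    let ?l = "\<lambda>t. x + t *\<^sub>R (y - x)"
    have img: "?l ` {0..1} \<subseteq> S"
      using S x y by (force simp: convex_alt algebra_simps)
    have l: "(?l has_derivative (\<lambda>t. t *\<^sub>R (y - x))) (at 0 within {0..1})"
      by (auto intro!: derivative_eq_intros)
    have "((\<lambda>_. 0) \<circ> ?l has_derivative d \<circ> (\<lambda>t. t *\<^sub>R (y - x))) (at 0 within {0..1})"
      by (rule diff_chain_within[OF l]) (use has_derivative_subset[OF d img] in simp)
    then have "((\<lambda>_. 0) has_vector_derivative d (y - x)) (at (0::real) within {0..1})"
      unfolding has_vector_derivative_def
      by (simp add: o_def linear_scale[OF lin])
    moreover have "((\<lambda>_. 0) has_vector_derivative 0) (at (0::real) within {0..1})"
      by simp
    ultimately show ?thesis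
      by (metis vector_derivative_unique_within_closed_interval[of 0 1 0 "\<lambda>_. 0"]
          atLeastAtMost_iff cbox_interval order_refl zero_less_one zero_le_one)
  qed
  obtain z e where e: "e > 0" "ball z e \<subseteq> S"
    using ne by (meson equals0I mem_interior)
  have "d v = 0" for v
  proof (cases "v = 0")
    case True then show ?thesis using linear_0[OF lin] by simp
  next
    case False
    define c where "c = e / (2 * norm v)"
    have c: "c > 0" using e False by (simp add: c_def)
    have "z + c *\<^sub>R v \<in> S" "z \<in> S"
      using e False by (auto simp: c_def dist_norm intro!: subsetD[OF e(2)])
    then have "d (z + c *\<^sub>R v - x) = 0" "d (z - x) = 0" using zero by blast+
    then have "d (c *\<^sub>R v) = 0" by (simp add: linear_diff[OF lin] linear_add[OF lin])
    then show ?thesis using c by (simp add: linear_scale[OF lin])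
  qed
  then show ?thesis by (auto simp: d_def fun_eq_iff)
qed

lemma DERIV_compose_has_derivative:
  fixes f :: "'b::real_normed_vector \<Rightarrow> real"
  assumes f: "\<And>x. (f has_derivative f' x) (at x)" and g: "(g has_vector_derivative v) (at s)"
  shows "((\<lambda>r. f (g r)) has_real_derivative f' (g s) v) (at s)"
proof -
  have "((\<lambda>r. f (g r)) has_derivative (\<lambda>h. f' (g s) (h *\<^sub>R v))) (at s)"
    using has_derivative_compose[OF g[unfolded has_vector_derivative_def] f] .
  then show ?thesis
    using linear_scale[OF has_derivative_linear[OF f]]
    by (simp add: has_field_derivative_def mult_commute_abs)
qed

section \<open>Smooth functions\<close>

lemma frechet_derivative_eqI:
  "(f has_derivative f') (at x) \<Longrightarrow> frechet_derivative f (at x) = f'"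
  by (metis frechet_derivative_at)

lemma C_k_continuous: "C_k k f \<Longrightarrow> continuous_on UNIV f"
  by (cases k) (auto simp: continuous_on_eq_continuous_at differentiable_imp_continuous_within)

lemma C_k_SucD: "C_k (Suc k) f \<Longrightarrow> C_k k f"
proof (induction k arbitrary: f)
  case 0
  then show ?case using C_k_continuous[of "Suc 0" f] by simp
next
  case (Suc k)
  then show ?case by (metis C_k.simps(2))
qed

lemma C_k_SucI:
  assumes "\<And>x. (f has_derivative f' x) (at x)" and "\<And>v. C_k k (\<lambda>x. f' x v)"
  shows "C_k (Suc k) f"
  using assms by (auto simp: frechet_derivative_eqI[OF assms(1)] differentiable_def)

lemma C_k_SucE:
  assumes "C_k (Suc k) f"
  shows "(f has_derivative frechet_derivative f (at x)) (at x)"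
    and "C_k k (\<lambda>x. frechet_derivative f (at x) v)"
  using assms by (auto simp: frechet_derivative_works)

lemma C_k_const: "C_k k (\<lambda>_. c)"
  by (induction k arbitrary: c) (auto intro: C_k_SucI[where f' = "\<lambda>_ _. 0"])

lemma C_k_add: "C_k k f \<Longrightarrow> C_k k g \<Longrightarrow> C_k k (\<lambda>x. f x + g x)"
proof (induction k arbitrary: f g)
  case 0 then show ?case by (auto intro: continuous_on_add)
next
  case (Suc k)
  show ?case
    by (rule C_k_SucI[OF has_derivative_add[OF C_k_SucE(1)[OF Suc.prems(1)] C_k_SucE(1)[OF Suc.prems(2)]]])
      (use Suc in \<open>auto\<close>)
qed

lemma C_k_mult: "C_k k f \<Longrightarrow> C_k k g \<Longrightarrow> C_k k (\<lambda>x. f x * g x)"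
proof (induction k arbitrary: f g)
  case 0 then show ?case by (auto intro: continuous_on_mult)
next
  case (Suc k)
  note E = C_k_SucE[OF Suc.prems(1)] C_k_SucE[OF Suc.prems(2)]
  show ?case
    by (rule C_k_SucI[OF has_derivative_mult[OF E(1) E(3)]])
      (use E C_k_SucD[OF Suc.prems(1)] C_k_SucD[OF Suc.prems(2)] in \<open>auto intro!: C_k_add Suc.IH\<close>)
qed

lemma C_k_affine_compose:
  fixes l :: "'a::euclidean_space \<Rightarrow> 'b::euclidean_space"
  assumes l: "bounded_linear l"
  shows "C_k k f \<Longrightarrow> C_k k (\<lambda>x. f (l x + c))"
proof (induction k arbitrary: f)
  case 0
  have "continuous_on UNIV l" using l by (simp add: linear_continuous_on)
  with 0 show ?case by (auto intro!: continuous_on_compose2[of UNIV f] continuous_intros)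
next
  case (Suc k)
  have "((\<lambda>x. f (l x + c)) has_derivative (\<lambda>v. frechet_derivative f (at (l x + c)) (l v))) (at x)" for x
    by (rule has_derivative_compose[of "\<lambda>x. l x + c" l _ _ f])
      (use l C_k_SucE(1)[OF Suc.prems] in
        \<open>auto intro!: derivative_eq_intros bounded_linear_imp_has_derivative\<close>)
  then show ?case
    by (rule C_k_SucI) (use Suc in auto)
qed

lemma C_k_real_SucI:
  assumes "\<And>x. (f has_real_derivative f' x) (at x)" and "C_k k f'"
  shows "C_k (Suc k) f"
  by (rule C_k_SucI[of f "\<lambda>x v. f' x * v"])
    (use assms in \<open>auto simp: has_field_derivative_def intro!: C_k_mult C_k_const\<close>)

text \<open>
  The family is closed under differentiation up to linear combinations, so that its smoothness
  follows by one induction for all \<open>n\<close> together.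
\<close>

definition exp_recip :: "nat \<Rightarrow> real \<Rightarrow> real" where
  "exp_recip n t = (if t > 0 then exp (- (1 / t)) / t ^ n else 0)"

lemma exp_recip_lim0: "(exp_recip n \<longlongrightarrow> 0) (at 0)"
proof -
  have "((\<lambda>t::real. exp (- (1 / t)) / t ^ n) \<longlongrightarrow> 0) (at_right 0)"
  proof -
    have "((\<lambda>x::real. x ^ n / exp x) \<longlongrightarrow> 0) at_top" by (rule tendsto_power_div_exp_0)
    then have "((\<lambda>t::real. inverse t ^ n / exp (inverse t)) \<longlongrightarrow> 0) (at_right 0)"
      by (rule filterlim_compose[OF _ filterlim_inverse_at_top_right])
    then show ?thesis
      by (simp add: exp_minus field_simps inverse_eq_divide)
  qed
  then have r: "(exp_recip n \<longlongrightarrow> 0) (at_right 0)"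
    by (rule Lim_transform_eventually)
      (auto simp: exp_recip_def eventually_at_right_less intro!: eventually_mono[OF eventually_at_right_less])
  have l: "(exp_recip n \<longlongrightarrow> 0) (at_left 0)"
  proof (rule Lim_transform_eventually[OF tendsto_const])
    show "\<forall>\<^sub>F x in at_left 0. 0 = exp_recip n x"
      by (rule eventually_at_leftI[of "-1"]) (auto simp: exp_recip_def)
  qed
  show ?thesis using l r by (simp add: filterlim_split_at)
qed

lemma exp_recip_deriv:
  "(exp_recip n has_real_derivative exp_recip (n + 2) t - real n * exp_recip (Suc n) t) (at t)"
proof (cases t "0::real" rule: linorder_cases)
  case less
  have "((\<lambda>_. 0) has_real_derivative 0) (at t)" by simp
  then have "(exp_recip n has_real_derivative 0) (at t)"
    by (rule has_field_derivative_transform_within_open[of _ _ _ "{..<0}"])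
      (use less in \<open>auto simp: exp_recip_def\<close>)
  then show ?thesis using less by (simp add: exp_recip_def)
next
  case greater
  have "((\<lambda>t. exp (- (1 / t)) / t ^ n) has_real_derivative
      exp_recip (n + 2) t - real n * exp_recip (Suc n) t) (at t)"
  proof -
    have "((\<lambda>t. exp (- (1 / t))) has_real_derivative exp (- (1 / t)) / t\<^sup>2) (at t)"
      using greater by (auto intro!: derivative_eq_intros simp: power2_eq_square)
    from DERIV_divide[OF this DERIV_pow[of n t]] greater
    have "((\<lambda>t. exp (- (1 / t)) / t ^ n) has_real_derivative
        (exp (- (1 / t)) / t\<^sup>2 * t ^ n - exp (- (1 / t)) * (real n * t ^ (n - Suc 0))) / (t ^ n * t ^ n)) (at t)"
      by simp
    then show ?thesis
      by (rule DERIV_cong) (use greater in \<open>cases n; simp add: exp_recip_def field_simps power2_eq_square\<close>)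
  qed
  then show ?thesis
    by (rule has_field_derivative_transform_within_open[of _ _ _ "{0<..}"])
      (use greater in \<open>auto simp: exp_recip_def\<close>)
next
  case equal
  have "((\<lambda>h. exp_recip n h / h) \<longlongrightarrow> 0) (at 0)"
  proof (rule Lim_transform_eventually[OF exp_recip_lim0[of "Suc n"]])
    show "\<forall>\<^sub>F x in at 0. exp_recip (Suc n) x = exp_recip n x / x"
      by (rule always_eventually) (auto simp: exp_recip_def)
  qed
  moreover have "exp_recip k 0 = 0" for k by (simp add: exp_recip_def)
  ultimately show ?thesis using equal by (simp add: DERIV_def)
qed

lemma C_k_exp_recip: "C_k k (exp_recip n)"
proof (induction k arbitrary: n)
  case 0
  have "isCont (exp_recip n) x" for x using exp_recip_deriv by (rule DERIV_isCont)
  then show ?case by (simp add: continuous_on_eq_continuous_at)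
next
  case (Suc k)
  have "C_k k (\<lambda>t. exp_recip (n + 2) t + (- real n) * exp_recip (Suc n) t)"
    by (intro C_k_add C_k_mult C_k_const Suc)
  then show ?case
    by (intro C_k_real_SucI[OF exp_recip_deriv]) simp
qed


text \<open>
  The step is the normalised primitive of \<open>exp(- 1/(t - 1)) exp(- 1/(2 - t))\<close> on \<open>[1, 2]\<close>. The
  step is flat below 1, and not just below 0, so that \<open>step(\<lambda>/\<epsilon>)\<close> vanishes in a whole neighbourhood
  of the line \<open>\<lambda> = 0\<close>.
\<close>

lemma smooth_step_exists:
  obtains step step' :: "real \<Rightarrow> real"
  where "\<And>k. C_k k step" and "\<And>k. C_k k step'"
    and "\<And>t. (step has_real_derivative step' t) (at t)"
    and "\<And>t. 0 \<le> step' t" and "\<And>t. t \<le> 1 \<or> 2 \<le> t \<Longrightarrow> step' t = 0"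
    and "\<And>t. t \<le> 1 \<Longrightarrow> step t = 0" and "\<And>t. 2 \<le> t \<Longrightarrow> step t = 1"
    and "\<And>t. 0 \<le> step t" and "\<And>t. step t \<le> 1"
proof -
  define p where "p t = exp_recip 0 (t - 1) * exp_recip 0 (2 - t)" for t :: real
  have Cp: "C_k k p" for k
  proof -
    have "C_k k (\<lambda>t::real. exp_recip 0 (t + - 1))"
      by (rule C_k_affine_compose[OF bounded_linear_ident C_k_exp_recip])
    moreover have "C_k k (\<lambda>t::real. exp_recip 0 (- t + 2))"
      by (rule C_k_affine_compose[OF bounded_linear_minus[OF bounded_linear_ident] C_k_exp_recip])
    ultimately have "C_k k (\<lambda>t::real. exp_recip 0 (t + - 1) * exp_recip 0 (- t + 2))"
      by (rule C_k_mult)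
    then show ?thesis by (simp add: p_def[abs_def] algebra_simps)
  qed
  have cont: "continuous_on A p" for A
    using C_k_continuous[OF Cp] continuous_on_subset by blast
  have p0: "0 \<le> p t" for t by (simp add: p_def exp_recip_def)
  have pz: "p t = 0" if "t \<le> 1 \<or> 2 \<le> t" for t using that by (auto simp: p_def exp_recip_def)
  define X where "X t = integral {0..t} p" for t
  have int: "p integrable_on {a..b}" for a b
    by (rule integrable_continuous_real[OF cont])
  have X1: "X t = 0" if "t \<le> 1" for t
  proof -
    have "X t = integral {0..t} (\<lambda>_. 0)" unfolding X_def
      by (rule integral_cong) (use that pz in auto)
    then show ?thesis by simp
  qed
  have X2: "X t = X 2" if "2 \<le> t" for t
  proof -
    have "integral {2..t} p = integral {2..t} (\<lambda>_. 0)"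
      by (rule integral_cong) (use pz in auto)
    then show ?thesis
      using Henstock_Kurzweil_Integration.integral_combine[of 0 2 t p] that int by (simp add: X_def)
  qed
  have dX: "(X has_real_derivative p t) (at t)" for t
  proof (cases "t < 1")
    case True
    have "((\<lambda>_. 0) has_real_derivative p t) (at t)" using True pz by simp
    then show ?thesis
      by (rule has_field_derivative_transform_within_open[of _ _ _ "{..<1}"]) (use True X1 in auto)
  next
    case False
    have "(X has_real_derivative p t) (at t within {0..t + 1})"
      unfolding X_def using False by (intro integral_has_real_derivative cont) auto
    then show ?thesis
      by (subst (asm) at_within_Icc_at) (use False in auto)
  qed
  have mono: "X s \<le> X t" if "s \<le> t" for s t
    by (rule DERIV_nonneg_imp_nondecreasing[OF that]) (use dX p0 in blast)
  have pos: "X 2 > 0"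
  proof -
    have "X 2 \<noteq> 0"
    proof
      assume "X 2 = 0"
      then have "\<forall>x\<in>{0..2}. p x = 0"
        using integral_eq_0_iff[of 0 2 p] cont p0 by (simp add: X_def)
      then have "p (3/2) = 0" by (rule bspec) simp
      then show False by (simp add: p_def exp_recip_def)
    qed
    then show ?thesis using mono[of 0 2] X1[of 0] by simp
  qed
  have CX: "C_k k (\<lambda>t. X t / X 2)" "C_k k (\<lambda>t. p t / X 2)" for k
  proof -
    have "C_k k X"
    proof (cases k)
      case 0
      have "isCont X x" for x using dX by (rule DERIV_isCont)
      then show ?thesis using 0 by (simp add: continuous_on_eq_continuous_at)
    next
      case (Suc n) then show ?thesis using C_k_real_SucI[OF dX Cp] by simp
    qed
    from C_k_mult[OF this C_k_const[of k "1 / X 2"]] C_k_mult[OF Cp C_k_const[of k "1 / X 2"]]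
    show "C_k k (\<lambda>t. X t / X 2)" "C_k k (\<lambda>t. p t / X 2)" by simp_all
  qed
  show thesis
  proof (rule that[of "\<lambda>t. X t / X 2" "\<lambda>t. p t / X 2"])
    show "((\<lambda>t. X t / X 2) has_real_derivative p t / X 2) (at t)" for t
      using dX by (rule DERIV_cdivide)
    show "0 \<le> X t / X 2" for t using mono[of 0 t] X1[of t] X1[of 0] pos by (cases "t \<le> 1") auto
    show "X t / X 2 \<le> 1" for t using mono[of t 2] X2[of t] pos by (cases "t \<le> 2") auto
    show "X t / X 2 = 1" if "2 \<le> t" for t using X2[OF that] pos by simp
  qed (use CX X1 pz p0 pos in auto)
qed

text \<open>
  Differentiating \<open>f(x + sa + tb) - f(x + tb) = \<integral>\<^sub>0\<^sup>s D\<^sub>a f(x + \<sigma>a + tb) d\<sigma>\<close> under the integral in \<open>t\<close>,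
  and then in \<open>s\<close> at \<open>s = 0\<close>, gives \<open>D\<^sub>a D\<^sub>b f = D\<^sub>b D\<^sub>a f\<close>.
\<close>

lemma symmetric_second_derivative:
  fixes f :: "'a::euclidean_space \<Rightarrow> real"
  assumes f: "C_k 2 f"
  shows "frechet_derivative (\<lambda>y. frechet_derivative f (at y) b) (at x) a =
         frechet_derivative (\<lambda>y. frechet_derivative f (at y) a) (at x) b"
proof -
  define D where "D v y = frechet_derivative f (at y) v" for v y
  define D2 where "D2 v w y = frechet_derivative (D v) (at y) w" for v w y
  have f2: "C_k (Suc (Suc 0)) f" using f by (simp only: numeral_2_eq_2)
  have df: "(f has_derivative (\<lambda>v. D v y)) (at y)" for y
    using C_k_SucE(1)[OF f2] by (simp add: D_def)
  have C1: "C_k (Suc 0) (D v)" for v using C_k_SucE(2)[OF f2] by (simp add: D_def[abs_def])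
  have dD: "(D v has_derivative (\<lambda>w. D2 v w y)) (at y)" for v y
    using C_k_SucE(1)[OF C1] by (simp add: D2_def)
  have contD: "continuous_on UNIV (D v)" for v using C_k_continuous[OF C1] .
  have contD2: "continuous_on UNIV (D2 v w)" for v w
    using C_k_SucE(2)[OF C1] by (simp add: D2_def[abs_def])
  have lin: "D (c *\<^sub>R v) y = c * D v y" "D2 u (c *\<^sub>R v) y = c * D2 u v y" for c u v y
    using linear_scale[OF has_derivative_linear[OF df]]
      linear_scale[OF has_derivative_linear[OF dD]] by simp_all
  have line: "((\<lambda>s. g (y + s *\<^sub>R v)) has_vector_derivative g' (y + s *\<^sub>R v) v) (at s within A)"
    if g: "\<And>z. (g has_derivative g' z) (at z)" for g g' v y s A
  proof -
    have "((\<lambda>s. g (y + s *\<^sub>R v)) has_derivative (\<lambda>h. g' (y + s *\<^sub>R v) (h *\<^sub>R v))) (at s)"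
      by (rule has_derivative_compose[OF _ g]) (auto intro!: derivative_eq_intros)
    then show ?thesis
      using linear_scale[OF has_derivative_linear[OF g]]
      by (simp add: has_vector_derivative_def has_derivative_at_withinI)
  qed
  have key: "D b (x + s *\<^sub>R a) - D b x = integral {0..s} (\<lambda>\<sigma>. D2 a b (x + \<sigma> *\<^sub>R a))" if s: "s \<ge> 0" for s
  proof -
    let ?h = "\<lambda>t. integral {0..s} (\<lambda>\<sigma>. D a (x + \<sigma> *\<^sub>R a + t *\<^sub>R b))"
    have h: "?h t = f (x + t *\<^sub>R b + s *\<^sub>R a) - f (x + t *\<^sub>R b)" for t
    proof (rule integral_unique)
      have "((\<lambda>\<sigma>. D a (x + t *\<^sub>R b + \<sigma> *\<^sub>R a)) has_integral
          f (x + t *\<^sub>R b + s *\<^sub>R a) - f (x + t *\<^sub>R b + 0 *\<^sub>R a)) {0..s}"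
        by (rule fundamental_theorem_of_calculus[OF s line[OF df]])
      then show "((\<lambda>\<sigma>. D a (x + \<sigma> *\<^sub>R a + t *\<^sub>R b)) has_integral
          f (x + t *\<^sub>R b + s *\<^sub>R a) - f (x + t *\<^sub>R b)) {0..s}"
        by (simp add: add.assoc add.commute add.left_commute)
    qed
    have 1: "(?h has_vector_derivative integral {0..s} (\<lambda>\<sigma>. D2 a b (x + \<sigma> *\<^sub>R a + 0 *\<^sub>R b))) (at 0 within UNIV)"
      unfolding cbox_interval[symmetric]
    proof (rule leibniz_rule_vector_derivative)
      fix t \<sigma> :: real
      show "((\<lambda>t. D a (x + \<sigma> *\<^sub>R a + t *\<^sub>R b)) has_vector_derivative D2 a b (x + \<sigma> *\<^sub>R a + t *\<^sub>R b))
          (at t within UNIV)"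
        by (rule line[OF dD])
      show "(\<lambda>\<sigma>. D a (x + \<sigma> *\<^sub>R a + t *\<^sub>R b)) integrable_on cbox 0 s"
        by (intro integrable_continuous continuous_on_compose2[OF contD] continuous_intros) auto
    next
      show "continuous_on (UNIV \<times> cbox 0 s) (\<lambda>(t, \<sigma>). D2 a b (x + \<sigma> *\<^sub>R a + t *\<^sub>R b))"
        unfolding case_prod_beta
        by (intro continuous_on_compose2[OF contD2] continuous_intros) auto
    qed auto
    have 2: "(?h has_vector_derivative D b (x + s *\<^sub>R a + 0 *\<^sub>R b) - D b (x + 0 *\<^sub>R b)) (at 0 within UNIV)"
      using has_vector_derivative_diff[OF line[OF df, of "x + s *\<^sub>R a" b 0 UNIV] line[OF df, of x b 0 UNIV]]
      unfolding h by (simp add: add.assoc add.commute add.left_commute)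
    show ?thesis using vector_derivative_unique_at[OF 1 2] by simp
  qed
  have "((\<lambda>s. integral {0..s} (\<lambda>\<sigma>. D2 a b (x + \<sigma> *\<^sub>R a))) has_vector_derivative D2 a b (x + 0 *\<^sub>R a)) (at 0 within {0..1})"
    by (rule integral_has_vector_derivative)
      (auto intro!: continuous_on_compose2[OF contD2] continuous_intros)
  then have 1: "((\<lambda>s. D b (x + s *\<^sub>R a) - D b x) has_vector_derivative D2 a b x) (at 0 within {0..1})"
    by (intro has_vector_derivative_transform[OF _ key]) auto
  have 2: "((\<lambda>s. D b (x + s *\<^sub>R a) - D b x) has_vector_derivative D2 b a x - 0) (at 0 within {0..1})"
    using has_vector_derivative_diff[OF line[OF dD, of b x a 0 "{0..1}"] has_vector_derivative_const[where c = "D b x"]]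
    by simp
  have "D2 a b x = D2 b a x"
    using vector_derivative_unique_within_closed_interval[of 0 1 0, unfolded cbox_interval, OF _ _ 1 2] by simp
  then show ?thesis by (simp add: D2_def D_def[abs_def])
qed


section \<open>Integrals of compactly supported functions\<close>

lemma has_integral_compact_support:
  fixes f :: "'c::euclidean_space \<Rightarrow> real"
  assumes f: "continuous_on UNIV f" and S: "\<And>x. x \<notin> cbox a b \<Longrightarrow> f x = 0"
  shows "(f has_integral integral UNIV f) UNIV" and "(f has_integral integral UNIV f) (cbox a b)"
    and "integral (cbox a b) f = integral UNIV f"
proof -
  have 1: "(f has_integral integral (cbox a b) f) (cbox a b)"
    using f by (meson continuous_on_subset integrable_continuous integrable_integral subset_UNIV)
  then have 2: "(f has_integral integral (cbox a b) f) UNIV"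
    by (rule has_integral_on_superset) (use S in auto)
  then show 3: "integral (cbox a b) f = integral UNIV f" by (simp add: integral_unique)
  from 1 2 show "(f has_integral integral UNIV f) UNIV" "(f has_integral integral UNIV f) (cbox a b)"
    unfolding 3 by simp_all
qed

lemma integral_affine_compose:
  fixes f :: "'c::euclidean_space \<Rightarrow> real"
  assumes f: "continuous_on UNIV f" and C: "bounded C" and S: "\<And>x. x \<notin> C \<Longrightarrow> f x = 0"
    and m: "m > 0" and box: "\<And>x. m *\<^sub>R x + c \<in> C \<Longrightarrow> x \<in> cbox a b"
  shows "integral (cbox a b) (\<lambda>x. f (m *\<^sub>R x + c)) = integral UNIV f / m ^ DIM('c)"
proof -
  obtain r where r: "C \<subseteq> cbox (- r) r" using bounded_subset_cbox_symmetric[OF C] by blast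
  have "(f has_integral integral UNIV f) (cbox (- r) r)"
    by (rule has_integral_compact_support(2)[OF f]) (use S r in blast)
  from has_integral_affinity'[OF this m, of c]
  have "((\<lambda>x. f (m *\<^sub>R x + c)) has_integral integral UNIV f /\<^sub>R m ^ DIM('c)) UNIV"
  proof (rule has_integral_on_superset)
    fix x assume "x \<notin> cbox ((- r - c) /\<^sub>R m) ((r - c) /\<^sub>R m)"
    then have "m *\<^sub>R x + c \<notin> cbox (- r) r"
      using m by (auto simp: mem_box inner_simps field_simps)
    then show "f (m *\<^sub>R x + c) = 0" using S r by blast
  qed simp
  moreover have "integral (cbox a b) (\<lambda>x. f (m *\<^sub>R x + c)) = integral UNIV (\<lambda>x. f (m *\<^sub>R x + c))"
    by (rule has_integral_compact_support(3))
      (use box S in \<open>auto intro!: continuous_intros continuous_on_compose2[OF f]\<close>)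
  ultimately show ?thesis by (simp add: integral_unique divide_inverse)
qed

text \<open>
  The integral of \<open>x \<mapsto> g(x + tv)\<close> does not depend on \<open>t\<close>; its derivative at \<open>t = 0\<close>, taken under the
  integral sign, is the integral of \<open>g' v\<close>.
\<close>

lemma integral_directional_derivative_zero:
  fixes g :: "'c::euclidean_space \<Rightarrow> real"
  assumes g: "\<And>x. (g has_derivative g' x) (at x)" and cont: "continuous_on UNIV (\<lambda>x. g' x v)"
    and C: "bounded C" and S: "\<And>x. x \<notin> C \<Longrightarrow> g x = 0" "\<And>x. x \<notin> C \<Longrightarrow> g' x v = 0"
  shows "integral UNIV (\<lambda>x. g' x v) = 0"
proof -
  have contg: "continuous_on UNIV g"
    using has_derivative_continuous[OF g] by (simp add: continuous_at_imp_continuous_on)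
  have "bounded ((\<lambda>(x, t). x - t *\<^sub>R v) ` (closure C \<times> {-1..1}))"
    by (intro compact_imp_bounded compact_continuous_image compact_Times)
      (use C in \<open>auto simp: case_prod_beta intro!: continuous_intros\<close>)
  then obtain a where a: "(\<lambda>(x, t). x - t *\<^sub>R v) ` (closure C \<times> {-1..1}) \<subseteq> cbox (- a) a"
    using bounded_subset_cbox_symmetric by blast
  have box: "x \<in> cbox (- a) a" if "x + t *\<^sub>R v \<in> C" "t \<in> {-1..1}" for x t
  proof -
    have "(x + t *\<^sub>R v) - t *\<^sub>R v \<in> (\<lambda>(x, t). x - t *\<^sub>R v) ` (closure C \<times> {-1..1})"
      using that closure_subset by (intro image_eqI[of _ _ "(x + t *\<^sub>R v, t)"]) auto
    then show ?thesis using a by auto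
  qed
  define h where "h t = integral (cbox (- a) a) (\<lambda>x. g (x + t *\<^sub>R v))" for t :: real
  have h: "h t = integral UNIV g" if "t \<in> {-1..1}" for t
    using integral_affine_compose[OF contg C S(1), of 1 "t *\<^sub>R v" "- a" a] box that
    by (simp add: h_def)
  have "(h has_vector_derivative integral (cbox (- a) a) (\<lambda>x. g' (x + 0 *\<^sub>R v) v)) (at 0 within {-1..1})"
    unfolding h_def
  proof (rule leibniz_rule_vector_derivative)
    fix t x
    have "((\<lambda>t. g (x + t *\<^sub>R v)) has_derivative (\<lambda>h. g' (x + t *\<^sub>R v) (h *\<^sub>R v))) (at t)"
      by (rule has_derivative_compose[OF _ g]) (auto intro!: derivative_eq_intros)
    then show "((\<lambda>t. g (x + t *\<^sub>R v)) has_vector_derivative g' (x + t *\<^sub>R v) v) (at t within {-1..1})"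
      using linear_scale[OF has_derivative_linear[OF g]]
      by (simp add: has_vector_derivative_def has_derivative_at_withinI)
    show "(\<lambda>x. g (x + t *\<^sub>R v)) integrable_on cbox (- a) a"
      by (intro integrable_continuous continuous_on_compose2[OF contg] continuous_intros) auto
  next
    show "continuous_on ({-1..1} \<times> cbox (- a) a) (\<lambda>(t, x). g' (x + t *\<^sub>R v) v)"
      unfolding case_prod_beta by (intro continuous_on_compose2[OF cont] continuous_intros) auto
  qed auto
  moreover have "(h has_vector_derivative 0) (at 0 within {-1..1})"
    by (rule has_vector_derivative_transform[OF _ h has_vector_derivative_const]) auto
  ultimately have "integral (cbox (- a) a) (\<lambda>x. g' x v) = 0"
    using vector_derivative_unique_within_closed_interval[of "-1" 1 0 h] by fastforce
  moreover have "integral (cbox (- a) a) (\<lambda>x. g' x v) = integral UNIV (\<lambda>x. g' x v)"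
    by (rule has_integral_compact_support(3)[OF cont]) (use S(2) box[of _ 0] in auto)
  ultimately show ?thesis by simp
qed

text \<open>
  By homogeneity of \<open>g\<close> and a change of variables, \<open>\<integral> g(x) \<phi>(w + t(x - w)) dx\<close> is \<open>t\<close> to the power
  \<open>- (k + dim)\<close> times its value at \<open>t = 1\<close>. Differentiation at \<open>t = 1\<close> gives the identity. In
  effect this is an integration by parts in the radial direction that asks for no derivative of \<open>g\<close>,
  so that \<open>g\<close> may have kinks along rays through \<open>w\<close>.
\<close>

lemma integral_radial_derivative:
  fixes g \<phi> :: "'c::euclidean_space \<Rightarrow> real"
  assumes \<phi>: "\<And>x. (\<phi> has_derivative \<phi>' x) (at x)" and cont: "\<And>v. continuous_on UNIV (\<lambda>x. \<phi>' x v)"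
    and C: "bounded C" and S: "\<And>x. x \<notin> C \<Longrightarrow> \<phi> x = 0" "\<And>x v. x \<notin> C \<Longrightarrow> \<phi>' x v = 0"
    and g: "continuous_on UNIV g"
    and hom: "\<And>x t. t > 0 \<Longrightarrow> g (w + t *\<^sub>R (x - w)) = t ^ k * g x"
  shows "integral UNIV (\<lambda>x. g x * \<phi>' x (x - w)) = - real (k + DIM('c)) * integral UNIV (\<lambda>x. \<phi> x * g x)"
proof -
  let ?U = "{1/2..2::real}"
  have cont\<phi>: "continuous_on UNIV \<phi>"
    using has_derivative_continuous[OF \<phi>] by (simp add: continuous_at_imp_continuous_on)
  have contgp: "continuous_on UNIV (\<lambda>x. \<phi> x * g x)" by (intro continuous_intros cont\<phi> g)
  have exp: "\<phi>' y z = (\<Sum>b\<in>Basis. (z \<bullet> b) * \<phi>' y b)" for y z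
    using Linear_Algebra.linear_componentwise[OF has_derivative_linear[OF \<phi>], of y z 1] by simp
  have "bounded ((\<lambda>(x, t). w + inverse t *\<^sub>R (x - w)) ` (closure C \<times> ?U))"
    by (intro compact_imp_bounded compact_continuous_image compact_Times)
      (use C in \<open>auto simp: case_prod_beta intro!: continuous_intros\<close>)
  then obtain a where a: "(\<lambda>(x, t). w + inverse t *\<^sub>R (x - w)) ` (closure C \<times> ?U) \<subseteq> cbox (- a) a"
    using bounded_subset_cbox_symmetric by blast
  have box: "x \<in> cbox (- a) a" if "t *\<^sub>R x + (w - t *\<^sub>R w) \<in> C" "t \<in> ?U" for x t
  proof -
    have "w + inverse t *\<^sub>R ((t *\<^sub>R x + (w - t *\<^sub>R w)) - w) \<in>
        (\<lambda>(x, t). w + inverse t *\<^sub>R (x - w)) ` (closure C \<times> ?U)"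
      using that closure_subset by (intro image_eqI[of _ _ "(t *\<^sub>R x + (w - t *\<^sub>R w), t)"]) auto
    moreover have "w + inverse t *\<^sub>R ((t *\<^sub>R x + (w - t *\<^sub>R w)) - w) = x"
      using that by (simp add: algebra_simps)
    ultimately show ?thesis using a by auto
  qed
  have hom': "g (t *\<^sub>R x + (w - t *\<^sub>R w)) = t ^ k * g x" if "t > 0" for t x
    using hom[OF that, of x] by (simp add: algebra_simps)
  define h where "h t = integral (cbox (- a) a) (\<lambda>x. g x * \<phi> (t *\<^sub>R x + (w - t *\<^sub>R w)))" for t :: real
  let ?I = "integral UNIV (\<lambda>x. \<phi> x * g x)"
  have h: "h t = ?I / t ^ (k + DIM('c))" if t: "t \<in> ?U" for t
  proof -
    have t0: "t > 0" using t by auto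
    have "h t = integral (cbox (- a) a) (\<lambda>x. (\<phi> (t *\<^sub>R x + (w - t *\<^sub>R w)) * g (t *\<^sub>R x + (w - t *\<^sub>R w))) / t ^ k)"
      unfolding h_def using t0 by (intro integral_cong) (simp add: hom')
    also have "\<dots> = (?I / t ^ DIM('c)) / t ^ k"
      using integral_affine_compose[OF contgp C _ t0, of "w - t *\<^sub>R w" "- a" a] box t S(1) by simp
    finally show ?thesis by (simp add: power_add field_simps)
  qed
  have "(h has_vector_derivative
      integral (cbox (- a) a) (\<lambda>x. g x * \<phi>' (1 *\<^sub>R x + (w - 1 *\<^sub>R w)) (x - w))) (at 1 within ?U)"
    unfolding h_def
  proof (rule leibniz_rule_vector_derivative)
    fix t x
    have "((\<lambda>t. \<phi> (t *\<^sub>R x + (w - t *\<^sub>R w))) has_derivative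
        (\<lambda>h. \<phi>' (t *\<^sub>R x + (w - t *\<^sub>R w)) (h *\<^sub>R (x - w)))) (at t)"
      by (rule has_derivative_compose[OF _ \<phi>])
        (auto intro!: derivative_eq_intros simp: algebra_simps)
    then have "((\<lambda>t. \<phi> (t *\<^sub>R x + (w - t *\<^sub>R w))) has_vector_derivative
        \<phi>' (t *\<^sub>R x + (w - t *\<^sub>R w)) (x - w)) (at t within ?U)"
      using linear_scale[OF has_derivative_linear[OF \<phi>]]
      by (simp add: has_vector_derivative_def has_derivative_at_withinI)
    then show "((\<lambda>t. g x * \<phi> (t *\<^sub>R x + (w - t *\<^sub>R w))) has_vector_derivative
        g x * \<phi>' (t *\<^sub>R x + (w - t *\<^sub>R w)) (x - w)) (at t within ?U)"
      by (auto intro!: derivative_eq_intros)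
    show "(\<lambda>x. g x * \<phi> (t *\<^sub>R x + (w - t *\<^sub>R w))) integrable_on cbox (- a) a"
      by (intro integrable_continuous continuous_on_compose2[OF cont\<phi>] continuous_on_compose2[OF g]
          continuous_intros) auto
  next
    show "continuous_on (?U \<times> cbox (- a) a)
        (\<lambda>(t, x). g x * \<phi>' (t *\<^sub>R x + (w - t *\<^sub>R w)) (x - w))"
      unfolding case_prod_beta exp[of _ "_ - w"]
      by (intro continuous_on_compose2[OF cont] continuous_on_compose2[OF g] continuous_intros) auto
  qed auto
  moreover have "(h has_vector_derivative - real (k + DIM('c)) * ?I) (at 1 within ?U)"
  proof (rule has_vector_derivative_transform[OF _ h])
    have "((\<lambda>t. ?I / t ^ (k + DIM('c))) has_real_derivative - real (k + DIM('c)) * ?I) (at 1 within ?U)"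
      by (auto intro!: derivative_eq_intros simp: algebra_simps)
    then show "((\<lambda>t. ?I / t ^ (k + DIM('c))) has_vector_derivative - real (k + DIM('c)) * ?I) (at 1 within ?U)"
      by (simp add: has_real_derivative_iff_has_vector_derivative)
  qed auto
  ultimately have "integral (cbox (- a) a) (\<lambda>x. g x * \<phi>' x (x - w)) = - real (k + DIM('c)) * ?I"
    using vector_derivative_unique_within_closed_interval[of "1/2" 2 1 h] by fastforce
  moreover have "integral (cbox (- a) a) (\<lambda>x. g x * \<phi>' x (x - w)) = integral UNIV (\<lambda>x. g x * \<phi>' x (x - w))"
  proof (rule has_integral_compact_support(3))
    show "continuous_on UNIV (\<lambda>x. g x * \<phi>' x (x - w))"
      unfolding exp[of _ "_ - w"] by (intro continuous_intros cont g)
  qed (use S(2) box[of 1] in auto)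
  ultimately show ?thesis by simp
qed

section \<open>Polynomial functions\<close>

lemma subspace_polynomials: "subspace (polynomials k)"
  by (simp add: polynomials_def)

lemma polynomials_add: "f \<in> polynomials k \<Longrightarrow> g \<in> polynomials k \<Longrightarrow> (\<lambda>x. f x + g x) \<in> polynomials k"
  using subspace_add[OF subspace_polynomials, of f k g] by (simp add: plus_fun_def)

lemma polynomials_cmult: "f \<in> polynomials k \<Longrightarrow> (\<lambda>x. c * f x) \<in> polynomials k"
  using subspace_scale[OF subspace_polynomials, of f k c] by (simp add: scaleR_fun_def)

lemma polynomials_sum: "(\<And>i. i \<in> I \<Longrightarrow> f i \<in> polynomials k) \<Longrightarrow> (\<lambda>x. \<Sum>i\<in>I. f i x) \<in> polynomials k"
proof (induction I rule: infinite_finite_induct)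
  case (insert i I) then show ?case by (simp add: polynomials_add)
qed (use polynomials_cmult[of _ k 0] subspace_0[OF subspace_polynomials, of k] in \<open>simp_all add: zero_fun_def\<close>)

lemma polynomials_mono: "j \<le> k \<Longrightarrow> f \<in> polynomials j \<Longrightarrow> f \<in> polynomials k"
  unfolding polynomials_def by (rule subsetD[OF span_mono]) (auto intro: order_trans)

lemma polynomials_const: "(\<lambda>_. c) \<in> polynomials k"
proof -
  have "(\<lambda>x. \<Prod>b\<in>Basis. (x \<bullet> b) ^ (\<lambda>_. 0) b) \<in> polynomials k"
    unfolding polynomials_def by (rule span_base) (rule CollectI, rule exI[of _ "\<lambda>_. 0"], simp)
  from polynomials_cmult[OF this, of c] show ?thesis by simp
qed

lemma polynomials_mult:
  assumes f: "f \<in> polynomials j" and g: "g \<in> polynomials k"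
  shows "(\<lambda>x. f x * g x) \<in> polynomials (j + k)"
  using f unfolding polynomials_def[of j]
proof (induction rule: span_induct)
  case (step f)
  then obtain m where f: "f = (\<lambda>x. \<Prod>b\<in>Basis. (x \<bullet> b) ^ m b)" and m: "(\<Sum>b\<in>Basis. m b) \<le> j"
    by blast
  show ?case
    using g unfolding polynomials_def[of k]
  proof (induction rule: span_induct)
    case (step g)
    then obtain n where g: "g = (\<lambda>x. \<Prod>b\<in>Basis. (x \<bullet> b) ^ n b)" and n: "(\<Sum>b\<in>Basis. n b) \<le> k"
      by blast
    show ?case
      unfolding polynomials_def
      by (rule span_base, rule CollectI, rule exI[of _ "\<lambda>b. m b + n b"])
        (use m n in \<open>auto simp: f g power_add prod.distrib sum.distrib\<close>)
  next
    case base
    show ?case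
      using polynomials_const[of 0 "j + k"]
      by (auto simp: subspace_def plus_fun_def scaleR_fun_def zero_fun_def distrib_left mult.left_commute
          intro: polynomials_add polynomials_cmult)
  qed
next
  case base
  show ?case
    using polynomials_const[of 0 "j + k"]
    by (auto simp: subspace_def plus_fun_def scaleR_fun_def zero_fun_def distrib_right mult.assoc
        intro: polynomials_add polynomials_cmult)
qed

lemma polynomials_power: "f \<in> polynomials j \<Longrightarrow> (\<lambda>x. f x ^ n) \<in> polynomials (n * j)"
proof (induction n)
  case 0 then show ?case using polynomials_const[of 1] by simp
next
  case (Suc n) then show ?case using polynomials_mult[of f j "\<lambda>x. f x ^ n"] by simp
qed

lemma polynomials_prod:
  "finite I \<Longrightarrow> (\<And>i. i \<in> I \<Longrightarrow> f i \<in> polynomials (d i)) \<Longrightarrow> (\<lambda>x. \<Prod>i\<in>I. f i x) \<in> polynomials (\<Sum>i\<in>I. d i)"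
proof (induction I rule: finite_induct)
  case empty then show ?case using polynomials_const[of 1] by simp
next
  case (insert i I) then show ?case using polynomials_mult[of "f i" "d i"] by simp
qed

lemma polynomials_affine:
  assumes "linear l"
  shows "(\<lambda>x. l x + c) \<in> polynomials 1"
proof -
  have b: "(\<lambda>x. x \<bullet> b) \<in> polynomials 1" if "b \<in> Basis" for b :: 'a
  proof -
    let ?m = "\<lambda>c. if c = b then 1 else 0 :: nat"
    have eq: "(\<lambda>x. x \<bullet> b) = (\<lambda>x::'a. \<Prod>c\<in>Basis. (x \<bullet> c) ^ ?m c)"
    proof
      fix x :: 'a
      have "(\<Prod>c\<in>Basis. (x \<bullet> c) ^ ?m c) = (\<Prod>c\<in>Basis. if c = b then x \<bullet> c else 1)"
        by (rule prod.cong) auto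
      then show "x \<bullet> b = (\<Prod>c\<in>Basis. (x \<bullet> c) ^ ?m c)" using that by (simp add: prod.delta)
    qed
    have deg: "(\<Sum>c\<in>Basis. ?m c) \<le> 1" using that by (simp add: sum.delta)
    show ?thesis
      unfolding polynomials_def by (rule span_base, rule CollectI, rule exI[of _ ?m], rule conjI, rule eq, rule deg)
  qed
  have "(\<lambda>x. (\<Sum>b\<in>Basis. l b * (x \<bullet> b)) + c) \<in> polynomials 1"
    by (intro polynomials_add polynomials_sum polynomials_cmult polynomials_const b)
  moreover have "(\<lambda>x. l x + c) = (\<lambda>x. (\<Sum>b\<in>Basis. l b * (x \<bullet> b)) + c)"
  proof
    fix x show "l x + c = (\<Sum>b\<in>Basis. l b * (x \<bullet> b)) + c"
      using Linear_Algebra.linear_componentwise[OF assms, of x 1] by (simp add: mult.commute)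
  qed
  ultimately show ?thesis by (simp only:)
qed

lemma polynomials_compose_affine:
  fixes l :: "'a::euclidean_space \<Rightarrow> 'b::euclidean_space"
  assumes l: "linear l" and f: "f \<in> polynomials k"
  shows "(\<lambda>x. f (l x + c)) \<in> polynomials k"
  using f unfolding polynomials_def[of k, where 'a = 'b]
proof (induction rule: span_induct)
  case (step f)
  then obtain m where f: "f = (\<lambda>x. \<Prod>b\<in>Basis. (x \<bullet> b) ^ m b)" and m: "(\<Sum>b\<in>Basis. m b) \<le> k"
    by blast
  have "(\<lambda>x. \<Prod>b\<in>Basis. ((l x + c) \<bullet> b) ^ m b) \<in> polynomials (\<Sum>b\<in>Basis. m b * 1)"
  proof (intro polynomials_prod polynomials_power finite_Basis)
    fix b :: 'b
    have "linear (\<lambda>x. l x \<bullet> b)"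
      using l by (auto intro!: linearI simp: linear_add linear_scale inner_simps)
    from polynomials_affine[OF this, of "c \<bullet> b"]
    show "(\<lambda>x. (l x + c) \<bullet> b) \<in> polynomials 1" by (simp add: inner_simps)
  qed
  then show ?case using polynomials_mono m f by auto
next
  case base
  show ?case
    using polynomials_const[of 0 k]
    by (auto simp: subspace_def plus_fun_def scaleR_fun_def zero_fun_def
        intro: polynomials_add polynomials_cmult)
qed

text \<open>
  The last clause makes the degree bound \<open>k - 1\<close> survive products: for \<open>k = 0\<close> the truncated
  difference is 0, and only the vanishing of \<open>f'\<close> keeps \<open>f' g\<close> within the degree of \<open>g\<close> minus one.
\<close>

definition has_poly_derivative :: "nat \<Rightarrow> ('a::euclidean_space \<Rightarrow> real) \<Rightarrow> bool" where
  "has_poly_derivative k f \<longleftrightarrow> f \<in> polynomials k \<and>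
    (\<exists>f'. (\<forall>x. (f has_derivative f' x) (at x)) \<and> (\<forall>v. (\<lambda>x. f' x v) \<in> polynomials (k - 1)) \<and>
          (k = 0 \<longrightarrow> f' = (\<lambda>_ _. 0)))"

lemma has_poly_derivative_mult:
  assumes "has_poly_derivative j f" "has_poly_derivative k g"
  shows "has_poly_derivative (j + k) (\<lambda>x. f x * g x)"
proof -
  obtain f' where f: "f \<in> polynomials j" "\<forall>x. (f has_derivative f' x) (at x)"
      "\<forall>v. (\<lambda>x. f' x v) \<in> polynomials (j - 1)" "j = 0 \<longrightarrow> f' = (\<lambda>_ _. 0)"
    using assms(1) unfolding has_poly_derivative_def by (elim conjE exE) (rule that)
  obtain g' where g: "g \<in> polynomials k" "\<forall>x. (g has_derivative g' x) (at x)"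
      "\<forall>v. (\<lambda>x. g' x v) \<in> polynomials (k - 1)" "k = 0 \<longrightarrow> g' = (\<lambda>_ _. 0)"
    using assms(2) unfolding has_poly_derivative_def by (elim conjE exE) (rule that)
  have "(\<lambda>x. f x * g' x v) \<in> polynomials (j + k - 1)" for v
    using polynomials_mult[OF f(1) g(3)[rule_format]] g(4) polynomials_const[of 0]
    by (cases k) auto
  moreover have "(\<lambda>x. f' x v * g x) \<in> polynomials (j + k - 1)" for v
    using polynomials_mult[OF f(3)[rule_format] g(1)] f(4) polynomials_const[of 0]
    by (cases j) auto
  ultimately show ?thesis
    unfolding has_poly_derivative_def
    by (intro conjI exI[of _ "\<lambda>x h. f x * g' x h + f' x h * g x"])
      (use f g in \<open>auto intro: polynomials_mult polynomials_add has_derivative_mult\<close>)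
qed

lemma has_poly_derivative_power: "has_poly_derivative j f \<Longrightarrow> has_poly_derivative (n * j) (\<lambda>x. f x ^ n)"
proof (induction n)
  case 0
  then show ?case
    using polynomials_const[of 1 0] polynomials_const[of 0 0] by (auto simp: has_poly_derivative_def)
next
  case (Suc n) then show ?case using has_poly_derivative_mult[of j f _ "\<lambda>x. f x ^ n"] by simp
qed

lemma has_poly_derivative_prod:
  "finite I \<Longrightarrow> (\<And>i. i \<in> I \<Longrightarrow> has_poly_derivative (d i) (f i)) \<Longrightarrow>
    has_poly_derivative (\<Sum>i\<in>I. d i) (\<lambda>x. \<Prod>i\<in>I. f i x)"
proof (induction I rule: finite_induct)
  case empty
  then show ?case
    using polynomials_const[of 1 0] polynomials_const[of 0 0] by (auto simp: has_poly_derivative_def)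
next
  case (insert i I) then show ?case using has_poly_derivative_mult[of "d i" "f i"] by simp
qed

lemma polynomials_has_derivative:
  assumes "f \<in> polynomials k"
  obtains f' where "\<And>x. (f has_derivative f' x) (at x)" "\<And>v. (\<lambda>x. f' x v) \<in> polynomials (k - 1)"
proof -
  have "\<exists>f'. (\<forall>x. (f has_derivative f' x) (at x)) \<and> (\<forall>v. (\<lambda>x. f' x v) \<in> polynomials (k - 1))"
    using assms unfolding polynomials_def[of k]
  proof (induction rule: span_induct)
    case (step f)
    then obtain m where f: "f = (\<lambda>x. \<Prod>b\<in>Basis. (x \<bullet> b) ^ m b)" and m: "(\<Sum>b\<in>Basis. m b) \<le> k"
      by blast
    have "has_poly_derivative (\<Sum>b\<in>Basis. m b * 1) f"
      unfolding f
    proof (intro has_poly_derivative_prod has_poly_derivative_power finite_Basis)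
      fix b :: 'a
      have "linear (\<lambda>x. x \<bullet> b)" by (auto intro!: linearI simp: inner_simps)
      from polynomials_affine[OF this, of 0]
      show "has_poly_derivative 1 (\<lambda>x. x \<bullet> b)"
        unfolding has_poly_derivative_def
        by (auto intro!: exI[of _ "\<lambda>x v. v \<bullet> b"] derivative_eq_intros polynomials_const)
    qed
    then obtain f' where "\<forall>x. (f has_derivative f' x) (at x)"
        "\<forall>v. (\<lambda>x. f' x v) \<in> polynomials ((\<Sum>b\<in>Basis. m b) - 1)"
      unfolding has_poly_derivative_def by auto
    then show ?case
      using m by (intro exI[of _ f']) (auto intro: polynomials_mono[of "(\<Sum>b\<in>Basis. m b) - Suc 0" "k - Suc 0"])
  next
    case base
    show ?case
      unfolding subspace_def Ball_def mem_Collect_eq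
    proof (intro conjI allI impI; (elim exE conjE)?)
      show "\<exists>f'. (\<forall>x. ((0::'a \<Rightarrow> real) has_derivative f' x) (at x)) \<and> (\<forall>v. (\<lambda>x. f' x v) \<in> polynomials (k - 1))"
        by (rule exI[of _ "\<lambda>_ _. 0"]) (simp add: zero_fun_def polynomials_const)
    next
      fix f g :: "'a \<Rightarrow> real" and f' g'
      assume "\<forall>x. (f has_derivative f' x) (at x)" "\<forall>v. (\<lambda>x. f' x v) \<in> polynomials (k - 1)"
        "\<forall>x. (g has_derivative g' x) (at x)" "\<forall>v. (\<lambda>x. g' x v) \<in> polynomials (k - 1)"
      then show "\<exists>h. (\<forall>x. (f + g has_derivative h x) (at x)) \<and> (\<forall>v. (\<lambda>x. h x v) \<in> polynomials (k - 1))"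
        unfolding plus_fun_def
        by (intro exI[of _ "\<lambda>x v. f' x v + g' x v"]) (auto intro: has_derivative_add polynomials_add)
    next
      fix c :: real and f :: "'a \<Rightarrow> real" and f'
      assume "\<forall>x. (f has_derivative f' x) (at x)" "\<forall>v. (\<lambda>x. f' x v) \<in> polynomials (k - 1)"
      then show "\<exists>h. (\<forall>x. (c *\<^sub>R f has_derivative h x) (at x)) \<and> (\<forall>v. (\<lambda>x. h x v) \<in> polynomials (k - 1))"
        unfolding scaleR_fun_def
        by (intro exI[of _ "\<lambda>x v. c * f' x v"]) (auto intro!: derivative_eq_intros polynomials_cmult)
    qed
  qed
  then show thesis using that by blast
qed

text \<open>
  Pulling \<open>f\<close> back to the plane \<open>\<real> \<times> \<real>\<close> along the affine map \<open>(s, t) \<mapsto> x0 + s e + t e'\<close> turns the monomials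
  in the standard basis into \<open>s\<^sup>a t\<^sup>b\<close>. In this form conditions on an element become linear equations
  between finitely many coefficients.
\<close>

lemma polynomials_normal_form:
  fixes e e' :: "'a::euclidean_space"
  assumes f: "f \<in> polynomials n"
  shows "\<exists>c. \<forall>s t. f (x0 + s *\<^sub>R e + t *\<^sub>R e') = (\<Sum>a\<le>n. \<Sum>b\<le>n - a. c a b * s ^ a * t ^ b)"
proof -
  define g where "g = (\<lambda>p::real \<times> real. f ((fst p *\<^sub>R e + snd p *\<^sub>R e') + x0))"
  have "linear (\<lambda>p::real \<times> real. fst p *\<^sub>R e + snd p *\<^sub>R e')"
    by (auto intro!: linearI simp: algebra_simps)
  from polynomials_compose_affine[OF this f, of x0] have "g \<in> polynomials n"
    by (simp add: g_def)
  then have "\<exists>c. \<forall>s t. g (s, t) = (\<Sum>a\<le>n. \<Sum>b\<le>n - a. c a b * s ^ a * t ^ b)"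
    unfolding polynomials_def
  proof (induction rule: span_induct)
    case (step g)
    then obtain m where g: "g = (\<lambda>x::real \<times> real. \<Prod>b\<in>Basis. (x \<bullet> b) ^ m b)" and m: "(\<Sum>b\<in>Basis. m b) \<le> n"
      by blast
    let ?i = "m (1, 0)" and ?j = "m (0, 1)"
    have B: "(Basis :: (real \<times> real) set) = {(1, 0), (0, 1)}" by (auto simp: Basis_prod_def)
    have ij: "?i + ?j \<le> n" using m by (simp add: B)
    have "g (s, t) = (\<Sum>a\<le>n. \<Sum>b\<le>n - a. (if a = ?i then if b = ?j then 1 else 0 else 0) * s ^ a * t ^ b)" for s t
    proof -
      have inner: "(\<Sum>b\<le>N. (if b = j then 1 else 0) * x * t ^ b) = (if j \<le> N then x * t ^ j else 0)"
        for N j :: nat and x :: real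
      proof -
        have "(\<Sum>b\<le>N. (if b = j then 1 else 0) * x * t ^ b) = (\<Sum>b\<le>N. if b = j then x * t ^ b else 0)"
          by (rule sum.cong) auto
        then show ?thesis by (simp add: sum.delta)
      qed
      have "(\<Sum>a\<le>n. \<Sum>b\<le>n - a. (if a = ?i then if b = ?j then 1 else 0 else 0) * s ^ a * t ^ b)
          = (\<Sum>a\<le>n. if a = ?i then (\<Sum>b\<le>n - a. (if b = ?j then 1 else 0) * s ^ a * t ^ b) else 0)"
        by (rule sum.cong) auto
      also have "\<dots> = s ^ ?i * t ^ ?j" using ij by (simp add: sum.delta inner)
      finally show ?thesis by (simp add: g B)
    qed
    then show ?case
      by (intro exI[of _ "\<lambda>a b. if a = ?i then if b = ?j then 1 else 0 else 0"] allI)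
  next
    case base
    show ?case
      unfolding subspace_def Ball_def mem_Collect_eq
    proof (intro conjI allI impI; (elim exE)?)
      show "\<exists>c. \<forall>s t. (0::real \<times> real \<Rightarrow> real) (s, t) = (\<Sum>a\<le>n. \<Sum>b\<le>n - a. c a b * s ^ a * t ^ b)"
        by (rule exI[of _ "\<lambda>_ _. 0"]) simp
    next
      fix f g :: "real \<times> real \<Rightarrow> real" and c d
      assume "\<forall>s t. f (s, t) = (\<Sum>a\<le>n. \<Sum>b\<le>n - a. c a b * s ^ a * t ^ b)"
        "\<forall>s t. g (s, t) = (\<Sum>a\<le>n. \<Sum>b\<le>n - a. d a b * s ^ a * t ^ b)"
      then show "\<exists>c. \<forall>s t. (f + g) (s, t) = (\<Sum>a\<le>n. \<Sum>b\<le>n - a. c a b * s ^ a * t ^ b)"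
        by (intro exI[of _ "\<lambda>a b. c a b + d a b"]) (simp add: sum.distrib distrib_right)
    next
      fix r :: real and f :: "real \<times> real \<Rightarrow> real" and c
      assume "\<forall>s t. f (s, t) = (\<Sum>a\<le>n. \<Sum>b\<le>n - a. c a b * s ^ a * t ^ b)"
      then show "\<exists>c. \<forall>s t. (r *\<^sub>R f) (s, t) = (\<Sum>a\<le>n. \<Sum>b\<le>n - a. c a b * s ^ a * t ^ b)"
        by (intro exI[of _ "\<lambda>a b. r * c a b"]) (simp add: sum_distrib_left scaleR_fun_def mult.assoc)
    qed
  qed
  then show ?thesis by (simp add: g_def add.commute add.left_commute)
qed

section \<open>Barycentric coordinates and the subdivision\<close>

lemma three_eq_zero [simp]: "(3::3) = 0" and four_eq_one [simp]: "(4::3) = 1"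
  by simp_all

lemma forall_mod3: "(\<forall>i::3. P i) \<longleftrightarrow> P 0 \<and> P 1 \<and> P 2"
  unfolding forall_3 three_eq_zero by blast

lemma sum_mod3: "(\<Sum>i\<in>UNIV. f i) = f 0 + f 1 + f (2::3)" for f :: "3 \<Rightarrow> 'b::ab_group_add"
  unfolding sum_3 three_eq_zero by (simp add: algebra_simps)

lemma UNIV_mod3: "(UNIV :: 3 set) = {0, 1, 2}"
  unfolding UNIV_3 three_eq_zero by blast

lemma cyclic_mod3 [simp]:
  "(l::3) + 1 \<noteq> l" "l + 2 \<noteq> l" "l + 1 \<noteq> l + 2" "l \<noteq> l + 1" "l \<noteq> l + 2" "l + 2 \<noteq> l + 1"
  "l + 1 + 1 = l + 2" "l + 1 + 2 = l" "l + 2 + 1 = l" "l + 2 + 2 = l + 1"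
  using exhaust_3[of l] unfolding three_eq_zero by auto

lemma cases_mod3: "i = l \<or> i = l + 1 \<or> i = l + (2::3)"
  using exhaust_3[of l] exhaust_3[of i] unfolding three_eq_zero by auto

lemma forall_cyclic: "(\<forall>i::3. P i) \<longleftrightarrow> P l \<and> P (l + 1) \<and> P (l + 2)"
  using cases_mod3[of _ l] by metis

lemma sum_cyclic: "(\<Sum>i\<in>UNIV. f i) = f l + f (l + 1) + f (l + (2::3))" for f :: "3 \<Rightarrow> 'b::ab_group_add"
proof -
  have "UNIV = {l, l + 1, l + 2}" using cases_mod3[of _ l] by blast
  moreover have "sum f {l, l + 1, l + 2} = f l + f (l + 1) + f (l + 2)"
    by (simp add: add.assoc)
  ultimately show ?thesis by simp
qed

locale triangle =
  fixes V :: "3 \<Rightarrow> 'a::euclidean_space"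
  assumes dim2: "DIM('a) = 2"
    and nondegenerate: "\<not> collinear (range V)"
begin

abbreviation "T \<equiv> closed_triangle V"

definition "e1 = V 1 - V 0"
definition "e2 = V 2 - V 0"

lemma range_V: "range V = {V 0, V 1, V 2}"
  by (auto simp: UNIV_mod3)

lemma dual_basis_exists:
  "\<exists>d :: 3 \<Rightarrow> 'a \<Rightarrow>\<^sub>L real. (\<forall>x. x = d 1 x *\<^sub>R e1 + d 2 x *\<^sub>R e2) \<and>
     d 1 e1 = 1 \<and> d 1 e2 = 0 \<and> d 2 e1 = 0 \<and> d 2 e2 = 1 \<and> (\<forall>v. d 0 v = - d 1 v - d 2 v)"
proof -
  have "range V = {V 1, V 0, V 2}" by (auto simp: range_V)
  then have nc: "\<not> collinear {0, e1, e2}"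
    using nondegenerate by (simp add: collinear_3 e1_def e2_def)
  then have ne: "e1 \<noteq> 0" "e2 \<noteq> 0" and nsc: "\<nexists>c. e2 = c *\<^sub>R e1"
    by (auto simp: collinear_lemma)
  have ne12: "e1 \<noteq> e2" using nsc by (metis scaleR_one)
  have "independent {e2, e1}"
    using ne nsc ne12 by (auto simp: independent_insert span_singleton)
  then have ind: "independent {e1, e2}" by (metis insert_commute)
  have span: "span {e1, e2} = UNIV"
    using ind ne12 card_eq_dim[of "{e1, e2}" UNIV] by (simp add: dim2 subset_antisym)
  obtain g1 where g1: "linear g1" "\<forall>x\<in>{e1, e2}. g1 x = (if x = e1 then 1 else 0 :: real)"
    using linear_independent_extend[OF ind, of "\<lambda>x. if x = e1 then 1 else 0 :: real"] by blast
  obtain g2 where g2: "linear g2" "\<forall>x\<in>{e1, e2}. g2 x = (if x = e2 then 1 else 0 :: real)"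
    using linear_independent_extend[OF ind, of "\<lambda>x. if x = e2 then 1 else 0 :: real"] by blast
  have rep: "x = g1 x *\<^sub>R e1 + g2 x *\<^sub>R e2" for x
  proof (rule linear_eq_on_span[of "\<lambda>x. x" "\<lambda>x. g1 x *\<^sub>R e1 + g2 x *\<^sub>R e2" "{e1, e2}"])
    show "linear (\<lambda>x. g1 x *\<^sub>R e1 + g2 x *\<^sub>R e2)"
      using g1(1) g2(1) by (auto intro!: linearI simp: linear_add linear_scale algebra_simps)
    show "x \<in> span {e1, e2}" using span by simp
  qed (use g1(2) g2(2) ne12 linear_id[unfolded id_def] in auto)
  have [simp]: "blinfun_apply (Blinfun g1) = g1" "blinfun_apply (Blinfun g2) = g2"
    using g1(1) g2(1) by (simp_all add: bounded_linear_Blinfun_apply linear_conv_bounded_linear)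
  show ?thesis
    by (rule exI[of _ "\<lambda>i. if i = 1 then Blinfun g1 else if i = 2 then Blinfun g2
          else - Blinfun g1 - Blinfun g2"])
      (use rep g1(2) g2(2) ne12 in \<open>auto simp: blinfun.bilinear_simps\<close>)
qed

text \<open>
  The differentials of the barycentric coordinates: \<open>dlam 1\<close>, \<open>dlam 2\<close> are the dual basis of \<open>e1\<close>, \<open>e2\<close>,
  and \<open>dlam 0\<close> makes the three sum to zero.
\<close>

definition dlam :: "3 \<Rightarrow> 'a \<Rightarrow>\<^sub>L real" where
  "dlam = (SOME d. (\<forall>x. x = blinfun_apply (d 1) x *\<^sub>R e1 + blinfun_apply (d 2) x *\<^sub>R e2) \<and>
     d 1 e1 = 1 \<and> d 1 e2 = 0 \<and> d 2 e1 = 0 \<and> d 2 e2 = 1 \<and> (\<forall>v. d 0 v = - d 1 v - d 2 v))"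

definition lam :: "3 \<Rightarrow> 'a \<Rightarrow> real" where
  "lam i x = (if i = 0 then 1 else 0) + dlam i (x - V 0)"

lemma dlam_spec: "(\<forall>x. x = dlam 1 x *\<^sub>R e1 + dlam 2 x *\<^sub>R e2) \<and>
    dlam 1 e1 = 1 \<and> dlam 1 e2 = 0 \<and> dlam 2 e1 = 0 \<and> dlam 2 e2 = 1 \<and> (\<forall>v. dlam 0 v = - dlam 1 v - dlam 2 v)"
  using someI_ex[OF dual_basis_exists, folded dlam_def] .

lemma dlam_rep: "x = dlam 1 x *\<^sub>R e1 + dlam 2 x *\<^sub>R e2"
  using dlam_spec by blast

lemma dlam_e [simp]: "dlam 1 e1 = 1" "dlam 1 e2 = 0" "dlam 2 e1 = 0" "dlam 2 e2 = 1"
  and dlam_0: "dlam 0 v = - dlam 1 v - dlam 2 v"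
  using dlam_spec by blast+

lemma dlam_e0 [simp]: "dlam 0 e1 = - 1" "dlam 0 e2 = - 1"
  by (simp_all add: dlam_0 blinfun.bilinear_simps)

lemma dlam_sum: "dlam 0 v + dlam 1 v + dlam 2 v = 0"
  by (simp add: dlam_0 blinfun.bilinear_simps)

lemma lam_sum: "lam 0 x + lam 1 x + lam 2 x = 1"
  using dlam_sum[of "x - V 0"] by (simp add: lam_def)

lemma lam_sum_cyclic: "lam l x + lam (l + 1) x + lam (l + 2) x = 1"
  using sum_cyclic[of "\<lambda>i. lam i x" l] lam_sum[of x] by (simp add: sum_mod3)

lemma lam_add: "lam i (x + v) = lam i x + dlam i v"
  by (simp add: lam_def blinfun.bilinear_simps)

lemma dlam_diff: "dlam i (x - y) = lam i x - lam i y"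
  by (simp add: lam_def blinfun.bilinear_simps)

lemma lam_V [simp]: "lam i (V j) = (if i = j then 1 else 0)"
proof -
  have "\<forall>i j. lam i (V j) = (if i = j then 1 else 0)"
    unfolding forall_mod3 using dlam_e dlam_e0 by (simp add: lam_def e1_def e2_def)
  then show ?thesis by blast
qed

lemma lam_affine: "u + v = 1 \<Longrightarrow> lam i (u *\<^sub>R x + v *\<^sub>R y) = u * lam i x + v * lam i y"
  and lam_affine3: "u + v + w = 1 \<Longrightarrow>
    lam i (u *\<^sub>R x + v *\<^sub>R y + w *\<^sub>R z) = u * lam i x + v * lam i y + w * lam i z"
proof -
  assume "u + v = 1"
  then have u: "u = 1 - v" by simp
  show "lam i (u *\<^sub>R x + v *\<^sub>R y) = u * lam i x + v * lam i y"
    unfolding u lam_def by (simp add: blinfun.bilinear_simps algebra_simps)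
next
  assume "u + v + w = 1"
  then have u: "u = 1 - v - w" by simp
  show "lam i (u *\<^sub>R x + v *\<^sub>R y + w *\<^sub>R z) = u * lam i x + v * lam i y + w * lam i z"
    unfolding u lam_def by (simp add: blinfun.bilinear_simps algebra_simps)
qed

lemma lam_rep: "x = lam 0 x *\<^sub>R V 0 + lam 1 x *\<^sub>R V 1 + lam 2 x *\<^sub>R V 2"
proof -
  have x: "x = V 0 + (lam 1 x *\<^sub>R e1 + lam 2 x *\<^sub>R e2)"
    using dlam_rep[of "x - V 0"] by (simp add: lam_def algebra_simps)
  have "lam 0 x = 1 - lam 1 x - lam 2 x" using lam_sum[of x] by linarith
  then have 0: "lam 0 x *\<^sub>R V 0 = V 0 - lam 1 x *\<^sub>R V 0 - lam 2 x *\<^sub>R V 0"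
    by (simp add: scaleR_left_diff_distrib)
  have "lam 0 x *\<^sub>R V 0 + lam 1 x *\<^sub>R V 1 + lam 2 x *\<^sub>R V 2 = V 0 + (lam 1 x *\<^sub>R e1 + lam 2 x *\<^sub>R e2)"
    unfolding 0 by (simp add: e1_def e2_def algebra_simps)
  then show ?thesis using x by simp
qed

lemma lam_inject: "(\<And>i. lam i x = lam i y) \<Longrightarrow> x = y"
  by (metis lam_rep)

lemma dlam_inject: "(\<And>i. dlam i v = dlam i w) \<Longrightarrow> v = w"
  by (metis dlam_rep)

lemma lam_has_derivative: "(lam i has_derivative dlam i) (at x within S)"
  unfolding lam_def[abs_def]
  by (auto intro!: derivative_eq_intros)

lemma continuous_lam [continuous_intros]:
  "continuous_on S f \<Longrightarrow> continuous_on S (\<lambda>x. lam i (f x))"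
  unfolding lam_def by (intro continuous_intros)

lemma T_iff: "x \<in> T \<longleftrightarrow> (\<forall>i. 0 \<le> lam i x)"
proof
  assume "x \<in> T"
  then obtain u v w where "0 \<le> u" "0 \<le> v" "0 \<le> w" "u + v + w = 1"
    and x: "x = u *\<^sub>R V 0 + v *\<^sub>R V 1 + w *\<^sub>R V 2"
    unfolding closed_triangle_def range_V convex_hull_3 by blast
  then show "\<forall>i. 0 \<le> lam i x" by (simp add: x lam_affine3)
next
  assume "\<forall>i. 0 \<le> lam i x"
  then show "x \<in> T"
    unfolding closed_triangle_def range_V convex_hull_3
    using lam_rep[of x] lam_sum[of x] by blast
qed

lemma convex_T: "convex T" and compact_T: "compact T"
  by (simp_all add: closed_triangle_def convex_convex_hull compact_convex_hull finite_imp_compact)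

lemma V_in_T [simp]: "V i \<in> T"
  by (simp add: T_iff)

lemma open_lam_pos: "open {x. \<forall>i. 0 < lam i x}"
proof -
  have "{x. \<forall>i. 0 < lam i x} = {x. 0 < lam 0 x} \<inter> {x. 0 < lam 1 x} \<inter> {x. 0 < lam 2 x}"
    by (auto simp: forall_mod3)
  then show ?thesis by (auto intro!: open_Int open_Collect_less continuous_intros)
qed

lemma interior_T: "interior T = {x. \<forall>i. 0 < lam i x}"
proof (intro antisym subsetI)
  fix x assume "x \<in> {x. \<forall>i. 0 < lam i x}"
  moreover have "{x. \<forall>i. 0 < lam i x} \<subseteq> T" by (auto simp: T_iff less_imp_le)
  ultimately show "x \<in> interior T" using open_lam_pos interior_maximal by blast
next
  fix x assume x: "x \<in> interior T"
  have "0 < lam i x" for i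
  proof (rule ccontr)
    assume "\<not> 0 < lam i x"
    moreover have "x \<in> T" using x interior_subset by blast
    ultimately have 0: "lam i x = 0" using T_iff by (metis order_le_less)
    obtain e where e: "e > 0" "ball x e \<subseteq> T" using x by (meson mem_interior)
    have ne: "x \<noteq> V i" using 0 by auto
    define d where "d = e / (2 * norm (x - V i))"
    have d: "d > 0" using e ne by (simp add: d_def)
    have "x + d *\<^sub>R (x - V i) \<in> T"
      using e ne by (intro subsetD[OF e(2)]) (simp add: d_def dist_norm)
    then have "0 \<le> lam i (x + d *\<^sub>R (x - V i))" by (simp add: T_iff)
    also have "\<dots> = - d" by (simp add: lam_add blinfun.scaleR_right dlam_diff 0)
    finally show False using d by simp
  qed
  then show "x \<in> {x. \<forall>i. 0 < lam i x}" by simp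
qed

lemma interior_T_nonempty: "interior T \<noteq> {}"
proof -
  have "(1/3) *\<^sub>R V 0 + (1/3) *\<^sub>R V 1 + (1/3) *\<^sub>R V 2 \<in> interior T"
    by (simp add: interior_T lam_affine3 forall_mod3)
  then show ?thesis by blast
qed

lemma T_closure: "T = closure (interior T)"
  using convex_closure_interior[OF convex_T interior_T_nonempty] compact_T
  by (simp add: compact_imp_closed closure_closed)

text \<open>
  The area form, normalised by \<open>vol e1 e2 = 1\<close>. In dimension two it spans the alternating forms, so
  that 2-forms can be treated as scalar functions.
\<close>

definition vol :: "'a \<Rightarrow>\<^sub>L 'a \<Rightarrow>\<^sub>L real" where
  "vol = (blinfun_scaleR_left (dlam 2) o\<^sub>L dlam 1) - (blinfun_scaleR_left (dlam 1) o\<^sub>L dlam 2)"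

lemma vol_apply: "vol v w = dlam 1 v * dlam 2 w - dlam 2 v * dlam 1 w"
  by (simp add: vol_def blinfun.bilinear_simps)

lemma vol_e [simp]: "vol e1 e2 = 1"
  by (simp add: vol_apply)

lemma vol_alternating: "c *\<^sub>R vol \<in> alternating"
  by (simp add: alternating_def vol_apply blinfun.bilinear_simps)

lemma alternating_eq_vol:
  assumes "B \<in> alternating"
  shows "B = B e1 e2 *\<^sub>R vol"
proof (intro blinfun_eqI)
  fix v w
  have alt: "B v v = 0" for v using assms by (simp add: alternating_def)
  have skew: "B v w = - B w v" for v w
    using alt[of "v + w"] alt[of v] alt[of w] by (simp add: blinfun.bilinear_simps)
  have "B v w = B (dlam 1 v *\<^sub>R e1 + dlam 2 v *\<^sub>R e2) (dlam 1 w *\<^sub>R e1 + dlam 2 w *\<^sub>R e2)"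
    using dlam_rep by metis
  also have "\<dots> = B e1 e2 * vol v w"
    using skew[of e2 e1] by (simp add: blinfun.bilinear_simps alt vol_apply algebra_simps)
  finally show "B v w = (B e1 e2 *\<^sub>R vol) v w" by (simp add: blinfun.bilinear_simps)
qed

lemma form1_rep: "u v = u e1 * dlam 1 v + u e2 * dlam 2 v" for u :: "'a \<Rightarrow>\<^sub>L real"
proof -
  have "u v = u (dlam 1 v *\<^sub>R e1 + dlam 2 v *\<^sub>R e2)" by (rule arg_cong[OF dlam_rep])
  also have "\<dots> = u e1 * dlam 1 v + u e2 * dlam 2 v"
    by (simp add: blinfun.add_right blinfun.scaleR_right)
  finally show ?thesis .
qed

end

locale subdivided_triangle = triangle V for V :: "3 \<Rightarrow> 'a::euclidean_space" +
  fixes W :: 'a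
  assumes W_interior: "W \<in> interior T"
begin

text \<open>
  The barycentric coordinates of \<open>W\<close>, written \<open>a\<^sub>i\<close> in the formulas.
\<close>

definition "a i = lam i W"

lemma a_pos: "0 < a i"
  using W_interior by (simp add: interior_T a_def)

definition "K l = convex hull {W, V (l + 1), V (l + 2)}"

lemma subtriangles_eq: "subtriangles V W = range K"
  by (simp add: subtriangles_def K_def[abs_def])

text \<open>
  On \<open>T\<close> this is the piecewise affine function with value 1 at \<open>W\<close> and 0 on the boundary. The formula
  extends it to the plane so that \<open>hat - 1\<close> is positively homogeneous about \<open>W\<close>.
\<close>

definition hat :: "'a \<Rightarrow> real" where
  "hat x = min (lam 0 x / a 0) (min (lam 1 x / a 1) (lam 2 x / a 2))"

text \<open>
  A point \<open>u W + v V (l + 1) + w V (l + 2)\<close> has \<open>\<lambda>\<^sub>l = u a\<^sub>l\<close>, and its two other coordinates exceed \<open>u a\<^sub>j\<close> by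
  \<open>v\<close> and \<open>w\<close>. So \<open>u = \<lambda>\<^sub>l / a\<^sub>l\<close>, and nonnegativity of \<open>v\<close>, \<open>w\<close> is the comparison of the quotients.
\<close>

lemma K_iff: "x \<in> K l \<longleftrightarrow> (\<forall>j. 0 \<le> lam j x) \<and> (\<forall>j. lam l x / a l \<le> lam j x / a j)"
proof
  assume "x \<in> K l"
  then obtain u v w where uvw: "0 \<le> u" "0 \<le> v" "0 \<le> w" "u + v + w = 1"
    and x: "x = u *\<^sub>R W + v *\<^sub>R V (l + 1) + w *\<^sub>R V (l + 2)"
    unfolding K_def convex_hull_3 by blast
  have l: "lam i x = u * a i + v * (if i = l + 1 then 1 else 0) + w * (if i = l + 2 then 1 else 0)" for i
    unfolding x by (simp add: lam_affine3[OF uvw(4)] a_def)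
  show "(\<forall>j. 0 \<le> lam j x) \<and> (\<forall>j. lam l x / a l \<le> lam j x / a j)"
    unfolding forall_cyclic[where l = l] l using uvw a_pos[of l] a_pos[of "l + 1"] a_pos[of "l + 2"]
    by (simp add: add_divide_distrib)
next
  assume x: "(\<forall>j. 0 \<le> lam j x) \<and> (\<forall>j. lam l x / a l \<le> lam j x / a j)"
  define u where "u = lam l x / a l"
  have u: "0 \<le> u" "lam l x = u * a l" "u * a j \<le> lam j x" for j
  proof -
    show "0 \<le> u" "lam l x = u * a l" using x a_pos[of l] by (simp_all add: u_def)
    have "u \<le> lam j x / a j" using x by (simp add: u_def)
    then show "u * a j \<le> lam j x" using a_pos[of j] by (simp add: pos_le_divide_eq)
  qed
  have sum: "a l + a (l + 1) + a (l + 2) = 1"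
    using lam_sum_cyclic[of l W] by (simp add: a_def)
  have "u + (lam (l + 1) x - u * a (l + 1)) + (lam (l + 2) x - u * a (l + 2))
      = u * (1 - a l - a (l + 1) - a (l + 2)) + (lam l x + lam (l + 1) x + lam (l + 2) x)"
    using u(2) by (simp add: algebra_simps)
  also have "\<dots> = 1" using sum lam_sum_cyclic[of l x] by (simp add: algebra_simps)
  finally have one: "u + (lam (l + 1) x - u * a (l + 1)) + (lam (l + 2) x - u * a (l + 2)) = 1" .
  have "x = u *\<^sub>R W + (lam (l + 1) x - u * a (l + 1)) *\<^sub>R V (l + 1) + (lam (l + 2) x - u * a (l + 2)) *\<^sub>R V (l + 2)"
  proof (rule lam_inject)
    fix i
    show "lam i x = lam i (u *\<^sub>R W + (lam (l + 1) x - u * a (l + 1)) *\<^sub>R V (l + 1) + (lam (l + 2) x - u * a (l + 2)) *\<^sub>R V (l + 2))"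
      unfolding lam_affine3[OF one] using cases_mod3[of i l] u(2) by (auto simp: a_def)
  qed
  then show "x \<in> K l"
    unfolding K_def convex_hull_3 using u one by force
qed

lemma hat_K: "x \<in> K l \<Longrightarrow> hat x = lam l x / a l"
proof -
  assume "x \<in> K l"
  then have "\<forall>j. lam l x / a l \<le> lam j x / a j" by (simp add: K_iff)
  moreover have "l = 0 \<or> l = 1 \<or> l = 2" using cases_mod3[of l 0] by simp
  ultimately show ?thesis by (auto simp: hat_def forall_mod3 min_def)
qed

lemma T_eq_K: "T = (\<Union>l. K l)"
proof (intro antisym subsetI)
  fix x assume x: "x \<in> T"
  have "hat x = lam 0 x / a 0 \<or> hat x = lam 1 x / a 1 \<or> hat x = lam 2 x / a 2"
    by (auto simp: hat_def min_def)
  then obtain l where l: "hat x = lam l x / a l" by blast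
  moreover have "hat x \<le> lam j x / a j" for j
    using cases_mod3[of j 0] by (auto simp: hat_def)
  ultimately have "x \<in> K l" using x by (simp add: K_iff T_iff)
  then show "x \<in> (\<Union>l. K l)" by blast
qed (auto simp: K_iff T_iff)

lemma K_subset_T: "K l \<subseteq> T" using T_eq_K by blast

lemma convex_K: "convex (K l)" and compact_K: "compact (K l)"
  by (simp_all add: K_def convex_convex_hull compact_convex_hull finite_imp_compact)

lemma W_in_K [simp]: "W \<in> K l" and V_in_K [simp]: "V (l + 1) \<in> K l" "V (l + 2) \<in> K l"
  by (simp_all add: K_def hull_inc)

lemma continuous_hat: "continuous_on S hat"
  unfolding hat_def using a_pos by (intro continuous_intros continuous_on_min) (simp_all add: less_imp_neq[symmetric])

lemma hat_W [simp]: "hat W = 1"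
  using hat_K[OF W_in_K, of 0] a_pos[of 0] by (simp add: a_def)

lemma hat_V [simp]: "hat (V i) = 0"
  using hat_K[OF V_in_K(1), of "i + 2"] by simp

lemma hat_nonneg: "x \<in> T \<Longrightarrow> 0 \<le> hat x"
  using a_pos by (auto simp: hat_def T_iff intro!: divide_nonneg_pos)

text \<open>
  An open part of \<open>K l\<close> that is dense in it, cut out by strict inequalities; test functions for the
  restriction of a form to \<open>K l\<close> are supported in it.
\<close>

definition "openK l = {x. 0 < lam l x \<and> lam l x / a l < lam (l + 1) x / a (l + 1) \<and>
    lam l x / a l < lam (l + 2) x / a (l + 2)}"

lemma open_openK: "open (openK l)"
  unfolding openK_def using a_pos
  by (intro open_Collect_conj open_Collect_less continuous_intros) (simp_all add: less_imp_neq[symmetric])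

lemma openK_subset: "openK l \<subseteq> K l"
proof
  fix x assume x: "x \<in> openK l"
  then have "0 < lam l x / a l" using a_pos[of l] by (simp add: openK_def)
  then have "0 < lam (l + 1) x / a (l + 1)" "0 < lam (l + 2) x / a (l + 2)"
    using x by (auto simp: openK_def)
  then have "0 < lam (l + 1) x" "0 < lam (l + 2) x"
    using a_pos by (simp_all add: zero_less_divide_iff) (meson less_asym)+
  then show "x \<in> K l"
    unfolding K_iff forall_cyclic[where l = l] using x by (auto simp: openK_def)
qed

lemma K_subset_closure: "K l \<subseteq> closure (openK l)"
proof
  fix x assume x: "x \<in> K l"
  define c where "c = (1/3) *\<^sub>R W + (1/3) *\<^sub>R V (l + 1) + (1/3) *\<^sub>R V (l + 2)"
  have c: "lam i c / a i = 1/3 + (1/3) * (if i = l + 1 then 1 / a i else 0) + (1/3) * (if i = l + 2 then 1 / a i else 0)" for i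
    using a_pos[of i] by (simp add: c_def lam_affine3 a_def[symmetric] add_divide_distrib)
  have t: "(1 - t) *\<^sub>R x + t *\<^sub>R c \<in> openK l" if t: "0 < t" "t \<le> 1" for t
  proof -
    have q: "lam i ((1 - t) *\<^sub>R x + t *\<^sub>R c) / a i = (1 - t) * (lam i x / a i) + t * (lam i c / a i)" for i
      by (simp add: lam_affine add_divide_distrib)
    have strict: "(1 - t) * A + t * C < (1 - t) * B + t * D" if "A \<le> B" "C < D" for A B C D
      using t that by (intro add_le_less_mono mult_left_mono mult_strict_left_mono) auto
    have "0 < lam l ((1 - t) *\<^sub>R x + t *\<^sub>R c) / a l"
      using strict[of 0 "lam l x / a l" 0 "lam l c / a l"] x a_pos[of l] c[of l]
      unfolding q by (simp add: K_iff)
    then have "0 < lam l ((1 - t) *\<^sub>R x + t *\<^sub>R c)"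
      using a_pos[of l] by (simp add: zero_less_divide_iff)
    moreover have "lam l ((1 - t) *\<^sub>R x + t *\<^sub>R c) / a l < lam i ((1 - t) *\<^sub>R x + t *\<^sub>R c) / a i"
      if "i = l + 1 \<or> i = l + 2" for i
      unfolding q
    proof (rule strict)
      show "lam l x / a l \<le> lam i x / a i" using x by (simp add: K_iff)
      show "lam l c / a l < lam i c / a i"
        using that a_pos[of i] unfolding c by auto
    qed
    ultimately show ?thesis by (simp add: openK_def)
  qed
  have "(\<lambda>n. (1 - 1 / real (Suc n)) *\<^sub>R x + (1 / real (Suc n)) *\<^sub>R c) \<longlonglongrightarrow> (1 - 0) *\<^sub>R x + 0 *\<^sub>R c"
    by (intro tendsto_intros LIMSEQ_Suc[OF lim_1_over_n])
  then have lim: "(\<lambda>n. (1 - 1 / real (Suc n)) *\<^sub>R x + (1 / real (Suc n)) *\<^sub>R c) \<longlonglongrightarrow> x" by simp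
  have "(1 - 1 / real (Suc n)) *\<^sub>R x + (1 / real (Suc n)) *\<^sub>R c \<in> openK l" for n
    by (rule t) auto
  then show "x \<in> closure (openK l)"
    unfolding closure_sequential
    using lim by (intro exI[of _ "\<lambda>n. (1 - 1 / real (Suc n)) *\<^sub>R x + (1 / real (Suc n)) *\<^sub>R c"]) blast
qed

lemma interior_K_nonempty: "interior (K l) \<noteq> {}"
proof -
  have "openK l \<noteq> {}" by (metis K_subset_closure W_in_K closure_empty empty_iff subset_empty)
  then show ?thesis using interior_maximal[OF openK_subset open_openK, of l] by auto
qed

lemma openK_subset_T: "openK l \<subseteq> interior T"
  using open_openK openK_subset K_subset_T interior_maximal by (metis order_trans)

lemma eq_on_K_if_eq_on_openK:
  fixes f g :: "'a \<Rightarrow> 'b::real_normed_vector"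
  assumes "continuous_on (K l) f" "continuous_on (K l) g" "\<And>x. x \<in> openK l \<Longrightarrow> f x = g x" "x \<in> K l"
  shows "f x = g x"
proof -
  have cl: "closure (openK l) = K l"
    using K_subset_closure closure_minimal[OF openK_subset] compact_imp_closed[OF compact_K] by blast
  have "continuous_on (closure (openK l)) (\<lambda>x. f x - g x)"
    unfolding cl by (intro continuous_intros assms)
  then have "f x - g x = 0"
    by (rule continuous_constant_on_closure) (use assms cl in auto)
  then show ?thesis by simp
qed

end

section \<open>Test functions and weak exterior derivatives\<close>

lemma continuous_on_times_compact_support:
  fixes f g :: "'b::topological_space \<Rightarrow> real"
  assumes "open S" "closed C" "C \<subseteq> S" "continuous_on S f" "continuous_on UNIV g" "\<And>x. x \<notin> C \<Longrightarrow> g x = 0"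
  shows "continuous_on UNIV (\<lambda>x. f x * g x)"
proof -
  have "continuous_on (S \<union> - C) (\<lambda>x. f x * g x)"
  proof (rule continuous_on_open_Un)
    show "continuous_on S (\<lambda>x. f x * g x)"
      using assms by (auto intro!: continuous_intros intro: continuous_on_subset)
    show "continuous_on (- C) (\<lambda>x. f x * g x)"
      using assms(6) by (subst continuous_on_cong[OF refl, of _ _ "\<lambda>_. 0"]) auto
  qed (use assms in auto)
  moreover have "S \<union> - C = UNIV" using assms by auto
  ultimately show ?thesis by simp
qed

lemma test_functionsE:
  assumes "\<phi> \<in> test_functions S"
  obtains C where "compact C" "C \<subseteq> S" "\<And>x. x \<notin> C \<Longrightarrow> \<phi> x = 0"
    "\<And>x v. x \<notin> C \<Longrightarrow> frechet_derivative \<phi> (at x) v = 0"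
proof -
  define C where "C = closure {x. \<phi> x \<noteq> 0}"
  have C: "compact C" "C \<subseteq> S" "open (- C)"
    using assms by (simp_all add: test_functions_def C_def open_Compl)
  have z: "\<phi> x = 0" if "x \<notin> C" for x
    using that closure_subset[of "{x. \<phi> x \<noteq> 0}"] by (auto simp: C_def)
  have "frechet_derivative \<phi> (at x) v = 0" if x: "x \<notin> C" for x v
  proof -
    have "((\<lambda>_. 0) has_derivative (\<lambda>_. 0)) (at x)" by simp
    then have "(\<phi> has_derivative (\<lambda>_. 0)) (at x)"
      by (rule has_derivative_transform_within_open[OF _ C(3)]) (use x z in auto)
    from frechet_derivative_eqI[OF this] show ?thesis by simp
  qed
  with C z show thesis using that[of C] by blast
qed

lemma test_functionsI:
  assumes "\<And>k. C_k k \<phi>" "compact C" "C \<subseteq> S" "\<And>x. x \<notin> C \<Longrightarrow> \<phi> x = 0"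
  shows "\<phi> \<in> test_functions S"
proof -
  have "closure {x. \<phi> x \<noteq> 0} \<subseteq> C"
    using assms by (intro closure_minimal compact_imp_closed) auto
  then show ?thesis
    using assms compact_closure[of "{x. \<phi> x \<noteq> 0}"]
    by (auto simp: test_functions_def intro: bounded_subset[OF compact_imp_bounded])
qed

lemma test_functions_mono: "S \<subseteq> S' \<Longrightarrow> \<phi> \<in> test_functions S \<Longrightarrow> \<phi> \<in> test_functions S'"
  by (auto simp: test_functions_def)

lemma test_functions_derivative:
  assumes "\<phi> \<in> test_functions S"
  shows "(\<phi> has_derivative frechet_derivative \<phi> (at x)) (at x)"
    and "continuous_on UNIV (\<lambda>x. frechet_derivative \<phi> (at x) v)"
    and "continuous_on UNIV \<phi>"
    and "(\<lambda>x. frechet_derivative \<phi> (at x) v) \<in> test_functions S"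
proof -
  have C: "C_k k \<phi>" for k using assms by (simp add: test_functions_def)
  show "(\<phi> has_derivative frechet_derivative \<phi> (at x)) (at x)" by (rule C_k_SucE(1)[OF C])
  show "continuous_on UNIV (\<lambda>x. frechet_derivative \<phi> (at x) v)"
    by (rule C_k_continuous[OF C_k_SucE(2)[OF C[of "Suc 0"]]])
  show "continuous_on UNIV \<phi>" by (rule C_k_continuous[OF C])
  obtain C where "compact C" "C \<subseteq> S" "\<And>x v. x \<notin> C \<Longrightarrow> frechet_derivative \<phi> (at x) v = 0"
    using test_functionsE[OF assms] by metis
  then show "(\<lambda>x. frechet_derivative \<phi> (at x) v) \<in> test_functions S"
    by (intro test_functionsI[of _ C] C_k_SucE(2)[OF C])
qed

context triangle
begin

definition Pt :: "real \<times> real \<Rightarrow> 'a" where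
  "Pt p = V 0 + fst p *\<^sub>R e1 + snd p *\<^sub>R e2"

definition Tref :: "(real \<times> real) set" where
  "Tref = {p. 0 \<le> fst p \<and> 0 \<le> snd p \<and> fst p + snd p \<le> 1}"

text \<open>
  Integration over the plane in the affine coordinates of the reference triangle, that is, against the
  area form \<open>vol\<close>. For functions that vanish outside \<open>T\<close> it is the integral over \<open>T\<close>.
\<close>

definition pint :: "('a \<Rightarrow> real) \<Rightarrow> real" where
  "pint f = integral UNIV (\<lambda>p. f (Pt p))"

lemma lam_Pt: "lam 1 (Pt p) = fst p" "lam 2 (Pt p) = snd p" "lam 0 (Pt p) = 1 - fst p - snd p"
  by (simp_all add: Pt_def lam_def blinfun.bilinear_simps)

lemma Pt_lam: "Pt (lam 1 x, lam 2 x) = x"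
proof -
  have "\<forall>i. lam i (Pt (lam 1 x, lam 2 x)) = lam i x"
    unfolding forall_mod3 using lam_sum[of x] by (simp add: lam_Pt)
  then show ?thesis by (intro lam_inject) blast
qed

lemma Pt_in_T: "Pt p \<in> T \<longleftrightarrow> p \<in> Tref"
  by (auto simp: T_iff forall_mod3 lam_Pt Tref_def)

lemma continuous_Pt [continuous_intros]: "continuous_on S f \<Longrightarrow> continuous_on S (\<lambda>x. Pt (f x))"
  unfolding Pt_def by (intro continuous_intros)

lemma Pt_has_derivative: "(Pt has_derivative (\<lambda>q. fst q *\<^sub>R e1 + snd q *\<^sub>R e2)) (at p within S)"
  unfolding Pt_def[abs_def] by (auto intro!: derivative_eq_intros)

lemma tri_integral_Pt: "tri_integral V w = integral Tref (\<lambda>p. w (Pt p) e1 e2)"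
  by (simp add: tri_integral_def Tref_def Pt_def e1_def e2_def)

lemma integral_Tref: "(\<And>x. x \<notin> T \<Longrightarrow> f x = 0) \<Longrightarrow> integral Tref (\<lambda>p. f (Pt p)) = pint f"
  unfolding pint_def integral_restrict_UNIV[of Tref, symmetric]
  by (rule integral_cong) (auto simp: Pt_in_T[symmetric])

lemma compact_support_Pt:
  assumes "compact C"
  shows "compact ((\<lambda>x. (lam 1 x, lam 2 x)) ` C)"
    and "p \<notin> (\<lambda>x. (lam 1 x, lam 2 x)) ` C \<Longrightarrow> Pt p \<notin> C"
proof -
  show "compact ((\<lambda>x. (lam 1 x, lam 2 x)) ` C)"
    using assms by (intro compact_continuous_image continuous_intros)
  show "Pt p \<notin> C" if "p \<notin> (\<lambda>x. (lam 1 x, lam 2 x)) ` C"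
    using that by (metis (no_types, lifting) lam_Pt(1,2) prod.collapse rev_image_eqI)
qed

lemma compact_Tref: "compact Tref"
proof -
  have "Tref \<subseteq> (\<lambda>x. (lam 1 x, lam 2 x)) ` T"
    using compact_support_Pt(2)[OF compact_T] Pt_in_T by blast
  moreover have "closed Tref" unfolding Tref_def
    by (intro closed_Collect_conj closed_Collect_le continuous_intros)
  ultimately show ?thesis
    using compact_support_Pt(1)[OF compact_T] by (metis compact_Int_closed inf.absorb_iff2)
qed

lemma integrable_Tref:
  fixes f :: "'a \<Rightarrow> real"
  assumes "continuous_on T f"
  shows "(\<lambda>p. f (Pt p)) integrable_on Tref"
proof -
  have "continuous_on Tref (\<lambda>p. f (Pt p))"
    by (intro continuous_on_compose2[OF assms] continuous_intros) (auto simp: Pt_in_T)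
  from borel_integrable_compact[OF compact_Tref this]
  have "(\<lambda>p. indicator Tref p *\<^sub>R f (Pt p)) integrable_on UNIV" by (rule integrable_on_lborel)
  moreover have "(\<lambda>p. indicator Tref p *\<^sub>R f (Pt p)) = (\<lambda>p. if p \<in> Tref then f (Pt p) else 0)"
    by (auto simp: indicator_def)
  ultimately show ?thesis by (simp add: integrable_restrict_UNIV)
qed

lemma integrable_pint:
  fixes f :: "'a \<Rightarrow> real"
  assumes "continuous_on UNIV f" "compact C" "\<And>x. x \<notin> C \<Longrightarrow> f x = 0"
  shows "(\<lambda>p. f (Pt p)) integrable_on UNIV"
proof -
  obtain a where a: "(\<lambda>x. (lam 1 x, lam 2 x)) ` C \<subseteq> cbox (- a) a"
    using bounded_subset_cbox_symmetric[OF compact_imp_bounded[OF compact_support_Pt(1)[OF assms(2)]]] by blast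
  have "((\<lambda>p. f (Pt p)) has_integral integral UNIV (\<lambda>p. f (Pt p))) UNIV"
  proof (rule has_integral_compact_support(1)[where a = "- a" and b = a])
    show "continuous_on UNIV (\<lambda>p. f (Pt p))"
      by (intro continuous_on_compose2[OF assms(1)] continuous_intros) auto
    show "f (Pt p) = 0" if "p \<notin> cbox (- a) a" for p
      using that a compact_support_Pt(2)[OF assms(2)] assms(3) by blast
  qed
  then show ?thesis by blast
qed

lemma pint_directional_derivative_zero:
  assumes g: "\<And>x. (g has_derivative g' x) (at x)" and cont: "continuous_on UNIV (\<lambda>x. g' x v)"
    and C: "compact C" and S: "\<And>x. x \<notin> C \<Longrightarrow> g x = 0" "\<And>x. x \<notin> C \<Longrightarrow> g' x v = 0"
  shows "pint (\<lambda>x. g' x v) = 0"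
proof -
  let ?q = "(dlam 1 v, dlam 2 v)"
  let ?G' = "\<lambda>p q. g' (Pt p) (fst q *\<^sub>R e1 + snd q *\<^sub>R e2)"
  have v: "fst ?q *\<^sub>R e1 + snd ?q *\<^sub>R e2 = v" using dlam_rep[of v] by simp
  have "integral UNIV (\<lambda>p. ?G' p ?q) = 0"
  proof (rule integral_directional_derivative_zero[where g' = ?G'])
    show "((\<lambda>p. g (Pt p)) has_derivative ?G' p) (at p)" for p
      by (rule has_derivative_compose[OF Pt_has_derivative g])
    show "continuous_on UNIV (\<lambda>p. ?G' p ?q)"
      unfolding v by (intro continuous_on_compose2[OF cont] continuous_intros) auto
    show "bounded ((\<lambda>x. (lam 1 x, lam 2 x)) ` C)"
      by (rule compact_imp_bounded[OF compact_support_Pt(1)[OF C]])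
  qed (use compact_support_Pt(2)[OF C] S v in auto)
  then show ?thesis by (simp only: pint_def v)
qed

lemma pint_radial_derivative:
  assumes \<phi>: "\<And>x. (\<phi> has_derivative \<phi>' x) (at x)" and cont: "\<And>v. continuous_on UNIV (\<lambda>x. \<phi>' x v)"
    and C: "compact C" and S: "\<And>x. x \<notin> C \<Longrightarrow> \<phi> x = 0" "\<And>x v. x \<notin> C \<Longrightarrow> \<phi>' x v = 0"
    and g: "continuous_on UNIV g"
    and hom: "\<And>x t. t > 0 \<Longrightarrow> g (w + t *\<^sub>R (x - w)) = t ^ k * g x"
  shows "pint (\<lambda>x. g x * \<phi>' x (x - w)) = - real (k + 2) * pint (\<lambda>x. \<phi> x * g x)"
proof -
  let ?w = "(lam 1 w, lam 2 w)"
  let ?\<phi>' = "\<lambda>p q. \<phi>' (Pt p) (fst q *\<^sub>R e1 + snd q *\<^sub>R e2)"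
  have diff: "fst (p - ?w) *\<^sub>R e1 + snd (p - ?w) *\<^sub>R e2 = Pt p - w" for p
  proof -
    have "Pt p - w = Pt p - Pt ?w" by (simp only: Pt_lam)
    then show ?thesis by (simp add: Pt_def algebra_simps)
  qed
  have Pt_hom: "Pt (?w + t *\<^sub>R (p - ?w)) = w + t *\<^sub>R (Pt p - w)" for t p
  proof -
    have "Pt (?w + t *\<^sub>R (p - ?w)) = Pt ?w + t *\<^sub>R (Pt p - Pt ?w)" by (simp add: Pt_def algebra_simps)
    then show ?thesis by (simp only: Pt_lam)
  qed
  have "integral UNIV (\<lambda>p. g (Pt p) * ?\<phi>' p (p - ?w)) =
      - real (k + DIM(real \<times> real)) * integral UNIV (\<lambda>p. \<phi> (Pt p) * g (Pt p))"
  proof (rule integral_radial_derivative[where \<phi>' = ?\<phi>'])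
    show "((\<lambda>p. \<phi> (Pt p)) has_derivative ?\<phi>' p) (at p)" for p
      by (rule has_derivative_compose[OF Pt_has_derivative \<phi>])
    show "continuous_on UNIV (\<lambda>p. ?\<phi>' p q)" for q
      by (intro continuous_on_compose2[OF cont] continuous_intros) auto
    show "bounded ((\<lambda>x. (lam 1 x, lam 2 x)) ` C)"
      by (rule compact_imp_bounded[OF compact_support_Pt(1)[OF C]])
    show "continuous_on UNIV (\<lambda>p. g (Pt p))"
      by (intro continuous_on_compose2[OF g] continuous_intros) auto
    show "g (Pt (?w + t *\<^sub>R (p - ?w))) = t ^ k * g (Pt p)" if "0 < t" for t p
      unfolding Pt_hom by (rule hom[OF that])
  qed (use compact_support_Pt(2)[OF C] S in auto)
  then show ?thesis unfolding diff by (simp add: pint_def)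
qed

lemma pint_nonneg_zero:
  assumes f: "continuous_on UNIV f" "\<And>x. 0 \<le> f x" and C: "compact C" "\<And>x. x \<notin> C \<Longrightarrow> f x = 0"
    and 0: "pint f = 0"
  shows "f x = 0"
proof (rule ccontr)
  assume ne: "f x \<noteq> 0"
  obtain a where a: "(\<lambda>x. (lam 1 x, lam 2 x)) ` C \<subseteq> box (- a) a"
    using bounded_subset_box_symmetric[OF compact_imp_bounded[OF compact_support_Pt(1)[OF C(1)]]] by blast
  have x: "(lam 1 x, lam 2 x) \<in> box (- a) a" using ne C a by blast
  have cont: "continuous_on UNIV (\<lambda>p. f (Pt p))"
    by (intro continuous_on_compose2[OF f(1)] continuous_intros) auto
  have "((\<lambda>p. f (Pt p)) has_integral pint f) (cbox (- a) a)"
    unfolding pint_def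
    by (rule has_integral_compact_support(2)[OF cont])
      (use a compact_support_Pt(2)[OF C(1)] C(2) box_subset_cbox in blast)
  then have "f (Pt (lam 1 x, lam 2 x)) = 0"
    using x f(2) subsetD[OF box_subset_cbox x] continuous_on_subset[OF cont] unfolding 0
    by (intro has_integral_0_cbox_imp_0[of "- a" a "\<lambda>p. f (Pt p)"]) auto
  then show False using ne by (simp add: Pt_lam)
qed

text \<open>
  The product \<open>f \<phi>\<close>, extended by zero outside \<open>S\<close>, is differentiable on the whole plane, since \<open>\<phi>\<close>
  vanishes near the boundary of \<open>S\<close>. Its directional derivative has integral zero.
\<close>

lemma pint_integration_by_parts:
  assumes \<phi>: "\<phi> \<in> test_functions S" and S: "open S"
    and f: "\<And>x. x \<in> S \<Longrightarrow> (f has_derivative f' x) (at x)" "continuous_on S (\<lambda>x. f' x v)"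
  shows "pint (\<lambda>x. f x * frechet_derivative \<phi> (at x) v) = - pint (\<lambda>x. f' x v * \<phi> x)"
proof -
  obtain C where C: "compact C" "C \<subseteq> S" and z: "\<And>x. x \<notin> C \<Longrightarrow> \<phi> x = 0"
    "\<And>x v. x \<notin> C \<Longrightarrow> frechet_derivative \<phi> (at x) v = 0"
    using test_functionsE[OF \<phi>] by metis
  have zS: "\<phi> x = 0" "frechet_derivative \<phi> (at x) v = 0" if "x \<notin> S" for x v
    using that C(2) z by blast+
  note d = test_functions_derivative[OF \<phi>]
  let ?D = "\<lambda>x. frechet_derivative \<phi> (at x)"
  have cf: "continuous_on S f"
    by (meson f(1) continuous_at_imp_continuous_on has_derivative_continuous)
  have c1: "continuous_on UNIV (\<lambda>x. f x * ?D x v)" and c2: "continuous_on UNIV (\<lambda>x. f' x v * \<phi> x)"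
    by (rule continuous_on_times_compact_support[OF S compact_imp_closed[OF C(1)] C(2)];
        use cf f(2) d z in simp)+
  define g' where "g' x h = (if x \<in> S then f x * ?D x h + f' x h * \<phi> x else 0)" for x h
  have "pint (\<lambda>x. g' x v) = 0"
  proof (rule pint_directional_derivative_zero[where C = C])
    show "((\<lambda>x. f x * \<phi> x) has_derivative g' x) (at x)" for x
    proof (cases "x \<in> S")
      case True
      then show ?thesis unfolding g'_def using has_derivative_mult[OF f(1) d(1)] by simp
    next
      case False
      then have x: "x \<in> - C" using C by auto
      have "((\<lambda>_. 0) has_derivative g' x) (at x)" using False by (simp add: g'_def[abs_def])
      then show ?thesis
        by (rule has_derivative_transform_within_open[of _ _ _ _ "- C"])
          (use x z compact_imp_closed[OF C(1)] in auto)
    qed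
    have "(\<lambda>x. g' x v) = (\<lambda>x. f x * ?D x v + f' x v * \<phi> x)"
      using zS by (auto simp: g'_def fun_eq_iff)
    then show "continuous_on UNIV (\<lambda>x. g' x v)" using continuous_on_add[OF c1 c2] by (simp only:)
  qed (use C z in \<open>auto simp: g'_def\<close>)
  also have "pint (\<lambda>x. g' x v) = pint (\<lambda>x. f x * ?D x v + f' x v * \<phi> x)"
    using zS by (intro arg_cong[where f = pint]) (auto simp: g'_def fun_eq_iff)
  also have "\<dots> = pint (\<lambda>x. f x * ?D x v) + pint (\<lambda>x. f' x v * \<phi> x)"
    unfolding pint_def
    by (intro integral_add integrable_pint[OF c1 C(1)] integrable_pint[OF c2 C(1)]) (use z in auto)
  finally show ?thesis by simp
qed

text \<open>
  The product of the smooth functions \<open>exp(- 1/t)\<close> of the three affine functions \<open>lam i - lam i x0 + d\<close>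
  is supported in a small triangle around \<open>x0\<close> that is similar to \<open>T\<close>.
\<close>

lemma bump_exists:
  fixes x0 :: 'a
  assumes "r > 0"
  obtains \<phi> C where "\<And>k. C_k k \<phi>" "compact C" "C \<subseteq> ball x0 r" "\<And>x. x \<notin> C \<Longrightarrow> \<phi> x = 0"
    "\<And>x. 0 \<le> \<phi> x" "0 < \<phi> x0"
proof -
  define M where "M = norm (V 0) + norm (V 1) + norm (V 2) + 1"
  have M: "M > 0" by (simp add: M_def add_nonneg_pos)
  \<comment> \<open>the small triangle has radius at most \<open>2 d M\<close>, half of \<open>r\<close>\<close>
  define d where "d = r / (4 * M)"
  have d: "d > 0" using assms M by (simp add: d_def)
  define C where "C = {x. \<forall>i. lam i x0 - d \<le> lam i x}"
  define \<phi> where "\<phi> x = exp_recip 0 (dlam 0 x + (lam 0 0 - lam 0 x0 + d)) *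
      (exp_recip 0 (dlam 1 x + (lam 1 0 - lam 1 x0 + d)) * exp_recip 0 (dlam 2 x + (lam 2 0 - lam 2 x0 + d)))" for x
  have \<phi>: "\<phi> x = exp_recip 0 (lam 0 x - lam 0 x0 + d) *
      (exp_recip 0 (lam 1 x - lam 1 x0 + d) * exp_recip 0 (lam 2 x - lam 2 x0 + d))" for x
    unfolding \<phi>_def using lam_add[of _ 0 x] by (simp add: algebra_simps)
  have near: "norm (x - x0) \<le> r / 2" if "x \<in> C" for x
  proof -
    have ge: "- d \<le> dlam i (x - x0)" for i
      using that by (auto simp: C_def dlam_diff algebra_simps)
    then have "\<bar>dlam i (x - x0)\<bar> \<le> 2 * d" for i
    proof -
      have "\<forall>i. \<bar>dlam i (x - x0)\<bar> \<le> 2 * d"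
        using ge[of 0] ge[of 1] ge[of 2] dlam_sum[of "x - x0"] d unfolding forall_mod3 by linarith
      then show ?thesis by blast
    qed
    moreover have "x - x0 = dlam 0 (x - x0) *\<^sub>R V 0 + dlam 1 (x - x0) *\<^sub>R V 1 + dlam 2 (x - x0) *\<^sub>R V 2"
      using lam_rep[of x] lam_rep[of x0] by (simp add: dlam_diff algebra_simps)
    ultimately have "norm (x - x0) \<le> 2 * d * norm (V 0) + 2 * d * norm (V 1) + 2 * d * norm (V 2)"
      by (metis (no_types, lifting) norm_triangle_mono norm_scaleR mult_right_mono norm_ge_zero)
    also have "\<dots> \<le> 2 * d * M" using d by (simp add: M_def algebra_simps)
    also have "\<dots> = r / 2" using M by (simp add: d_def)
    finally show ?thesis .
  qed
  show thesis
  proof (rule that[of \<phi> C])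
    show "C_k k \<phi>" for k
      unfolding \<phi>_def
      by (intro C_k_mult C_k_affine_compose[OF blinfun.bounded_linear_right] C_k_exp_recip)
    have "closed C"
      unfolding C_def by (intro closed_Collect_all closed_Collect_le continuous_intros)
    moreover have "bounded C"
      by (rule boundedI[of _ "r / 2 + norm x0"])
        (use near in \<open>metis add.commute norm_triangle_sub order_trans add_left_mono\<close>)
    ultimately show "compact C" by (simp add: compact_eq_bounded_closed)
    show "C \<subseteq> ball x0 r" using near assms by (fastforce simp: dist_norm norm_minus_commute)
    show "\<phi> x = 0" if x: "x \<notin> C" for x
    proof -
      obtain i where "\<not> lam i x0 - d \<le> lam i x" using x by (auto simp: C_def)
      then have "exp_recip 0 (lam i x - lam i x0 + d) = 0" by (simp add: exp_recip_def)
      then show ?thesis using cases_mod3[of i 0] by (auto simp: \<phi>)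
    qed
    show "0 \<le> \<phi> x" for x by (simp add: \<phi>_def exp_recip_def)
    show "0 < \<phi> x0" using d by (simp add: \<phi> exp_recip_def)
  qed
qed

lemma pint_fundamental_lemma:
  assumes S: "open S" and g: "continuous_on S g"
    and 0: "\<And>\<phi>. \<phi> \<in> test_functions S \<Longrightarrow> pint (\<lambda>x. g x * \<phi> x) = 0"
    and x: "x \<in> S"
  shows "g x = 0"
proof -
  have pos: False
    if g: "continuous_on S g" and 0: "\<And>\<phi>. \<phi> \<in> test_functions S \<Longrightarrow> pint (\<lambda>x. g x * \<phi> x) = 0"
      and p: "g x > 0" for g
  proof -
    have "open {y \<in> S. g y > 0}"
      using continuous_on_open_vimage[OF S, of g] g
      by (auto simp: vimage_def Collect_conj_eq Int_commute dest!: spec[of _ "{0<..}"])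
    then obtain r where r: "r > 0" "ball x r \<subseteq> {y \<in> S. g y > 0}"
      using x p by (auto simp: open_contains_ball)
    obtain \<phi> C where \<phi>: "\<And>k. C_k k \<phi>" "compact C" "C \<subseteq> ball x r" "\<And>x. x \<notin> C \<Longrightarrow> \<phi> x = 0"
      "\<And>x. 0 \<le> \<phi> x" "0 < \<phi> x"
      using bump_exists[OF r(1), where ?x0.0 = x] by metis
    have CS: "C \<subseteq> S" using \<phi>(3) r(2) by blast
    have "pint (\<lambda>x. g x * \<phi> x) = 0" by (rule 0[OF test_functionsI[OF \<phi>(1,2) CS \<phi>(4)]])
    moreover have "continuous_on UNIV (\<lambda>x. g x * \<phi> x)"
      by (rule continuous_on_times_compact_support[OF S compact_imp_closed[OF \<phi>(2)] CS g C_k_continuous[OF \<phi>(1)] \<phi>(4)])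
    moreover have "0 \<le> g y * \<phi> y" for y
      using \<phi>(3,4,5) r(2) by (cases "y \<in> C") (force intro!: mult_nonneg_nonneg)+
    ultimately have "g x * \<phi> x = 0"
      using pint_nonneg_zero[of "\<lambda>x. g x * \<phi> x" C x] \<phi>(2,4) by simp
    then show False using p \<phi>(6) by simp
  qed
  have "pint (\<lambda>x. - g x * \<phi> x) = 0" if "\<phi> \<in> test_functions S" for \<phi>
    using 0[OF that] by (simp add: pint_def)
  then have "\<not> - g x > 0" using pos[of "\<lambda>x. - g x"] g by (auto intro: continuous_intros)
  moreover have "\<not> g x > 0" using pos[of g] g 0 by blast
  ultimately show ?thesis by simp
qed

end

context triangle
begin

lemma C0_form2_rep:
  assumes "w \<in> C0_form2 T"
  shows "w x = w x e1 e2 *\<^sub>R vol" and "continuous_on T (\<lambda>x. w x e1 e2)" and "x \<notin> T \<Longrightarrow> w x = 0"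
proof -
  show "w x = w x e1 e2 *\<^sub>R vol" using assms by (intro alternating_eq_vol) (auto simp: C0_form2_def)
  show "continuous_on T (\<lambda>x. w x e1 e2)"
    using assms by (auto simp: C0_form2_def intro!: continuous_intros)
  show "x \<notin> T \<Longrightarrow> w x = 0" using assms by (simp add: C0_form2_def zero_off_def)
qed

lemma C0_form2_vol:
  assumes "continuous_on T g"
  shows "(\<lambda>x. if x \<in> T then g x *\<^sub>R vol else 0) \<in> C0_form2 T"
proof -
  have "continuous_on T (\<lambda>x. if x \<in> T then g x *\<^sub>R vol else 0)"
    by (subst continuous_on_cong[OF refl, of _ _ "\<lambda>x. g x *\<^sub>R vol"]) (auto intro!: continuous_intros assms)
  moreover have "(0 :: 'a \<Rightarrow>\<^sub>L 'a \<Rightarrow>\<^sub>L real) \<in> alternating" by (simp add: alternating_def)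
  ultimately show ?thesis using vol_alternating by (auto simp: C0_form2_def zero_off_def)
qed

lemma C0_form2_eqI:
  assumes "w \<in> C0_form2 T" "w' \<in> C0_form2 T" "\<And>x. x \<in> interior T \<Longrightarrow> w x e1 e2 = w' x e1 e2"
  shows "w = w'"
proof
  fix x
  show "w x = w' x"
  proof (cases "x \<in> T")
    case True
    have "continuous_on (closure (interior T)) (\<lambda>x. w x e1 e2 - w' x e1 e2)"
      unfolding T_closure[symmetric] by (intro continuous_intros C0_form2_rep(2) assms)
    then have "w x e1 e2 - w' x e1 e2 = 0"
      by (rule continuous_constant_on_closure) (use assms True T_closure in auto)
    then show ?thesis using C0_form2_rep(1)[OF assms(1)] C0_form2_rep(1)[OF assms(2)] by (metis eq_iff_diff_eq_0)
  next
    case False then show ?thesis using C0_form2_rep(3) assms by metis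
  qed
qed

abbreviation "tests \<equiv> test_functions (interior T)"

lemma test_product_integrable:
  assumes "\<phi> \<in> test_functions S" "open S" "continuous_on S f"
  shows "(\<lambda>p. f (Pt p) * \<phi> (Pt p)) integrable_on UNIV"
proof -
  obtain C where C: "compact C" "C \<subseteq> S" and z: "\<And>x. x \<notin> C \<Longrightarrow> \<phi> x = 0"
    using test_functionsE[OF assms(1)] by metis
  have "continuous_on UNIV (\<lambda>x. f x * \<phi> x)"
    by (rule continuous_on_times_compact_support[OF assms(2) compact_imp_closed[OF C(1)] C(2) assms(3)
          test_functions_derivative(3)[OF assms(1)] z])
  then show ?thesis by (rule integrable_pint[OF _ C(1)]) (use z in auto)
qed

lemma pint_diff:
  "(\<lambda>p. f (Pt p)) integrable_on UNIV \<Longrightarrow> (\<lambda>p. g (Pt p)) integrable_on UNIV \<Longrightarrow>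
    pint (\<lambda>x. f x - g x) = pint f - pint g"
  unfolding pint_def by (rule integral_diff)

lemma pint_add:
  "(\<lambda>p. f (Pt p)) integrable_on UNIV \<Longrightarrow> (\<lambda>p. g (Pt p)) integrable_on UNIV \<Longrightarrow>
    pint (\<lambda>x. f x + g x) = pint f + pint g"
  unfolding pint_def by (rule integral_add)

lemma pint_cmult: "pint (\<lambda>x. c * f x) = c * pint f"
  by (simp add: pint_def)

lemma test_functions_off_T:
  assumes "\<phi> \<in> tests" "x \<notin> T"
  shows "\<phi> x = 0" "frechet_derivative \<phi> (at x) v = 0"
  using test_functionsE[OF assms(1)] assms(2) interior_subset by (metis subsetD)+

lemma has_d1_iff:
  "has_d1 V u w \<longleftrightarrow> w \<in> C0_form2 T \<and>
    (\<forall>\<phi>\<in>tests. pint (\<lambda>x. w x e1 e2 * \<phi> x) =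
      pint (\<lambda>x. u x e1 * frechet_derivative \<phi> (at x) e2 - u x e2 * frechet_derivative \<phi> (at x) e1))"
proof -
  have 1: "tri_integral V (\<lambda>x v v'. \<phi> x * w x v v') = pint (\<lambda>x. w x e1 e2 * \<phi> x)" if "\<phi> \<in> tests" for \<phi>
    unfolding tri_integral_Pt using test_functions_off_T[OF that]
    by (subst integral_Tref) (auto simp: mult.commute)
  have 2: "tri_integral V (\<lambda>x. wedge (u x) (frechet_derivative \<phi> (at x))) =
      pint (\<lambda>x. u x e1 * frechet_derivative \<phi> (at x) e2 - u x e2 * frechet_derivative \<phi> (at x) e1)"
    if "\<phi> \<in> tests" for \<phi>
    unfolding tri_integral_Pt wedge_def using test_functions_off_T[OF that]
    by (subst integral_Tref) auto
  show ?thesis unfolding has_d1_def using 1 2 by simp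
qed

lemma has_d1_unique:
  assumes "has_d1 V u w" "has_d1 V u w'"
  shows "w = w'"
proof (rule C0_form2_eqI)
  show w: "w \<in> C0_form2 T" "w' \<in> C0_form2 T" using assms by (simp_all add: has_d1_iff)
  have c: "continuous_on (interior T) (\<lambda>x. w x e1 e2)" "continuous_on (interior T) (\<lambda>x. w' x e1 e2)"
    using C0_form2_rep(2)[OF w(1)] C0_form2_rep(2)[OF w(2)] interior_subset continuous_on_subset by blast+
  fix x assume x: "x \<in> interior T"
  have "w x e1 e2 - w' x e1 e2 = 0"
  proof (rule pint_fundamental_lemma[OF open_interior _ _ x])
    show "continuous_on (interior T) (\<lambda>x. w x e1 e2 - w' x e1 e2)" by (intro continuous_intros c)
    fix \<phi> assume \<phi>: "\<phi> \<in> tests"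
    have "pint (\<lambda>x. w x e1 e2 * \<phi> x - w' x e1 e2 * \<phi> x) = 0"
      using pint_diff[OF test_product_integrable[OF \<phi> open_interior c(1)]
          test_product_integrable[OF \<phi> open_interior c(2)]] assms \<phi>
      by (simp add: has_d1_iff)
    then show "pint (\<lambda>x. (w x e1 e2 - w' x e1 e2) * \<phi> x) = 0" by (simp add: left_diff_distrib)
  qed
  then show "w x e1 e2 = w' x e1 e2" by simp
qed

lemma d1_eqI: "has_d1 V u w \<Longrightarrow> d1 V u = w"
  unfolding d1_def using has_d1_unique by blast

lemma has_d1_d1: "u \<in> C0d_form1 V \<Longrightarrow> has_d1 V u (d1 V u)"
  using d1_eqI by (auto simp: C0d_form1_def)

lemma d1_C0_form2: "u \<in> C0d_form1 V \<Longrightarrow> d1 V u \<in> C0_form2 T"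
  using has_d1_d1 by (auto simp: has_d1_iff)

lemma has_d1_linear:
  assumes u: "has_d1 V u w" "continuous_on T u" and u': "has_d1 V u' w'" "continuous_on T u'"
  shows "has_d1 V (c *\<^sub>R u + c' *\<^sub>R u') (c *\<^sub>R w + c' *\<^sub>R w')"
  unfolding has_d1_iff
proof (intro conjI ballI)
  have w: "w \<in> C0_form2 T" "w' \<in> C0_form2 T" using assms by (simp_all add: has_d1_iff)
  show "c *\<^sub>R w + c' *\<^sub>R w' \<in> C0_form2 T"
    using w by (auto simp: C0_form2_def zero_off_def scaleR_fun_def plus_fun_def alternating_def
        blinfun.bilinear_simps image_subset_iff intro!: continuous_intros)
  have c: "continuous_on (interior T) (\<lambda>x. w x e1 e2)" "continuous_on (interior T) (\<lambda>x. w' x e1 e2)"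
    using C0_form2_rep(2)[OF w(1)] C0_form2_rep(2)[OF w(2)] interior_subset continuous_on_subset by blast+
  have cu: "continuous_on (interior T) (\<lambda>x. u x v)" "continuous_on (interior T) (\<lambda>x. u' x v)" for v
    using u(2) u'(2) interior_subset[of T]
    by (auto intro!: continuous_intros intro: continuous_on_subset)
  fix \<phi> assume \<phi>: "\<phi> \<in> tests"
  let ?D = "\<lambda>x. frechet_derivative \<phi> (at x)"
  note I = test_product_integrable[OF \<phi> open_interior]
    test_product_integrable[OF test_functions_derivative(4)[OF \<phi>] open_interior]
  have "pint (\<lambda>x. (c *\<^sub>R w + c' *\<^sub>R w') x e1 e2 * \<phi> x) =
      pint (\<lambda>x. c * (w x e1 e2 * \<phi> x) + c' * (w' x e1 e2 * \<phi> x))"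
    by (simp add: scaleR_fun_def plus_fun_def blinfun.bilinear_simps algebra_simps)
  also have "\<dots> = c * pint (\<lambda>x. w x e1 e2 * \<phi> x) + c' * pint (\<lambda>x. w' x e1 e2 * \<phi> x)"
    by (subst pint_add) (auto simp: pint_cmult intro!: integrable_on_mult_right I c)
  also have "\<dots> = c * pint (\<lambda>x. u x e1 * ?D x e2 - u x e2 * ?D x e1) +
      c' * pint (\<lambda>x. u' x e1 * ?D x e2 - u' x e2 * ?D x e1)"
    using u(1) u'(1) \<phi> by (simp add: has_d1_iff)
  also have "\<dots> = pint (\<lambda>x. c * (u x e1 * ?D x e2 - u x e2 * ?D x e1) +
      c' * (u' x e1 * ?D x e2 - u' x e2 * ?D x e1))"
    by (subst pint_add) (auto simp: pint_cmult intro!: integrable_on_mult_right integrable_diff I cu)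
  also have "\<dots> = pint (\<lambda>x. (c *\<^sub>R u + c' *\<^sub>R u') x e1 * ?D x e2 - (c *\<^sub>R u + c' *\<^sub>R u') x e2 * ?D x e1)"
    by (simp add: scaleR_fun_def plus_fun_def blinfun.bilinear_simps algebra_simps)
  finally show "pint (\<lambda>x. (c *\<^sub>R w + c' *\<^sub>R w') x e1 e2 * \<phi> x) =
      pint (\<lambda>x. (c *\<^sub>R u + c' *\<^sub>R u') x e1 * ?D x e2 - (c *\<^sub>R u + c' *\<^sub>R u') x e2 * ?D x e1)" .
qed

lemma C1_form0_has_derivative:
  assumes "u \<in> C1_form0 T" "x \<in> T"
  shows "(u has_derivative d0 T u x) (at x within T)"
proof -
  have D: "(u has_derivative frechet_derivative u (at x within T)) (at x within T)"
    using assms by (auto simp: C1_form0_def differentiable_on_def frechet_derivative_works)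
  moreover have "blinfun_apply (d0 T u x) = frechet_derivative u (at x within T)"
    using assms(2) bounded_linear_Blinfun_apply[OF has_derivative_bounded_linear[OF D]] by (simp add: d0_def)
  ultimately show ?thesis by simp
qed

lemma d0_unique:
  assumes "x \<in> T" "(u has_derivative blinfun_apply D) (at x within T)"
  shows "d0 T u x = D"
proof -
  have "(u has_derivative frechet_derivative u (at x within T)) (at x within T)"
    using assms(2) by (metis differentiableI frechet_derivative_works)
  then have "frechet_derivative u (at x within T) = blinfun_apply D"
    using has_derivative_unique_within_convex[OF convex_T interior_T_nonempty assms(1)] assms(2) by blast
  then show ?thesis using assms(1) by (simp add: d0_def blinfun_apply_inverse)
qed

lemma C1_form0I:
  assumes z: "\<And>x. x \<notin> T \<Longrightarrow> u x = 0" "\<And>x. x \<notin> T \<Longrightarrow> D x = 0"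
    and D: "\<And>x. x \<in> T \<Longrightarrow> (u has_derivative blinfun_apply (D x)) (at x within T)" and c: "continuous_on T D"
  shows "u \<in> C1_form0 T" and "d0 T u = D"
proof -
  show "d0 T u = D"
  proof
    fix x show "d0 T u x = D x"
      using d0_unique[OF _ D] z(2) by (cases "x \<in> T") (auto simp: d0_def)
  qed
  then show "u \<in> C1_form0 T"
    using assms by (auto simp: C1_form0_def zero_off_def differentiable_on_def differentiable_def)
qed

text \<open>
  Two integrations by parts move all derivatives to the test function; the two mixed second
  derivatives that appear cancel.
\<close>

lemma has_d1_d0:
  assumes u: "u \<in> C1_form0 T"
  shows "has_d1 V (d0 T u) 0"
  unfolding has_d1_iff
proof (intro conjI ballI)
  have "(0 :: 'a \<Rightarrow>\<^sub>L 'a \<Rightarrow>\<^sub>L real) \<in> alternating" by (simp add: alternating_def)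
  then show "0 \<in> C0_form2 T" by (auto simp: C0_form2_def zero_off_def zero_fun_def)
  have du: "(u has_derivative d0 T u x) (at x)" if "x \<in> interior T" for x
    using C1_form0_has_derivative[OF u] that interior_subset at_within_interior[OF that] by fastforce
  have c: "continuous_on (interior T) (\<lambda>x. d0 T u x v)" for v
    using u interior_subset[of T]
    by (auto simp: C1_form0_def intro!: continuous_intros intro: continuous_on_subset)
  fix \<phi> assume \<phi>: "\<phi> \<in> tests"
  let ?D = "\<lambda>v x. frechet_derivative \<phi> (at x) v"
  have D: "?D v \<in> tests" for v by (rule test_functions_derivative(4)[OF \<phi>])
  have "C_k 2 \<phi>" using \<phi> by (simp add: test_functions_def)
  note sym = symmetric_second_derivative[OF this]
  have "pint (\<lambda>x. d0 T u x e1 * ?D e2 x - d0 T u x e2 * ?D e1 x) =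
      pint (\<lambda>x. d0 T u x e1 * ?D e2 x) - pint (\<lambda>x. d0 T u x e2 * ?D e1 x)"
    by (intro pint_diff test_product_integrable[OF D open_interior] c)
  also have "\<dots> = - pint (\<lambda>x. u x * frechet_derivative (?D e2) (at x) e1) + pint (\<lambda>x. u x * frechet_derivative (?D e1) (at x) e2)"
    using pint_integration_by_parts[OF D[of e2] open_interior du c[of e1]]
      pint_integration_by_parts[OF D[of e1] open_interior du c[of e2]] by simp
  also have "\<dots> = 0" using sym[of e2 _ e1] by simp
  finally show "pint (\<lambda>x. (0 :: 'a form2) x e1 e2 * \<phi> x) = pint (\<lambda>x. d0 T u x e1 * ?D e2 x - d0 T u x e2 * ?D e1 x)"
    by (simp add: pint_def zero_fun_def)
qed

lemma d0_C0d:
  assumes "u \<in> C1_form0 T"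
  shows "d0 T u \<in> C0d_form1 V" "d1 V (d0 T u) = 0"
proof -
  show "d0 T u \<in> C0d_form1 V"
    using assms has_d1_d0[OF assms] by (auto simp: C0d_form1_def C1_form0_def zero_off_def d0_def)
  show "d1 V (d0 T u) = 0" by (rule d1_eqI[OF has_d1_d0[OF assms]])
qed

text \<open>
  Where the components of \<open>u\<close> are of class \<open>C\<^sup>1\<close> the weak derivative is the pointwise one. Testing only
  with functions supported in \<open>S\<close> allows kinks of \<open>u\<close> outside \<open>S\<close>.
\<close>

lemma has_d1_local:
  assumes w: "has_d1 V u w" and S: "open S" "S \<subseteq> interior T"
    and p: "\<And>x. x \<in> S \<Longrightarrow> ((\<lambda>x. u x e1) has_derivative p' x) (at x)" "continuous_on S (\<lambda>x. p' x e2)"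
    and q: "\<And>x. x \<in> S \<Longrightarrow> ((\<lambda>x. u x e2) has_derivative q' x) (at x)" "continuous_on S (\<lambda>x. q' x e1)"
    and x: "x \<in> S"
  shows "w x e1 e2 = q' x e1 - p' x e2"
proof -
  have wC: "w \<in> C0_form2 T" using w by (simp add: has_d1_iff)
  have cw: "continuous_on S (\<lambda>x. w x e1 e2)"
    using C0_form2_rep(2)[OF wC] S interior_subset continuous_on_subset by blast
  have cp: "continuous_on S (\<lambda>x. u x e1)" and cq: "continuous_on S (\<lambda>x. u x e2)"
    using p(1) q(1) by (meson continuous_at_imp_continuous_on has_derivative_continuous)+
  have "w x e1 e2 - (q' x e1 - p' x e2) = 0"
  proof (rule pint_fundamental_lemma[OF S(1) _ _ x])
    show "continuous_on S (\<lambda>x. w x e1 e2 - (q' x e1 - p' x e2))" by (intro continuous_intros cw p q)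
    fix \<phi> assume \<phi>: "\<phi> \<in> test_functions S"
    then have \<phi>T: "\<phi> \<in> tests" using test_functions_mono S(2) by blast
    let ?D = "\<lambda>v x. frechet_derivative \<phi> (at x) v"
    note I = test_product_integrable[OF \<phi> S(1)] test_product_integrable[OF test_functions_derivative(4)[OF \<phi>] S(1)]
    have "pint (\<lambda>x. w x e1 e2 * \<phi> x) = pint (\<lambda>x. u x e1 * ?D e2 x - u x e2 * ?D e1 x)"
      using w \<phi>T by (simp add: has_d1_iff)
    also have "\<dots> = pint (\<lambda>x. u x e1 * ?D e2 x) - pint (\<lambda>x. u x e2 * ?D e1 x)"
      by (intro pint_diff I cp cq)
    also have "\<dots> = pint (\<lambda>x. q' x e1 * \<phi> x) - pint (\<lambda>x. p' x e2 * \<phi> x)"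
      using pint_integration_by_parts[OF \<phi> S(1) p(1) p(2)] pint_integration_by_parts[OF \<phi> S(1) q(1) q(2)] by simp
    also have "\<dots> = pint (\<lambda>x. q' x e1 * \<phi> x - p' x e2 * \<phi> x)"
      by (intro pint_diff[symmetric] I p q)
    finally have eq: "pint (\<lambda>x. w x e1 e2 * \<phi> x) = pint (\<lambda>x. q' x e1 * \<phi> x - p' x e2 * \<phi> x)" .
    have "pint (\<lambda>x. (w x e1 e2 - (q' x e1 - p' x e2)) * \<phi> x) =
        pint (\<lambda>x. w x e1 e2 * \<phi> x - (q' x e1 * \<phi> x - p' x e2 * \<phi> x))"
      by (simp add: left_diff_distrib)
    also have "\<dots> = pint (\<lambda>x. w x e1 e2 * \<phi> x) - pint (\<lambda>x. q' x e1 * \<phi> x - p' x e2 * \<phi> x)"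
      by (intro pint_diff I cw integrable_diff p q)
    finally show "pint (\<lambda>x. (w x e1 e2 - (q' x e1 - p' x e2)) * \<phi> x) = 0" using eq by simp
  qed
  then show ?thesis by simp
qed

text \<open>
  Contraction of the area form with the radial field. In dimension two
  \<open>(\<iota>\<^sub>y vol) \<and> d\<phi> = - d\<phi>(y) vol\<close>, so that the weak derivative only involves radial derivatives of the test
  function, and these are governed by homogeneity. Hence \<open>g\<close> may be any continuous homogeneous function,
  such as a piecewise affine one.
\<close>

lemma has_d1_koszul:
  fixes g :: "'a \<Rightarrow> real"
  assumes g: "continuous_on UNIV g" and hom: "\<And>x t. t > 0 \<Longrightarrow> g (w + t *\<^sub>R (x - w)) = t ^ k * g x"
  shows "has_d1 V (\<lambda>x. if x \<in> T then g x *\<^sub>R vol (x - w) else 0)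
    (\<lambda>x. if x \<in> T then (real (k + 2) * g x) *\<^sub>R vol else 0)"
  unfolding has_d1_iff
proof (intro conjI ballI)
  show "(\<lambda>x. if x \<in> T then (real (k + 2) * g x) *\<^sub>R vol else 0) \<in> C0_form2 T"
    by (intro C0_form2_vol continuous_intros continuous_on_subset[OF g]) auto
  fix \<phi> assume \<phi>: "\<phi> \<in> tests"
  obtain C where C: "compact C" "C \<subseteq> interior T" and z: "\<And>x. x \<notin> C \<Longrightarrow> \<phi> x = 0"
    "\<And>x v. x \<notin> C \<Longrightarrow> frechet_derivative \<phi> (at x) v = 0"
    using test_functionsE[OF \<phi>] by metis
  let ?D = "\<lambda>x. frechet_derivative \<phi> (at x)"
  note d = test_functions_derivative[OF \<phi>]
  let ?u = "\<lambda>x. if x \<in> T then g x *\<^sub>R vol (x - w) else 0"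
  have off: "\<phi> x = 0" "?D x v = 0" if "x \<notin> T" for x v
    using test_functions_off_T[OF \<phi> that] by auto
  have lin: "?D x y = dlam 1 y * ?D x e1 + dlam 2 y * ?D x e2" for x y
  proof -
    have l: "linear (?D x)" by (rule has_derivative_linear[OF d(1)])
    have "?D x y = ?D x (dlam 1 y *\<^sub>R e1 + dlam 2 y *\<^sub>R e2)" by (rule arg_cong[OF dlam_rep])
    then show ?thesis by (simp add: linear_add[OF l] linear_scale[OF l])
  qed
  have "?u x e1 * ?D x e2 - ?u x e2 * ?D x e1 = (- 1) * (g x * ?D x (x - w))" for x
    using off(2)[of x] by (cases "x \<in> T") (simp_all add: lin[of x "x - w"] vol_apply blinfun.scaleR_left algebra_simps)
  then have "pint (\<lambda>x. ?u x e1 * ?D x e2 - ?u x e2 * ?D x e1) = (- 1) * pint (\<lambda>x. g x * ?D x (x - w))"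
    by (simp only: pint_cmult)
  also have "\<dots> = real (k + 2) * pint (\<lambda>x. \<phi> x * g x)"
    using pint_radial_derivative[OF d(1,2) C(1) z g hom] by (simp add: algebra_simps)
  also have "\<dots> = pint (\<lambda>x. real (k + 2) * (\<phi> x * g x))" by (rule pint_cmult[symmetric])
  also have "\<dots> = pint (\<lambda>x. (if x \<in> T then (real (k + 2) * g x) *\<^sub>R vol else 0) e1 e2 * \<phi> x)"
    using off(1) by (intro arg_cong[where f = pint]) (auto simp: fun_eq_iff blinfun.bilinear_simps)
  finally show "pint (\<lambda>x. (if x \<in> T then (real (k + 2) * g x) *\<^sub>R vol else 0) e1 e2 * \<phi> x) =
     pint (\<lambda>x. ?u x e1 * ?D x e2 - ?u x e2 * ?D x e1)" by simp
qed

end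

section \<open>Stokes' theorem for weak exterior derivatives\<close>

lemma integral_reflect_interval:
  fixes f :: "real \<Rightarrow> real"
  assumes "continuous_on {0..L} f" "0 \<le> L"
  shows "integral {0..L} (\<lambda>x. f (L - x)) = integral {0..L} f"
proof -
  have "(f has_integral integral {0..L} f) (cbox 0 L)"
    using assms(1) integrable_continuous_real integrable_integral by fastforce
  from has_integral_affinity[OF this, of "-1" L]
  have "((\<lambda>x. f (L - x)) has_integral integral {0..L} f) ((\<lambda>x. L - x) ` {0..L})"
    by simp
  moreover have "(\<lambda>x. L - x) ` {0..L} = {0..L}"
    by (auto intro!: image_eqI[of _ _ "L - _"])
  ultimately show ?thesis by (simp add: integral_unique)
qed

locale cutoff =
  fixes step step' :: "real \<Rightarrow> real"
  assumes smooth_step: "C_k k step" and smooth_step': "C_k k step'"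
    and step_deriv: "(step has_real_derivative step' t) (at t)"
    and step'_nonneg: "0 \<le> step' t" and step'_zero: "t \<le> 1 \<or> 2 \<le> t \<Longrightarrow> step' t = 0"
    and step_zero: "t \<le> 1 \<Longrightarrow> step t = 0" and step_one: "2 \<le> t \<Longrightarrow> step t = 1"
    and step_nonneg: "0 \<le> step t" and step_le_1: "step t \<le> 1"
begin

lemma continuous_step [continuous_intros]: "continuous_on S f \<Longrightarrow> continuous_on S (\<lambda>x. step (f x))"
  and continuous_step' [continuous_intros]: "continuous_on S f \<Longrightarrow> continuous_on S (\<lambda>x. step' (f x))"
  using continuous_on_compose2[OF C_k_continuous[OF smooth_step]] continuous_on_compose2[OF C_k_continuous[OF smooth_step']]
  by blast+

lemma layer_integral:
  assumes "0 \<le> b"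
  shows "((\<lambda>t. N * step' (N * t)) has_integral step (N * b)) {0..b}"
proof -
  have "((\<lambda>t. N * step' (N * t)) has_integral step (N * b) - step (N * 0)) {0..b}"
  proof (rule fundamental_theorem_of_calculus[OF assms])
    fix t
    have "((\<lambda>t. step (N * t)) has_real_derivative step' (N * t) * N) (at t)"
      by (rule DERIV_chain2[OF step_deriv]) (auto intro!: derivative_eq_intros)
    then show "((\<lambda>t. step (N * t)) has_vector_derivative N * step' (N * t)) (at t within {0..b})"
      by (simp add: has_real_derivative_iff_has_vector_derivative mult.commute has_vector_derivative_at_within)
  qed
  then show ?thesis by (simp add: step_zero)
qed

lemma layer_bound:
  assumes "continuous_on {0..1} f" "\<And>t. t \<in> {0..1} \<Longrightarrow> \<bar>f t\<bar> \<le> M * (N * step' (N * t))" "0 \<le> M"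
  shows "\<bar>integral {0..1} f\<bar> \<le> M"
proof -
  have i: "((\<lambda>t. M * (N * step' (N * t))) has_integral M * step N) {0..1}"
    using has_integral_mult_right[OF layer_integral[of 1 N], of M] by simp
  then have "norm (integral {0..1} f) \<le> integral {0..1} (\<lambda>t. M * (N * step' (N * t)))"
    by (intro integral_norm_bound_integral) (use assms in \<open>auto intro: integrable_continuous_real\<close>)
  also have "\<dots> = M * step N" using i by (rule integral_unique)
  also have "\<dots> \<le> M * 1" by (intro mult_left_mono step_le_1 assms)
  finally show ?thesis by simp
qed

text \<open>
  The kernels \<open>N step'(N t)\<close> are nonnegative, supported in \<open>[1/N, 2/N]\<close> and of integral 1, so they
  concentrate at \<open>t = 0\<close>.
\<close>

lemma layer_limit:
  fixes f c :: "nat \<Rightarrow> real \<Rightarrow> real"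
  assumes f: "\<And>n. continuous_on {0..1} (f n)"
    "\<And>n t. t \<in> {0..1} \<Longrightarrow> f n t = real (Suc n) * step' (real (Suc n) * t) * c n t"
    and lim: "\<And>e. e > 0 \<Longrightarrow> \<forall>\<^sub>F n in sequentially. \<forall>t\<in>{0..1}. real (Suc n) * t \<le> 2 \<longrightarrow> \<bar>c n t - c0\<bar> \<le> e"
  shows "(\<lambda>n. integral {0..1} (f n)) \<longlonglongrightarrow> c0"
proof (rule LIMSEQ_I)
  fix r :: real assume r: "0 < r"
  have "\<forall>\<^sub>F n in sequentially. norm (integral {0..1} (f n) - c0) < r"
    using lim[OF half_gt_zero[OF r]] eventually_ge_at_top[of 1]
  proof eventually_elim
    case (elim n)
    let ?N = "real (Suc n)"
    have i: "((\<lambda>t. ?N * step' (?N * t) * c0) has_integral c0) {0..1}"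
      using has_integral_mult_left[OF layer_integral[of 1 ?N], of c0] elim(2) by (simp add: step_one)
    have "\<bar>integral {0..1} (\<lambda>t. f n t - ?N * step' (?N * t) * c0)\<bar> \<le> r / 2"
    proof (rule layer_bound[where N = ?N])
      show "continuous_on {0..1} (\<lambda>t. f n t - ?N * step' (?N * t) * c0)"
        by (intro continuous_intros f)
      fix t :: real assume t: "t \<in> {0..1}"
      have eq: "\<bar>f n t - ?N * step' (?N * t) * c0\<bar> = ?N * step' (?N * t) * \<bar>c n t - c0\<bar>"
        using f(2)[OF t] step'_nonneg[of "?N * t"]
        by (simp add: abs_mult right_diff_distrib[symmetric] del: of_nat_Suc)
      show "\<bar>f n t - ?N * step' (?N * t) * c0\<bar> \<le> r / 2 * (?N * step' (?N * t))"
      proof (cases "?N * t \<le> 2")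
        case True
        then have "\<bar>c n t - c0\<bar> \<le> r / 2" using elim(1) t by blast
        then have "?N * step' (?N * t) * \<bar>c n t - c0\<bar> \<le> ?N * step' (?N * t) * (r / 2)"
          by (intro mult_left_mono mult_nonneg_nonneg step'_nonneg) auto
        then show ?thesis unfolding eq by (simp add: mult.commute)
      next
        case False
        then show ?thesis unfolding eq by (simp add: step'_zero del: of_nat_Suc)
      qed
    qed (use r in auto)
    moreover have "integral {0..1} (\<lambda>t. f n t - ?N * step' (?N * t) * c0) = integral {0..1} (f n) - c0"
      using integral_diff[OF integrable_continuous_real[OF f(1)] has_integral_integrable[OF i]] integral_unique[OF i]
      by simp
    ultimately show ?case using r by simp
  qed
  then show "\<exists>no. \<forall>n\<ge>no. norm (integral {0..1} (f n) - c0) < r"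
    by (simp add: eventually_sequentially)
qed

end

locale triangle_cutoff = triangle V + cutoff step step'
  for V :: "3 \<Rightarrow> 'a::euclidean_space" and step step'
begin

text \<open>
  The coefficient of \<open>d\<lambda>\<^sub>i\<close> in the differential of the cut-off function \<open>cut_fun n\<close>. It lives in a strip
  of width proportional to \<open>1/n\<close> along edge \<open>i\<close>.
\<close>

definition "layer n i x = real (Suc n) * step' (real (Suc n) * lam i x) *
    (step (real (Suc n) * lam (i + 1) x) * step (real (Suc n) * lam (i + 2) x))"

text \<open>
  The cut-off function number \<open>n\<close> and its differential vanish outside this smaller triangle.
\<close>

definition "core n = {x. \<forall>i. 1 / real (Suc n) \<le> lam i x}"

lemma continuous_layer: "continuous_on S (layer n i)"
  unfolding layer_def by (intro continuous_intros)

lemma core: "core n \<subseteq> interior T" "compact (core n)" "closed (core n)"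
proof -
  show sub: "core n \<subseteq> interior T"
    by (auto simp: core_def interior_T intro: less_le_trans[of _ "1 / real (Suc n)"])
  show "closed (core n)"
    unfolding core_def by (intro closed_Collect_all closed_Collect_le continuous_intros)
  moreover have "core n \<subseteq> T" using sub interior_subset by blast
  ultimately show "compact (core n)"
    using compact_T closed_subset compact_imp_closed by (metis compact_Int_closed inf.absorb_iff2)
qed

lemma not_core:
  assumes "x \<notin> core n"
  obtains i where "real (Suc n) * lam i x \<le> 1"
proof -
  obtain i where "\<not> 1 / real (Suc n) \<le> lam i x" using assms by (auto simp: core_def)
  then have "lam i x * real (Suc n) < 1" by (simp add: not_le pos_less_divide_eq del: of_nat_Suc)
  then show thesis by (intro that[of i]) (simp add: mult.commute)
qed

lemma layer_off_core:
  assumes "x \<notin> core n"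
  shows "layer n i x = 0"
proof -
  obtain j where j: "real (Suc n) * lam j x \<le> 1" using not_core[OF assms] .
  show ?thesis using cases_mod3[of j i] j by (auto simp: layer_def step'_zero step_zero simp del: of_nat_Suc)
qed

lemma continuous_layer_times:
  assumes "continuous_on T g"
  shows "continuous_on UNIV (\<lambda>x. layer n i x * g x)"
proof -
  have "continuous_on UNIV (\<lambda>x. g x * layer n i x)"
    using core[of n] interior_subset
    by (intro continuous_on_times_compact_support[OF open_interior core(3,1)] continuous_layer layer_off_core
        continuous_on_subset[OF assms]) auto
  then show ?thesis by (simp add: mult.commute)
qed

text \<open>
  The parametrisation \<open>q s r\<close> runs along edge \<open>i\<close> with \<open>s\<close> and away from it with \<open>r = \<lambda>\<^sub>i\<close>. For fixed \<open>s\<close> the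
  inner integral concentrates at \<open>r = 0\<close>, and dominated convergence gives the limit of the outer one.
  The two corner factors of \<open>layer\<close> are eventually 1 near \<open>r = 0\<close> as long as \<open>s\<close> is not 0 or 1.
\<close>

lemma sweep_limit:
  assumes g: "continuous_on T g"
    and q: "continuous_on UNIV (\<lambda>p. q (fst p) (snd p))"
    and lam_q: "\<And>s r. lam i (q s r) = r"
      "(\<forall>s r. lam (i + 1) (q s r) = s \<and> lam (i + 2) (q s r) = 1 - s - r) \<or>
       (\<forall>s r. lam (i + 2) (q s r) = s \<and> lam (i + 1) (q s r) = 1 - s - r)"
  shows "(\<lambda>n. integral {0..1} (\<lambda>s. integral {0..1} (\<lambda>r. layer n i (q s r) * g (q s r))))
      \<longlonglongrightarrow> integral {0..1} (\<lambda>s. g (q s 0))"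
proof -
  let ?N = "\<lambda>n. real (Suc n)"
  let ?F = "\<lambda>n p. layer n i (q (fst p) (snd p)) * g (q (fst p) (snd p))"
  let ?J = "\<lambda>n s. integral {0..1} (\<lambda>r. layer n i (q s r) * g (q s r))"
  have layer_q: "layer n i (q s r) = ?N n * step' (?N n * r) * (step (?N n * s) * step (?N n * (1 - s - r)))" for n s r
    using lam_q by (auto simp: layer_def mult.commute)
  have contF: "continuous_on UNIV (?F n)" for n
    by (rule continuous_on_compose2[OF continuous_layer_times[OF g] q]) auto
  have contJ: "continuous_on {0..1} (\<lambda>r. layer n i (q s r) * g (q s r))" for n s
    using continuous_on_compose2[OF contF, of "{0..1}" "\<lambda>r. (s, r)" n] by (simp add: continuous_intros)
  have inT: "q s r \<in> T \<longleftrightarrow> 0 \<le> r \<and> 0 \<le> s \<and> s + r \<le> 1" for s r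
    unfolding T_iff forall_cyclic[where l = i] using lam_q by auto
  have "bounded (g ` T)" by (intro compact_imp_bounded compact_continuous_image g compact_T)
  then obtain M where M: "M > 0" "\<And>x. x \<in> T \<Longrightarrow> \<bar>g x\<bar> \<le> M"
    unfolding bounded_pos by auto
  have bound: "\<bar>?J n s\<bar> \<le> M" for n s
  proof (rule layer_bound[OF contJ])
    fix r :: real
    have "\<bar>layer n i (q s r) * g (q s r)\<bar> \<le> ?N n * step' (?N n * r) * M"
    proof (cases "q s r \<in> T")
      case True
      have "\<bar>layer n i (q s r)\<bar> \<le> ?N n * step' (?N n * r) * (1 * 1)"
        unfolding layer_q abs_mult
        by (intro mult_mono) (simp_all add: step'_nonneg step_nonneg step_le_1 del: of_nat_Suc)
      then show ?thesis unfolding abs_mult using M True by (intro mult_mono) (simp_all add: step'_nonneg)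
    next
      case False
      then have "layer n i (q s r) = 0" using core[of n] interior_subset by (intro layer_off_core) blast
      then show ?thesis using M by (simp add: step'_nonneg)
    qed
    then show "\<bar>layer n i (q s r) * g (q s r)\<bar> \<le> M * (?N n * step' (?N n * r))"
      by (simp add: mult.commute)
  qed (use M in simp)
  have lim: "(\<lambda>n. ?J n s) \<longlonglongrightarrow> g (q s 0)" if s: "s \<in> {0<..<1}" for s
  proof (rule layer_limit[OF contJ, where c = "\<lambda>n r. step (?N n * s) * step (?N n * (1 - s - r)) * g (q s r)"])
    show "layer n i (q s r) * g (q s r) = ?N n * step' (?N n * r) *
        (step (?N n * s) * step (?N n * (1 - s - r)) * g (q s r))" for n r
      by (simp only: layer_q mult.assoc)
    fix e :: real assume e: "0 < e"
    have "continuous_on {0..1 - s} (\<lambda>r. g (q s r))"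
    proof (rule continuous_on_compose2[OF g])
      show "continuous_on {0..1 - s} (q s)"
        using continuous_on_compose2[OF q, of "{0..1 - s}" "\<lambda>r. (s, r)"] by (simp add: continuous_intros)
    qed (use inT s in auto)
    then obtain d where d: "d > 0" "\<And>r. r \<in> {0..1 - s} \<Longrightarrow> dist r 0 < d \<Longrightarrow> dist (g (q s r)) (g (q s 0)) < e"
      using s e unfolding continuous_on_iff by (elim ballE[of _ _ 0] allE[of _ e]) auto
    \<comment> \<open>from \<open>n0\<close> on the strip is narrower than \<open>d\<close> and both corner factors are 1 on it\<close>
    obtain n0 :: nat where n0: "2 / d + 2 / s + 4 / (1 - s) < real n0" using reals_Archimedean2 by blast
    show "\<forall>\<^sub>F n in sequentially. \<forall>r\<in>{0..1}. ?N n * r \<le> 2 \<longrightarrow>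
        \<bar>step (?N n * s) * step (?N n * (1 - s - r)) * g (q s r) - g (q s 0)\<bar> \<le> e"
      using eventually_ge_at_top[of n0]
    proof eventually_elim
      case (elim n)
      have pos: "2 / d > 0" "2 / s > 0" "4 / (1 - s) > 0" using d s by simp_all
      have big: "2 / d < ?N n" "2 / s < ?N n" "4 / (1 - s) < ?N n"
        unfolding of_nat_Suc using of_nat_mono[OF elim, where 'a = real] n0 pos by linarith+
      then have N: "2 < ?N n * d" "2 < ?N n * s" "4 < ?N n * (1 - s)"
        using d s by (simp_all add: pos_divide_less_eq)
      show ?case
      proof (intro ballI impI)
        fix r :: real assume r: "r \<in> {0..1}" "?N n * r \<le> 2"
        have 1: "?N n * r < ?N n * d" "?N n * r \<le> ?N n * (1 - s)" using N r by linarith+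
        then have "r < d" "r \<le> 1 - s" by (simp_all del: of_nat_Suc)
        then have "dist (g (q s r)) (g (q s 0)) < e" using d(2)[of r] r by simp
        moreover have "step (?N n * s) = 1" using N by (intro step_one) simp
        moreover have "step (?N n * (1 - s - r)) = 1"
          using N r by (intro step_one) (simp add: right_diff_distrib del: of_nat_Suc)
        ultimately show "\<bar>step (?N n * s) * step (?N n * (1 - s - r)) * g (q s r) - g (q s 0)\<bar> \<le> e"
          by (simp add: dist_real_def)
      qed
    qed
  qed
  have intJ: "?J n integrable_on {0<..<1}" for n
    using integral_integrable_2dim[OF continuous_on_subset[OF contF[of n] subset_UNIV], of 0 1 0 1]
    by (simp add: integrable_on_open_interval_real)
  have "(\<lambda>n. integral {0<..<1} (?J n)) \<longlonglongrightarrow> integral {0<..<1} (\<lambda>s. g (q s 0))"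
  proof (rule dominated_convergence(2)[OF intJ])
    show "(\<lambda>_. M) integrable_on {0<..<1::real}" using integrable_const_ivl[of M 0 "1::real"] by (simp add: integrable_on_open_interval_real)
  qed (use bound lim in auto)
  then show ?thesis by (simp only: integral_open_interval_real)
qed

text \<open>
  The three iterated integrals are adapted to the three edges: the inner variable is the barycentric
  coordinate that vanishes on edge 2, edge 1 and edge 0, respectively.
\<close>

lemma pint_iterated:
  assumes F: "continuous_on UNIV F" and off: "\<And>x. x \<notin> T \<Longrightarrow> F x = 0"
  shows "pint F = integral {0..1} (\<lambda>s. integral {0..1} (\<lambda>t. F (Pt (s, t))))"
    and "pint F = integral {0..1} (\<lambda>t. integral {0..1} (\<lambda>s. F (Pt (s, t))))"
    and "pint F = integral {0..1} (\<lambda>s. integral {0..1} (\<lambda>r. F (Pt (s, 1 - s - r))))"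
proof -
  have cont: "continuous_on UNIV (\<lambda>p. F (Pt p))"
    by (intro continuous_on_compose2[OF F] continuous_intros) auto
  have z: "F (Pt p) = 0" if "p \<notin> Tref" for p using off that Pt_in_T by blast
  have "pint F = integral (cbox (0, 0) (1, 1)) (\<lambda>p. F (Pt p))"
    unfolding pint_def
    by (rule has_integral_compact_support(3)[OF cont, symmetric]) (rule z, auto simp: Tref_def)
  also have "\<dots> = integral {0..1} (\<lambda>s. integral {0..1} (\<lambda>t. F (Pt (s, t))))"
    using integral_prod_continuous[OF continuous_on_subset[OF cont subset_UNIV], of 0 0 1 1] by simp
  finally show 1: "pint F = integral {0..1} (\<lambda>s. integral {0..1} (\<lambda>t. F (Pt (s, t))))" .
  also have "\<dots> = integral {0..1} (\<lambda>t. integral {0..1} (\<lambda>s. F (Pt (s, t))))"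
    using integral_swap_continuous[of 0 0 1 1 "\<lambda>s t. F (Pt (s, t))"] continuous_on_subset[OF cont subset_UNIV]
    by (simp add: case_prod_beta')
  finally show "pint F = integral {0..1} (\<lambda>t. integral {0..1} (\<lambda>s. F (Pt (s, t))))" .
  have "integral {0..1} (\<lambda>r. F (Pt (s, 1 - s - r))) = integral {0..1} (\<lambda>t. F (Pt (s, t)))"
    if s: "s \<in> {0..1}" for s
  proof -
    have c: "continuous_on S (\<lambda>t. F (Pt (s, t)))" for S
      using continuous_on_compose2[OF cont, of S "\<lambda>t. (s, t)"] by (simp add: continuous_intros)
    have sup: "integral {0..1} h = integral {0..1 - s} h"
      if "continuous_on {0..1 - s} h" "\<And>t. t \<notin> {0..1 - s} \<Longrightarrow> h t = 0" for h :: "real \<Rightarrow> real"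
      by (rule integral_unique, rule has_integral_on_superset[OF integrable_integral[OF integrable_continuous_real[OF that(1)]]])
        (use that s in auto)
    have "integral {0..1} (\<lambda>r. F (Pt (s, 1 - s - r))) = integral {0..1 - s} (\<lambda>r. F (Pt (s, 1 - s - r)))"
    proof (rule sup)
      show "continuous_on {0..1 - s} (\<lambda>r. F (Pt (s, 1 - s - r)))"
        using continuous_on_compose2[OF cont, of _ "\<lambda>t. (s, 1 - s - t)"] by (simp add: continuous_intros)
    qed (use s in \<open>auto intro!: z simp: Tref_def\<close>)
    also have "\<dots> = integral {0..1 - s} (\<lambda>t. F (Pt (s, t)))"
      using s by (intro integral_reflect_interval[where f = "\<lambda>t. F (Pt (s, t))"] c) auto
    also have "\<dots> = integral {0..1} (\<lambda>t. F (Pt (s, t)))"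
      by (rule sup[symmetric, OF c]) (use s in \<open>auto intro!: z simp: Tref_def\<close>)
    finally show ?thesis .
  qed
  then have "integral {0..1} (\<lambda>s. integral {0..1} (\<lambda>r. F (Pt (s, 1 - s - r)))) =
      integral {0..1} (\<lambda>s. integral {0..1} (\<lambda>t. F (Pt (s, t))))"
    by (rule integral_cong)
  then show "pint F = integral {0..1} (\<lambda>s. integral {0..1} (\<lambda>r. F (Pt (s, 1 - s - r))))"
    using 1 by simp
qed

lemma edge_point:
  "linepath (V 0) (V 1) t = Pt (t, 0)"
  "linepath (V 2) (V 0) t = Pt (0, 1 - t)"
  "linepath (V 1) (V 2) t = Pt (1 - t, t)"
  by (simp_all add: linepath_def Pt_def e1_def e2_def algebra_simps)

lemma edge_limit:
  assumes g: "continuous_on T g"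
  shows "(\<lambda>n. pint (\<lambda>x. layer n i x * g x)) \<longlonglongrightarrow> integral {0..1} (\<lambda>t. g (linepath (V (i + 1)) (V (i + 2)) t))"
proof -
  have off: "layer n i x * g x = 0" if "x \<notin> T" for n i x
    using that layer_off_core[of x n i] core(1)[of n] interior_subset by auto
  have it: "pint (\<lambda>x. layer n i x * g x) = integral {0..1} (\<lambda>s. integral {0..1} (\<lambda>t. layer n i (Pt (s, t)) * g (Pt (s, t))))"
    "pint (\<lambda>x. layer n i x * g x) = integral {0..1} (\<lambda>t. integral {0..1} (\<lambda>s. layer n i (Pt (s, t)) * g (Pt (s, t))))"
    "pint (\<lambda>x. layer n i x * g x) = integral {0..1} (\<lambda>s. integral {0..1}
        (\<lambda>r. layer n i (Pt (s, 1 - s - r)) * g (Pt (s, 1 - s - r))))" for n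
    by (rule pint_iterated[OF continuous_layer_times[OF g]], rule off, assumption)+
  have refl: "integral {0..1} (\<lambda>t. g (q (1 - t))) = integral {0..1} (\<lambda>t. g (q t))"
    if "continuous_on {0..1} q" "q ` {0..1} \<subseteq> T" for q :: "real \<Rightarrow> 'a"
    using that by (intro integral_reflect_interval[where f = "\<lambda>t. g (q t)"] continuous_on_compose2[OF g]) auto
  consider "i = 0" | "i = 1" | "i = 2" using cases_mod3[of i 0] by auto
  then show ?thesis
  proof cases
    case 1
    have "(\<lambda>n. pint (\<lambda>x. layer n i x * g x)) \<longlonglongrightarrow> integral {0..1} (\<lambda>s. g (Pt (s, 1 - s - 0)))"
      unfolding it(3)
      by (rule sweep_limit[OF g, where q = "\<lambda>s r. Pt (s, 1 - s - r)"]) (auto simp: 1 lam_Pt intro!: continuous_intros)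
    also have "integral {0..1} (\<lambda>s. g (Pt (s, 1 - s - 0))) = integral {0..1} (\<lambda>s. g (Pt (1 - s, s)))"
    proof -
      have "continuous_on {0..1} (\<lambda>s. Pt (s, 1 - s))" by (intro continuous_intros)
      moreover have "(\<lambda>s. Pt (s, 1 - s)) ` {0..1} \<subseteq> T" by (auto simp: Pt_in_T Tref_def)
      ultimately show ?thesis using refl[of "\<lambda>s. Pt (s, 1 - s)"] by simp
    qed
    finally show ?thesis by (simp add: 1 edge_point)
  next
    case 2
    have "(\<lambda>n. pint (\<lambda>x. layer n i x * g x)) \<longlonglongrightarrow> integral {0..1} (\<lambda>s. g (Pt (0, s)))"
      unfolding it(2)
      by (rule sweep_limit[OF g, where q = "\<lambda>s r. Pt (r, s)"]) (auto simp: 2 lam_Pt intro!: continuous_intros)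
    also have "integral {0..1} (\<lambda>s. g (Pt (0, s))) = integral {0..1} (\<lambda>s. g (Pt (0, 1 - s)))"
    proof -
      have "continuous_on {0..1} (\<lambda>s. Pt (0, s))" by (intro continuous_intros)
      moreover have "(\<lambda>s. Pt (0, s)) ` {0..1} \<subseteq> T" by (auto simp: Pt_in_T Tref_def)
      ultimately show ?thesis using refl[of "\<lambda>s. Pt (0, s)"] by simp
    qed
    finally show ?thesis by (simp add: 2 edge_point)
  next
    case 3
    have "(\<lambda>n. pint (\<lambda>x. layer n i x * g x)) \<longlonglongrightarrow> integral {0..1} (\<lambda>s. g (Pt (s, 0)))"
      unfolding it(1)
      by (rule sweep_limit[OF g, where q = "\<lambda>s r. Pt (s, r)"]) (auto simp: 3 lam_Pt intro!: continuous_intros)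
    then show ?thesis by (simp add: 3 edge_point)
  qed
qed

definition "cut_fun n x = step (real (Suc n) * lam 0 x) * (step (real (Suc n) * lam 1 x) * step (real (Suc n) * lam 2 x))"

lemma cut_fun_test: "cut_fun n \<in> tests"
proof (rule test_functionsI[OF _ core(2,1)])
  fix k
  have lam_lin: "lam i x = dlam i x + lam i 0" for i x using lam_add[of i 0 x] by simp
  have "C_k k (\<lambda>x. step (real (Suc n) * lam i x))" for i
  proof -
    have "C_k k (\<lambda>x. step (real (Suc n) * dlam i x + real (Suc n) * lam i 0))"
      by (rule C_k_affine_compose[OF _ smooth_step])
        (auto intro!: bounded_linear_intros)
    then show ?thesis by (subst lam_lin) (simp add: distrib_left)
  qed
  then show "C_k k (cut_fun n)" unfolding cut_fun_def[abs_def] by (intro C_k_mult)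
  fix x assume "x \<notin> core n"
  then obtain i where i: "real (Suc n) * lam i x \<le> 1" using not_core by blast
  show "cut_fun n x = 0" using cases_mod3[of i 0] i by (auto simp: cut_fun_def step_zero simp del: of_nat_Suc)
qed

lemma cut_fun_derivative:
  "frechet_derivative (cut_fun n) (at x) v = (\<Sum>i\<in>UNIV. layer n i x * dlam i v)"
proof -
  let ?N = "real (Suc n)"
  have "((\<lambda>x. step (?N * lam i x)) has_derivative (\<lambda>v. (?N * dlam i v) * step' (?N * lam i x))) (at x)" for i
    by (rule DERIV_compose_FDERIV[OF step_deriv]) (intro has_derivative_mult_right lam_has_derivative)
  note this[derivative_intros]
  have "(cut_fun n has_derivative (\<lambda>v. \<Sum>i\<in>UNIV. layer n i x * dlam i v)) (at x)"
    unfolding cut_fun_def[abs_def]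
    by (rule derivative_eq_intros refl)+
      (simp add: sum_mod3 layer_def fun_eq_iff algebra_simps)
  then show ?thesis by (simp add: frechet_derivative_eqI[of "cut_fun n"])
qed

text \<open>
  Wedging \<open>u\<close> with \<open>d\<lambda>\<^sub>i\<close> evaluates \<open>u\<close> in the direction of the oriented edge \<open>i\<close>, on which \<open>\<lambda>\<^sub>i\<close> is zero.
\<close>

lemma edge_direction: "u e1 * dlam i e2 - u e2 * dlam i e1 = u (V (i + 2) - V (i + 1))"
  for u :: "'a \<Rightarrow>\<^sub>L real"
proof -
  have "\<forall>i. u e1 * dlam i e2 - u e2 * dlam i e1 = u (V (i + 2) - V (i + 1))"
    unfolding forall_mod3 dlam_e dlam_e0 by (simp add: e1_def e2_def blinfun.bilinear_simps)
  then show ?thesis by blast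
qed

text \<open>
  The identity that defines the weak derivative is applied to the cut-off functions. Its left side tends
  to the integral over \<open>T\<close>; on its right side the strip along edge \<open>i\<close> contributes the integral over that
  edge in the limit.
\<close>

lemma stokes_by_cutoff:
  assumes u: "has_d1 V u w" "continuous_on T u"
  shows "integral2 V w = (\<Sum>i\<in>UNIV. edge_integral V i u)"
proof -
  have w: "w \<in> C0_form2 T" using u by (simp add: has_d1_iff)
  define W where "W x = w x e1 e2" for x
  define G where "G i x = u x (V (i + 2) - V (i + 1))" for i x
  have contG: "continuous_on T (G i)" for i unfolding G_def by (intro continuous_intros u)
  have contW: "continuous_on T W" unfolding W_def by (rule C0_form2_rep(2)[OF w])
  have W0: "W x = 0" if "x \<notin> T" for x using C0_form2_rep(3)[OF w that] by (simp add: W_def)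
  have off: "layer n i x * G i x = 0" if "x \<notin> core n" for n i x
    using that layer_off_core by simp
  have 1: "pint (\<lambda>x. W x * cut_fun n x) = (\<Sum>i\<in>UNIV. pint (\<lambda>x. layer n i x * G i x))" for n
  proof -
    let ?D = "\<lambda>x. frechet_derivative (cut_fun n) (at x)"
    have "u x e1 * ?D x e2 - u x e2 * ?D x e1 = (\<Sum>i\<in>UNIV. layer n i x * G i x)" for x
      unfolding cut_fun_derivative G_def edge_direction[symmetric]
      by (simp add: sum_mod3 algebra_simps del: dlam_e dlam_e0)
    then have "pint (\<lambda>x. W x * cut_fun n x) = pint (\<lambda>x. \<Sum>i\<in>UNIV. layer n i x * G i x)"
      using u(1) cut_fun_test[of n] unfolding has_d1_iff by (simp add: W_def)
    also have "\<dots> = (\<Sum>i\<in>UNIV. pint (\<lambda>x. layer n i x * G i x))"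
      unfolding pint_def
      by (intro integral_sum finite integrable_pint[OF continuous_layer_times[OF contG] core(2)] off)
    finally show ?thesis .
  qed
  have "(\<lambda>n. pint (\<lambda>x. W x * cut_fun n x)) \<longlonglongrightarrow> (\<Sum>i\<in>UNIV. edge_integral V i u)"
    unfolding 1 edge_integral_def using edge_limit[OF contG] by (intro tendsto_sum) (simp add: G_def)
  moreover have "(\<lambda>n. pint (\<lambda>x. W x * cut_fun n x)) \<longlonglongrightarrow> integral2 V w"
  proof -
    let ?f = "\<lambda>n p. W (Pt p) * cut_fun n (Pt p)"
    have "bounded (W ` T)" by (intro compact_imp_bounded compact_continuous_image contW compact_T)
    then obtain M where M: "M > 0" "\<And>x. x \<in> T \<Longrightarrow> \<bar>W x\<bar> \<le> M"
      unfolding bounded_pos by auto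
    have cut01: "0 \<le> cut_fun n x" "cut_fun n x \<le> 1" for n x
      by (simp_all add: cut_fun_def step_nonneg mult_le_one step_le_1)
    have int: "?f n integrable_on Tref" for n
    proof -
      have "?f n integrable_on UNIV"
        by (rule test_product_integrable[OF cut_fun_test open_interior])
          (use contW interior_subset continuous_on_subset in blast)
      then have "(\<lambda>p. if p \<in> Tref then ?f n p else 0) integrable_on UNIV"
        using W0 Pt_in_T by (elim integrable_eq) auto
      then show ?thesis by (simp add: integrable_restrict_UNIV)
    qed
    define g where "g p = (if Pt p \<in> interior T then W (Pt p) else 0)" for p
    have "(\<lambda>n. integral Tref (?f n)) \<longlonglongrightarrow> integral Tref g"
    proof (rule dominated_convergence(2)[OF int])
      show "(\<lambda>_. M) integrable_on Tref"
        by (intro integrable_on_const) (simp add: lmeasurable_compact[OF compact_Tref])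
      show "norm (?f n p) \<le> M" if "p \<in> Tref" for n p
      proof -
        have "\<bar>W (Pt p)\<bar> * \<bar>cut_fun n (Pt p)\<bar> \<le> M * 1"
          by (rule mult_mono) (use M cut01 that Pt_in_T in auto)
        then show ?thesis by (simp add: abs_mult)
      qed
      show "(\<lambda>n. ?f n p) \<longlonglongrightarrow> g p" if "p \<in> Tref" for p
      proof (cases "Pt p \<in> interior T")
        case True
        then have pos: "0 < lam i (Pt p)" for i by (simp add: interior_T)
        have ev: "\<forall>\<^sub>F n in sequentially. step (real (Suc n) * lam i (Pt p)) = 1" for i
        proof -
          obtain n0 where "2 / lam i (Pt p) < real n0" using reals_Archimedean2 by blast
          then have n0: "2 < real n0 * lam i (Pt p)" using pos[of i] by (simp add: pos_divide_less_eq)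
          show ?thesis
            using eventually_ge_at_top[of n0]
          proof eventually_elim
            case (elim n)
            have "real n0 * lam i (Pt p) \<le> real (Suc n) * lam i (Pt p)"
              using elim pos[of i] by (intro mult_right_mono) auto
            then show ?case using n0 by (intro step_one) linarith
          qed
        qed
        have "\<forall>\<^sub>F n in sequentially. cut_fun n (Pt p) = 1"
          using ev[of 0] ev[of 1] ev[of 2] by eventually_elim (simp add: cut_fun_def)
        then have "\<forall>\<^sub>F n in sequentially. ?f n p = g p"
          by eventually_elim (use True in \<open>simp add: g_def\<close>)
        then show ?thesis by (rule tendsto_eventually)
      next
        case False
        then have "cut_fun n (Pt p) = 0" for n using test_functionsE[OF cut_fun_test, of n] by (metis subsetD)
        then show ?thesis using False by (simp add: g_def)
      qed
    qed
    also have "integral Tref g = integral Tref (\<lambda>p. W (Pt p))"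
    proof (rule integral_spike)
      show "negligible ({p. (1, 0) \<bullet> p = 0} \<union> {p. (0, 1) \<bullet> p = 0} \<union> {p. (1, 1) \<bullet> p = (1::real)} :: (real \<times> real) set)"
        by (intro negligible_Un negligible_hyperplane) (auto simp: zero_prod_def)
      show "W (Pt p) = g p" if "p \<in> Tref - ({p. (1, 0) \<bullet> p = 0} \<union> {p. (0, 1) \<bullet> p = 0} \<union> {p. (1, 1) \<bullet> p = 1})" for p
        using that by (auto simp: g_def interior_T forall_mod3 lam_Pt Tref_def inner_prod_def)
    qed
    also have "\<dots> = integral2 V w" by (simp add: integral2_def tri_integral_Pt W_def)
    also have "(\<lambda>n. integral Tref (?f n)) = (\<lambda>n. pint (\<lambda>x. W x * cut_fun n x))"
      using W0 by (subst integral_Tref[of "\<lambda>x. W x * cut_fun n x" for n]) auto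
    finally show ?thesis .
  qed
  ultimately show ?thesis using LIMSEQ_unique by blast
qed

end

text \<open>
  Continuity of \<open>u\<close> and \<open>w\<close> up to the boundary is all the regularity that is used; this generality
  is what the interpolation of arbitrary 1-forms demands.
\<close>

lemma (in triangle) stokes:
  assumes "has_d1 V u w" "continuous_on T u"
  shows "integral2 V w = (\<Sum>i\<in>UNIV. edge_integral V i u)"
proof -
  obtain step step' :: "real \<Rightarrow> real" where "cutoff step step'"
    using smooth_step_exists unfolding cutoff_def by metis
  then interpret triangle_cutoff V step step'
    by (simp add: triangle_cutoff_def triangle_axioms)
  show ?thesis using assms by (rule stokes_by_cutoff)
qed

section \<open>The spaces of piecewise polynomial forms\<close>

context triangle
begin

lemma polynomials_1_affine:
  assumes "p \<in> polynomials 1"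
  shows "p x = (\<Sum>i\<in>UNIV. lam i x * p (V i))"
proof -
  obtain c :: "nat \<Rightarrow> nat \<Rightarrow> real" where c: "\<And>s t. p (V 0 + s *\<^sub>R e1 + t *\<^sub>R e2) = (\<Sum>a\<le>1. \<Sum>b\<le>1 - a. c a b * s ^ a * t ^ b)"
    using polynomials_normal_form[OF assms, where ?x0.0 = "V 0" and e = e1 and e' = e2] by blast
  have p: "p y = c 0 0 + c 0 1 * lam 2 y + c 1 0 * lam 1 y" for y
    using c[of "lam 1 y" "lam 2 y"] Pt_lam[of y] by (simp add: Pt_def)
  have l0: "lam 0 x = 1 - lam 1 x - lam 2 x" using lam_sum[of x] by linarith
  show ?thesis by (simp add: sum_mod3 p l0 algebra_simps)
qed

lemma lam_polynomial: "lam i \<in> polynomials 1"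
proof -
  have "(\<lambda>x. dlam i x + lam i 0) \<in> polynomials 1"
    by (rule polynomials_affine) (simp add: bounded_linear.linear blinfun.bounded_linear_right)
  moreover have "lam i = (\<lambda>x. dlam i x + lam i 0)"
  proof
    fix x show "lam i x = dlam i x + lam i 0" using lam_add[of i 0 x] by simp
  qed
  ultimately show ?thesis by simp
qed

lemma linear_form_polynomial: "(\<lambda>x. f (x - y)) \<in> polynomials 1" for f :: "'a \<Rightarrow>\<^sub>L real"
  using polynomials_affine[of f "- f y"] by (simp add: blinfun.diff_right bounded_linear.linear blinfun.bounded_linear_right)

lemma C1_form0_add:
  assumes "u \<in> C1_form0 T" "v \<in> C1_form0 T"
  shows "u + v \<in> C1_form0 T" "d0 T (u + v) = d0 T u + d0 T v"
proof -
  have z: "(u + v) x = 0" "(d0 T u + d0 T v) x = 0" if "x \<notin> T" for x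
    using assms that by (auto simp: C1_form0_def zero_off_def d0_def plus_fun_def)
  have D: "(u + v has_derivative (d0 T u + d0 T v) x) (at x within T)" if "x \<in> T" for x
    using has_derivative_add[OF C1_form0_has_derivative[OF assms(1) that] C1_form0_has_derivative[OF assms(2) that]]
    by (simp add: plus_fun_def plus_blinfun.rep_eq)
  have c: "continuous_on T (d0 T u + d0 T v)"
    using assms by (auto simp: C1_form0_def plus_fun_def intro!: continuous_intros)
  show "u + v \<in> C1_form0 T" "d0 T (u + v) = d0 T u + d0 T v"
    using C1_form0I[OF z D c] by auto
qed

lemma C1_form0_scaleR:
  assumes "u \<in> C1_form0 T"
  shows "c *\<^sub>R u \<in> C1_form0 T" "d0 T (c *\<^sub>R u) = c *\<^sub>R d0 T u"
proof -
  have z: "(c *\<^sub>R u) x = 0" "(c *\<^sub>R d0 T u) x = 0" if "x \<notin> T" for x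
    using assms that by (auto simp: C1_form0_def zero_off_def d0_def scaleR_fun_def)
  have D: "(c *\<^sub>R u has_derivative (c *\<^sub>R d0 T u) x) (at x within T)" if "x \<in> T" for x
    using has_derivative_scaleR_right[OF C1_form0_has_derivative[OF assms that], of c]
    by (simp add: scaleR_fun_def scaleR_blinfun.rep_eq)
  have c: "continuous_on T (c *\<^sub>R d0 T u)"
    using assms by (auto simp: C1_form0_def scaleR_fun_def intro!: continuous_intros)
  show "c *\<^sub>R u \<in> C1_form0 T" "d0 T (c *\<^sub>R u) = c *\<^sub>R d0 T u"
    using C1_form0I[OF z D c] by auto
qed

lemma C0d_form1_lincomb:
  assumes "u \<in> C0d_form1 V" "v \<in> C0d_form1 V"
  shows "c *\<^sub>R u + d *\<^sub>R v \<in> C0d_form1 V" "d1 V (c *\<^sub>R u + d *\<^sub>R v) = c *\<^sub>R d1 V u + d *\<^sub>R d1 V v"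
proof -
  have c: "continuous_on T u" "continuous_on T v" using assms by (simp_all add: C0d_form1_def)
  note h = has_d1_linear[OF has_d1_d1[OF assms(1)] c(1) has_d1_d1[OF assms(2)] c(2), of c d]
  show "d1 V (c *\<^sub>R u + d *\<^sub>R v) = c *\<^sub>R d1 V u + d *\<^sub>R d1 V v" by (rule d1_eqI[OF h])
  show "c *\<^sub>R u + d *\<^sub>R v \<in> C0d_form1 V"
    using assms h by (auto simp: C0d_form1_def zero_off_def scaleR_fun_def plus_fun_def intro!: continuous_intros)
qed

lemma C0d_form1_add:
  assumes "u \<in> C0d_form1 V" "v \<in> C0d_form1 V"
  shows "u + v \<in> C0d_form1 V" "d1 V (u + v) = d1 V u + d1 V v"
  using C0d_form1_lincomb[OF assms, of 1 1] by simp_all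

lemma C0d_form1_scaleR:
  assumes "u \<in> C0d_form1 V"
  shows "c *\<^sub>R u \<in> C0d_form1 V" "d1 V (c *\<^sub>R u) = c *\<^sub>R d1 V u"
  using C0d_form1_lincomb[OF assms assms, of c 0] by simp_all

end

context subdivided_triangle
begin

lemma piecewise_poly_iff:
  "piecewise_poly k (subtriangles V W) f \<longleftrightarrow> (\<forall>l. \<exists>p\<in>polynomials k. \<forall>x\<in>K l. f x = p x)"
  by (auto simp: piecewise_poly_def subtriangles_eq)

lemma piecewise_poly_add:
  assumes "piecewise_poly k (subtriangles V W) f" "piecewise_poly k (subtriangles V W) g"
  shows "piecewise_poly k (subtriangles V W) (\<lambda>x. f x + g x)"
  unfolding piecewise_poly_iff
proof
  fix l
  obtain p q where "p \<in> polynomials k" "\<forall>x\<in>K l. f x = p x" "q \<in> polynomials k" "\<forall>x\<in>K l. g x = q x"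
    using assms unfolding piecewise_poly_iff by metis
  then show "\<exists>p\<in>polynomials k. \<forall>x\<in>K l. f x + g x = p x"
    by (intro bexI[of _ "\<lambda>x. p x + q x"] polynomials_add) auto
qed

lemma piecewise_poly_cmult:
  assumes "piecewise_poly k (subtriangles V W) f"
  shows "piecewise_poly k (subtriangles V W) (\<lambda>x. c * f x)"
  unfolding piecewise_poly_iff
proof
  fix l
  obtain p where "p \<in> polynomials k" "\<forall>x\<in>K l. f x = p x"
    using assms unfolding piecewise_poly_iff by metis
  then show "\<exists>p\<in>polynomials k. \<forall>x\<in>K l. c * f x = p x"
    by (intro bexI[of _ "\<lambda>x. c * p x"] polynomials_cmult) auto
qed

lemma piecewise_poly_zero: "piecewise_poly k (subtriangles V W) (\<lambda>_. 0)"
  using polynomials_const unfolding piecewise_poly_iff by fastforce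

lemma zero_forms:
  "0 \<in> C1_form0 T" "0 \<in> C0d_form1 V" "0 \<in> C0_form2 T"
proof -
  show w: "0 \<in> C0_form2 T"
    by (auto simp: C0_form2_def zero_off_def zero_fun_def alternating_def)
  show u: "0 \<in> C1_form0 T"
    by (rule C1_form0I(1)[of 0 0]) (auto simp: zero_fun_def zero_blinfun.rep_eq)
  have "d0 T 0 = 0" using C1_form0_scaleR(2)[OF u, of 0] by simp
  then show "0 \<in> C0d_form1 V" using d0_C0d(1)[OF u] by simp
qed

lemma subspace_C1P3: "subspace (C1P3_form0 V W)"
  unfolding subspace_def C1P3_form0_def
  using C1_form0_add(1) C1_form0_scaleR(1) zero_forms(1) piecewise_poly_add[of 3] piecewise_poly_cmult[of 3]
    piecewise_poly_zero[of 3]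
  by (auto simp: plus_fun_def scaleR_fun_def zero_fun_def)

lemma subspace_C0dP2: "subspace (C0dP2_form1 V W)"
  unfolding subspace_def C0dP2_form1_def
  using C0d_form1_add(1) C0d_form1_scaleR(1) zero_forms(2) piecewise_poly_add[of 2] piecewise_poly_cmult[of 2]
    piecewise_poly_zero[of 2]
  by (auto simp: plus_fun_def scaleR_fun_def zero_fun_def blinfun.bilinear_simps)

lemma subspace_C0P1: "subspace (C0P1_form2 V W)"
proof -
  have "w + w' \<in> C0_form2 T" "c *\<^sub>R w \<in> C0_form2 T" if "w \<in> C0_form2 T" "w' \<in> C0_form2 T" for w w' c
    using that by (auto simp: C0_form2_def zero_off_def scaleR_fun_def plus_fun_def alternating_def
        blinfun.bilinear_simps image_subset_iff intro!: continuous_intros)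
  then show ?thesis
    unfolding subspace_def C0P1_form2_def
    using zero_forms(3) piecewise_poly_add[of 1] piecewise_poly_cmult[of 1] piecewise_poly_zero[of 1]
    by (auto simp: plus_fun_def scaleR_fun_def zero_fun_def blinfun.bilinear_simps)
qed

text \<open>
  All continuous piecewise affine functions have this form (\<open>C0P1_pw_affine\<close>): \<open>G\<close> lists the vertex
  values, and \<open>b\<close> is the deviation at \<open>W\<close> from the affine interpolant.
\<close>

definition pw_affine :: "(3 \<Rightarrow> real) \<Rightarrow> real \<Rightarrow> 'a \<Rightarrow> real" where
  "pw_affine G b x = (\<Sum>i\<in>UNIV. G i * lam i x) + b * hat x"

lemma continuous_pw_affine: "continuous_on S (pw_affine G b)"
  unfolding pw_affine_def by (intro continuous_intros continuous_hat)

lemma pw_affine_V [simp]: "pw_affine G b (V i) = G i"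
  by (simp add: pw_affine_def sum.delta if_distrib cong: if_cong)

definition form2_of :: "('a \<Rightarrow> real) \<Rightarrow> 'a form2" where
  "form2_of g x = (if x \<in> T then g x *\<^sub>R vol else 0)"

lemma pw_affine_polynomial: "\<exists>p\<in>polynomials 1. \<forall>x\<in>K l. pw_affine G b x = p x"
proof (rule bexI[of _ "\<lambda>x. (\<Sum>i\<in>UNIV. G i * lam i x) + b / a l * lam l x"])
  show "(\<lambda>x. (\<Sum>i\<in>UNIV. G i * lam i x) + b / a l * lam l x) \<in> polynomials 1"
    by (intro polynomials_add polynomials_sum polynomials_cmult lam_polynomial)
qed (simp add: pw_affine_def hat_K)

lemma form2_of_pw_affine: "form2_of (pw_affine G b) \<in> C0P1_form2 V W"
proof -
  have "form2_of (pw_affine G b) \<in> C0_form2 T"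
    using C0_form2_vol[OF continuous_pw_affine] by (simp add: form2_of_def[abs_def])
  moreover have "piecewise_poly 1 (subtriangles V W) (\<lambda>x. form2_of (pw_affine G b) x v v')" for v v'
    unfolding piecewise_poly_iff
  proof
    fix l
    obtain p where p: "p \<in> polynomials 1" "\<forall>x\<in>K l. pw_affine G b x = p x" using pw_affine_polynomial by blast
    show "\<exists>p\<in>polynomials 1. \<forall>x\<in>K l. form2_of (pw_affine G b) x v v' = p x"
      using K_subset_T[of l] p
      by (intro bexI[of _ "\<lambda>x. vol v v' * p x"] polynomials_cmult)
        (auto simp: form2_of_def blinfun.bilinear_simps)
  qed
  ultimately show ?thesis by (simp add: C0P1_form2_def)
qed

text \<open>
  On each subtriangle the function is affine, hence the affine interpolant of its values at the three
  vertices of \<open>T\<close> after extension to \<open>T\<close>. The value of the extension at the opposite vertex \<open>V l\<close> is read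
  off from the value at \<open>W\<close>; it exceeds \<open>G l\<close> by \<open>b / a l\<close>, which is the extension of \<open>b * hat\<close>.
\<close>

lemma C0P1_pw_affine:
  assumes w: "w \<in> C0P1_form2 V W"
  obtains G b where "w = form2_of (pw_affine G b)"
proof -
  define G where "G i = w (V i) e1 e2" for i
  define b where "b = w W e1 e2 - (\<Sum>i\<in>UNIV. G i * a i)"
  have wC: "w \<in> C0_form2 T" using w by (simp add: C0P1_form2_def)
  have eq: "w x e1 e2 = pw_affine G b x" if x: "x \<in> K l" for x l
  proof -
    obtain p where p: "p \<in> polynomials 1" "\<forall>x\<in>K l. w x e1 e2 = p x"
      using w unfolding C0P1_form2_def piecewise_poly_iff by blast
    have aff: "p y = lam l y * p (V l) + lam (l + 1) y * p (V (l + 1)) + lam (l + 2) y * p (V (l + 2))" for y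
      using polynomials_1_affine[OF p(1), of y] sum_cyclic[of _ l] by metis
    have 1: "p (V (l + 1)) = G (l + 1)" "p (V (l + 2)) = G (l + 2)" "p W = w W e1 e2"
      using p(2) by (simp_all add: G_def)
    have "a l * p (V l) = b + a l * G l"
      using aff[of W] 1 by (simp add: b_def sum_cyclic[of _ l] a_def algebra_simps)
    then have 2: "p (V l) = G l + b / a l" using a_pos[of l] by (simp add: field_simps)
    have "w x e1 e2 = p x" using p(2) x by blast
    also have "\<dots> = pw_affine G b x"
      unfolding aff[of x] 1 2 pw_affine_def hat_K[OF x] by (simp add: sum_cyclic[of _ l] algebra_simps)
    finally show ?thesis .
  qed
  have "w = form2_of (pw_affine G b)"
  proof
    fix x show "w x = form2_of (pw_affine G b) x"
    proof (cases "x \<in> T")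
      case True
      then obtain l where "x \<in> K l" using T_eq_K by blast
      then show ?thesis using eq C0_form2_rep(1)[OF wC, of x] True by (simp add: form2_of_def)
    next
      case False then show ?thesis using C0_form2_rep(3)[OF wC] by (simp add: form2_of_def)
    qed
  qed
  then show thesis by (rule that)
qed

lemma hat_integral_pos: "0 < integral Tref (\<lambda>p. hat (Pt p))"
proof -
  let ?h = "\<lambda>x. max 0 (hat x)"
  have off: "?h x = 0" if "x \<notin> T" for x
  proof -
    obtain i where "lam i x < 0" using \<open>x \<notin> T\<close> by (auto simp: T_iff not_le)
    then have "lam i x / a i < 0" using a_pos[of i] by (simp add: divide_neg_pos)
    moreover have "hat x \<le> lam i x / a i" using cases_mod3[of i 0] by (auto simp: hat_def)
    ultimately show ?thesis by simp
  qed
  have c: "continuous_on UNIV ?h" by (intro continuous_intros continuous_on_max continuous_hat)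
  have eq: "integral Tref (\<lambda>p. hat (Pt p)) = pint ?h"
  proof -
    have "integral Tref (\<lambda>p. hat (Pt p)) = integral Tref (\<lambda>p. ?h (Pt p))"
      by (rule integral_cong) (use hat_nonneg Pt_in_T in \<open>auto simp: max_def\<close>)
    then show ?thesis using integral_Tref[of ?h] off by simp
  qed
  have "0 \<le> pint ?h" unfolding pint_def
    by (intro integral_nonneg integrable_pint[OF c compact_T off]) auto
  moreover have "pint ?h \<noteq> 0"
  proof
    assume "pint ?h = 0"
    then have "?h W = 0" by (intro pint_nonneg_zero[OF c _ compact_T off]) auto
    then show False by simp
  qed
  ultimately show ?thesis using eq by simp
qed

lemma integral2_pw_affine:
  "integral2 V (form2_of (pw_affine G b)) =
    (\<Sum>i\<in>UNIV. G i * integral Tref (\<lambda>p. lam i (Pt p))) + b * integral Tref (\<lambda>p. hat (Pt p))"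
proof -
  have I: "(\<lambda>p. lam i (Pt p)) integrable_on Tref" "(\<lambda>p. hat (Pt p)) integrable_on Tref" for i
    by (intro integrable_Tref continuous_intros continuous_hat)+
  have "integral2 V (form2_of (pw_affine G b)) = integral Tref (\<lambda>p. pw_affine G b (Pt p))"
    unfolding integral2_def tri_integral_Pt
    by (rule integral_cong) (simp add: form2_of_def Pt_in_T blinfun.bilinear_simps)
  also have "\<dots> = (\<Sum>i\<in>UNIV. G i * integral Tref (\<lambda>p. lam i (Pt p))) + b * integral Tref (\<lambda>p. hat (Pt p))"
  proof -
    have "integral Tref (\<lambda>p. pw_affine G b (Pt p)) =
        integral Tref (\<lambda>p. \<Sum>i\<in>UNIV. G i * lam i (Pt p)) + integral Tref (\<lambda>p. b * hat (Pt p))"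
      unfolding pw_affine_def by (intro integral_add integrable_sum integrable_on_mult_right I finite)
    also have "integral Tref (\<lambda>p. \<Sum>i\<in>UNIV. G i * lam i (Pt p)) = (\<Sum>i\<in>UNIV. integral Tref (\<lambda>p. G i * lam i (Pt p)))"
      by (intro integral_sum integrable_on_mult_right I finite)
    finally show ?thesis by simp
  qed
  finally show ?thesis .
qed

lemma form2_of_V: "form2_of g (V i) = g (V i) *\<^sub>R vol"
  by (simp add: form2_of_def)

lemma dof2_bij: "bij_betw (dof2 V) (C0P1_form2 V W) ({b. range b \<subseteq> alternating} \<times> UNIV)"
proof (rule bij_betw_imageI)
  let ?H = "integral Tref (\<lambda>p. hat (Pt p))"
  show "inj_on (dof2 V) (C0P1_form2 V W)"
  proof (rule inj_onI)
    fix w w' assume w: "w \<in> C0P1_form2 V W" "w' \<in> C0P1_form2 V W" and eq: "dof2 V w = dof2 V w'"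
    obtain G b where G: "w = form2_of (pw_affine G b)" using C0P1_pw_affine[OF w(1)] .
    obtain G' b' where G': "w' = form2_of (pw_affine G' b')" using C0P1_pw_affine[OF w(2)] .
    have "G i = G' i" for i
    proof -
      have "w (V i) e1 e2 = w' (V i) e1 e2" using eq unfolding dof2_def prod.inject by metis
      then show ?thesis by (simp add: G G' form2_of_V blinfun.bilinear_simps)
    qed
    then have GG: "G = G'" by auto
    moreover have "b * ?H = b' * ?H" using eq GG by (simp add: dof2_def G G' integral2_pw_affine)
    then have "b = b'" using hat_integral_pos by simp
    ultimately show "w = w'" by (simp add: G G')
  qed
  show "dof2 V ` C0P1_form2 V W = {b. range b \<subseteq> alternating} \<times> UNIV"
  proof (intro antisym subsetI)
    fix y assume "y \<in> dof2 V ` C0P1_form2 V W"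
    then show "y \<in> {b. range b \<subseteq> alternating} \<times> UNIV"
      by (auto simp: dof2_def C0P1_form2_def C0_form2_def)
  next
    fix y :: "(3 \<Rightarrow> 'a \<Rightarrow>\<^sub>L 'a \<Rightarrow>\<^sub>L real) \<times> real"
    assume y: "y \<in> {b. range b \<subseteq> alternating} \<times> UNIV"
    obtain B r where yB: "y = (B, r)" by (cases y)
    define G where "G i = B i e1 e2" for i
    define b where "b = (r - (\<Sum>i\<in>UNIV. G i * integral Tref (\<lambda>p. lam i (Pt p)))) / ?H"
    have "(\<lambda>i. G i *\<^sub>R vol) = B"
    proof
      fix i show "G i *\<^sub>R vol = B i" unfolding G_def using y yB by (intro alternating_eq_vol[symmetric]) auto
    qed
    then have "dof2 V (form2_of (pw_affine G b)) = y"
      using hat_integral_pos by (simp add: dof2_def yB form2_of_V integral2_pw_affine b_def)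
    then show "y \<in> dof2 V ` C0P1_form2 V W" using form2_of_pw_affine by blast
  qed
qed

lemma C1P3_local:
  assumes u: "u \<in> C1P3_form0 V W"
  obtains p p' where "p \<in> polynomials 3" "\<And>x. x \<in> K l \<Longrightarrow> u x = p x"
    "\<And>x. (p has_derivative p' x) (at x)" "\<And>v. (\<lambda>x. p' x v) \<in> polynomials 2"
    "\<And>x. x \<in> K l \<Longrightarrow> blinfun_apply (d0 T u x) = p' x"
proof -
  obtain p where p: "p \<in> polynomials 3" "\<And>x. x \<in> K l \<Longrightarrow> u x = p x"
    using u unfolding C1P3_form0_def piecewise_poly_iff by blast
  obtain p' where p': "\<And>x. (p has_derivative p' x) (at x)" "\<And>v. (\<lambda>x. p' x v) \<in> polynomials (3 - 1)"
    using polynomials_has_derivative[OF p(1)] by metis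
  have "blinfun_apply (d0 T u x) = p' x" if x: "x \<in> K l" for x
  proof (rule has_derivative_unique_within_convex[OF convex_K interior_K_nonempty x])
    have "(u has_derivative d0 T u x) (at x within T)"
      using u x K_subset_T by (intro C1_form0_has_derivative) (auto simp: C1P3_form0_def)
    then show "(u has_derivative d0 T u x) (at x within K l)"
      by (rule has_derivative_subset[OF _ K_subset_T])
    show "(u has_derivative p' x) (at x within K l)"
      by (rule has_derivative_transform[OF x p(2) has_derivative_at_withinI[OF p'(1)]])
  qed
  then show thesis using that[OF p p'(1)] p'(2) by simp
qed

lemma d0_C1P3:
  assumes u: "u \<in> C1P3_form0 V W"
  shows "d0 T u \<in> C0dP2_form1 V W"
proof -
  have "d0 T u \<in> C0d_form1 V" using u d0_C0d by (simp add: C1P3_form0_def)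
  moreover have "piecewise_poly 2 (subtriangles V W) (\<lambda>x. d0 T u x v)" for v
    unfolding piecewise_poly_iff
  proof
    fix l
    obtain p' where "\<And>v. (\<lambda>x. p' x v) \<in> polynomials 2" "\<And>x. x \<in> K l \<Longrightarrow> blinfun_apply (d0 T u x) = p' x"
      using C1P3_local[OF u] by metis
    then show "\<exists>p\<in>polynomials 2. \<forall>x\<in>K l. d0 T u x v = p x" by (intro bexI[of _ "\<lambda>x. p' x v"]) auto
  qed
  ultimately show ?thesis by (simp add: C0dP2_form1_def)
qed

text \<open>
  The exterior derivative is weak on \<open>T\<close>, but on a subtriangle the coefficients are polynomials and it is
  the pointwise one. In particular it is affine there.
\<close>

lemma C0dP2_local:
  assumes u: "u \<in> C0dP2_form1 V W"
  obtains p q p' q' where "p \<in> polynomials 2" "q \<in> polynomials 2"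
    "\<And>x. x \<in> K l \<Longrightarrow> u x e1 = p x" "\<And>x. x \<in> K l \<Longrightarrow> u x e2 = q x"
    "\<And>x. (p has_derivative p' x) (at x)" "\<And>x. (q has_derivative q' x) (at x)"
    "(\<lambda>x. q' x e1 - p' x e2) \<in> polynomials 1"
    "\<And>x. x \<in> K l \<Longrightarrow> d1 V u x e1 e2 = q' x e1 - p' x e2"
proof -
  obtain p where p: "p \<in> polynomials 2" "\<And>x. x \<in> K l \<Longrightarrow> u x e1 = p x"
    using u unfolding C0dP2_form1_def piecewise_poly_iff by blast
  obtain q where q: "q \<in> polynomials 2" "\<And>x. x \<in> K l \<Longrightarrow> u x e2 = q x"
    using u unfolding C0dP2_form1_def piecewise_poly_iff by blast
  obtain p' where p': "\<And>x. (p has_derivative p' x) (at x)" "\<And>v. (\<lambda>x. p' x v) \<in> polynomials (2 - 1)"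
    using polynomials_has_derivative[OF p(1)] by metis
  obtain q' where q': "\<And>x. (q has_derivative q' x) (at x)" "\<And>v. (\<lambda>x. q' x v) \<in> polynomials (2 - 1)"
    using polynomials_has_derivative[OF q(1)] by metis
  have poly: "(\<lambda>x. q' x e1 - p' x e2) \<in> polynomials 1"
    using polynomials_add[OF q'(2)[of e1] polynomials_cmult[OF p'(2)[of e2], of "-1"]] by simp
  have cont: "continuous_on S (\<lambda>x. f x)" if "f \<in> polynomials k" for f :: "'a \<Rightarrow> real" and k S
    using polynomials_has_derivative[OF that] by (metis continuous_at_imp_continuous_on has_derivative_continuous)
  have uC: "u \<in> C0d_form1 V" using u by (simp add: C0dP2_form1_def)
  have open_eq: "d1 V u x e1 e2 = q' x e1 - p' x e2" if x: "x \<in> openK l" for x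
  proof (rule has_d1_local[OF has_d1_d1[OF uC] open_openK openK_subset_T _ _ _ _ x])
    fix y assume y: "y \<in> openK l"
    show "((\<lambda>x. u x e1) has_derivative p' y) (at y)"
      by (rule has_derivative_transform_within_open[OF p'(1) open_openK y]) (metis p(2) openK_subset subsetD)
    show "((\<lambda>x. u x e2) has_derivative q' y) (at y)"
      by (rule has_derivative_transform_within_open[OF q'(1) open_openK y]) (metis q(2) openK_subset subsetD)
  qed (use cont p'(2) q'(2) in blast)+
  have "d1 V u x e1 e2 = q' x e1 - p' x e2" if x: "x \<in> K l" for x
  proof (rule eq_on_K_if_eq_on_openK[OF _ _ open_eq x])
    show "continuous_on (K l) (\<lambda>x. d1 V u x e1 e2)"
      by (rule continuous_on_subset[OF C0_form2_rep(2)[OF d1_C0_form2[OF uC]] K_subset_T])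
    show "continuous_on (K l) (\<lambda>x. q' x e1 - p' x e2)" by (rule cont[OF poly])
  qed
  then show thesis using that[OF p(1) q(1) p(2) q(2) p'(1) q'(1) poly] by blast
qed

lemma d1_C0dP2:
  assumes u: "u \<in> C0dP2_form1 V W"
  shows "d1 V u \<in> C0P1_form2 V W"
proof -
  have uC: "u \<in> C0d_form1 V" using u by (simp add: C0dP2_form1_def)
  have "piecewise_poly 1 (subtriangles V W) (\<lambda>x. d1 V u x v v')" for v v'
    unfolding piecewise_poly_iff
  proof
    fix l
    obtain r where r: "r \<in> polynomials 1" "\<And>x. x \<in> K l \<Longrightarrow> d1 V u x e1 e2 = r x"
      by (rule C0dP2_local[OF u, of l]) blast
    have "d1 V u x v v' = vol v v' * (d1 V u x e1 e2)" for x
      by (subst C0_form2_rep(1)[OF d1_C0_form2[OF uC]]) (simp add: blinfun.bilinear_simps)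
    then show "\<exists>p\<in>polynomials 1. \<forall>x\<in>K l. d1 V u x v v' = p x"
      using r by (intro bexI[of _ "\<lambda>x. vol v v' * r x"] polynomials_cmult) auto
  qed
  then show ?thesis using d1_C0_form2[OF uC] by (simp add: C0P1_form2_def)
qed

lemma hat_homogeneous:
  assumes "0 < t"
  shows "hat (W + t *\<^sub>R (x - W)) - 1 = t * (hat x - 1)"
proof -
  have q: "lam i (W + t *\<^sub>R (x - W)) / a i = 1 + t * (lam i x / a i - 1)" for i
  proof -
    have "lam i (W + t *\<^sub>R (x - W)) = a i + t * (lam i x - a i)"
      by (simp add: lam_add blinfun.scaleR_right dlam_diff a_def)
    then show ?thesis using a_pos[of i] by (simp add: field_simps)
  qed
  have m: "min (1 + t * (A - 1)) (1 + t * (B - 1)) = 1 + t * (min A B - 1)" for A B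
    using assms by (auto simp: min_def)
  show ?thesis unfolding hat_def q m by simp
qed

text \<open>
  The density is split into its value at \<open>W\<close>, homogeneous of degree 0 about \<open>W\<close>, and the rest,
  homogeneous of degree 1. Contraction with \<open>x - W\<close> multiplies by \<open>2\<close> and \<open>3\<close> after differentiation,
  whence the factors \<open>1/2\<close> and \<open>1/3\<close>.
\<close>

lemma d1_surj:
  assumes w: "w \<in> C0P1_form2 V W"
  shows "\<exists>u\<in>C0dP2_form1 V W. d1 V u = w"
proof -
  obtain G b where G: "w = form2_of (pw_affine G b)" using C0P1_pw_affine[OF w] .
  let ?g = "pw_affine G b"
  define c where "c = ?g W"
  define h where "h x = (?g x - c) / 3" for x
  have h: "continuous_on S h" for S unfolding h_def by (intro continuous_intros continuous_pw_affine) simp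
  have hom: "h (W + t *\<^sub>R (x - W)) = t ^ 1 * h x" if t: "0 < t" for x t
  proof -
    have "?g (W + t *\<^sub>R (x - W)) - c = t * (?g x - c)"
    proof -
      have A: "?g y - c = (\<Sum>i\<in>UNIV. G i * (lam i y - a i)) + b * (hat y - 1)" for y
        by (simp add: c_def pw_affine_def sum_mod3 a_def algebra_simps)
      have B: "lam i (W + t *\<^sub>R (x - W)) - a i = t * (lam i x - a i)" for i
        by (simp add: lam_add blinfun.scaleR_right dlam_diff a_def)
      show ?thesis
        unfolding A B hat_homogeneous[OF t] by (simp add: sum_mod3 algebra_simps)
    qed
    then show ?thesis by (simp add: h_def)
  qed
  have 1: "has_d1 V (\<lambda>x. if x \<in> T then (c / 2) *\<^sub>R vol (x - W) else 0) (\<lambda>x. if x \<in> T then (real (0 + 2) * (c / 2)) *\<^sub>R vol else 0)"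
    by (rule has_d1_koszul) auto
  have 2: "has_d1 V (\<lambda>x. if x \<in> T then h x *\<^sub>R vol (x - W) else 0) (\<lambda>x. if x \<in> T then (real (1 + 2) * h x) *\<^sub>R vol else 0)"
    by (rule has_d1_koszul[OF h hom])
  define u where "u x = (if x \<in> T then (c / 2 + h x) *\<^sub>R vol (x - W) else 0)" for x
  have cont: "continuous_on T (\<lambda>x. if x \<in> T then f x *\<^sub>R vol (x - W) else 0)" if "continuous_on T f" for f
    by (subst continuous_on_cong[OF refl, of _ _ "\<lambda>x. f x *\<^sub>R vol (x - W)"]) (auto intro!: continuous_intros that)
  have "has_d1 V (1 *\<^sub>R (\<lambda>x. if x \<in> T then (c / 2) *\<^sub>R vol (x - W) else 0) + 1 *\<^sub>R (\<lambda>x. if x \<in> T then h x *\<^sub>R vol (x - W) else 0))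
    (1 *\<^sub>R (\<lambda>x. if x \<in> T then (real (0 + 2) * (c / 2)) *\<^sub>R vol else 0) + 1 *\<^sub>R (\<lambda>x. if x \<in> T then (real (1 + 2) * h x) *\<^sub>R vol else 0))"
    by (rule has_d1_linear[OF 1 cont 2 cont]) (auto intro: h)
  moreover have "1 *\<^sub>R (\<lambda>x. if x \<in> T then (c / 2) *\<^sub>R vol (x - W) else 0) + 1 *\<^sub>R (\<lambda>x. if x \<in> T then h x *\<^sub>R vol (x - W) else 0) = u"
    by (auto simp: u_def fun_eq_iff plus_fun_def scaleR_left_distrib)
  moreover have "1 *\<^sub>R (\<lambda>x. if x \<in> T then (real (0 + 2) * (c / 2)) *\<^sub>R vol else 0) + 1 *\<^sub>R (\<lambda>x. if x \<in> T then (real (1 + 2) * h x) *\<^sub>R vol else 0) = w"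
    unfolding G by (auto simp: form2_of_def fun_eq_iff plus_fun_def h_def scaleR_left_distrib[symmetric]
        diff_divide_distrib)
  ultimately have uw: "has_d1 V u w" by simp
  have "continuous_on T u" unfolding u_def[abs_def] by (rule cont) (intro continuous_intros h)
  moreover have "zero_off T u" by (simp add: zero_off_def u_def)
  ultimately have "u \<in> C0d_form1 V" using uw by (auto simp: C0d_form1_def)
  moreover have "piecewise_poly 2 (subtriangles V W) (\<lambda>x. u x v)" for v
    unfolding piecewise_poly_iff
  proof
    fix l
    obtain p where p: "p \<in> polynomials 1" "\<forall>x\<in>K l. ?g x = p x" using pw_affine_polynomial by blast
    have "(\<lambda>x. c / 2 - c / 3 + 1 / 3 * p x) \<in> polynomials 1"
      by (intro polynomials_add polynomials_const polynomials_cmult p)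
    moreover have "(\<lambda>x. vol (x - W) v) \<in> polynomials 1"
    proof -
      have "(\<lambda>x. dlam 2 v * dlam 1 (x - W) + (- dlam 1 v) * dlam 2 (x - W)) \<in> polynomials 1"
        by (intro polynomials_add polynomials_cmult linear_form_polynomial)
      then show ?thesis by (simp add: vol_apply mult.commute)
    qed
    ultimately have "(\<lambda>x. (c / 2 - c / 3 + 1 / 3 * p x) * vol (x - W) v) \<in> polynomials (1 + 1)"
      by (rule polynomials_mult)
    then have "(\<lambda>x. (c / 2 - c / 3 + 1 / 3 * p x) * vol (x - W) v) \<in> polynomials 2"
      by (simp only: one_add_one)
    moreover have "u x v = (c / 2 - c / 3 + 1 / 3 * p x) * vol (x - W) v" if "x \<in> K l" for x
    proof -
      have eq: "c / 2 + h x = c / 2 - c / 3 + 1 / 3 * p x"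
        using p(2) that by (simp add: h_def diff_divide_distrib)
      have "x \<in> T" using that K_subset_T by blast
      then have "u x v = (c / 2 + h x) * vol (x - W) v" by (simp add: u_def blinfun.scaleR_left)
      then show ?thesis by (simp only: eq)
    qed
    ultimately show "\<exists>p\<in>polynomials 2. \<forall>x\<in>K l. u x v = p x"
      by (intro bexI[of _ "\<lambda>x. (c / 2 - c / 3 + 1 / 3 * p x) * vol (x - W) v"] ballI)
  qed
  ultimately have "u \<in> C0dP2_form1 V W" by (simp add: C0dP2_form1_def)
  then show ?thesis using d1_eqI[OF uw] by blast
qed

end

section \<open>Exactness at the 1-forms\<close>

lemma cubic_has_derivative:
  fixes S R :: "'b::real_normed_vector \<Rightarrow> real"
  assumes "(S has_derivative S') (at x)" "(R has_derivative R') (at x)"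
  shows "((\<lambda>z. k0 * S z + l0 * R z + k1 / 2 * S z ^ 2 + m * S z * R z + l1 / 2 * R z ^ 2 +
      k2 / 3 * S z ^ 3 + l2 * S z ^ 2 * R z + m2 * S z * R z ^ 2 + l3 / 3 * R z ^ 3) has_derivative
    (\<lambda>v. (k0 + m * R x + m2 * R x ^ 2 + k1 * S x + 2 * l2 * S x * R x + k2 * S x ^ 2) * S' v +
      (l0 + l1 * R x + l3 * R x ^ 2 + m * S x + 2 * m2 * S x * R x + l2 * S x ^ 2) * R' v)) (at x)"
proof -
  have 1: "((\<lambda>z. S z ^ 2) has_derivative (\<lambda>v. 2 * S x * S' v)) (at x)"
    "((\<lambda>z. R z ^ 2) has_derivative (\<lambda>v. 2 * R x * R' v)) (at x)"
    "((\<lambda>z. S z ^ 3) has_derivative (\<lambda>v. 3 * S x ^ 2 * S' v)) (at x)"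
    "((\<lambda>z. R z ^ 3) has_derivative (\<lambda>v. 3 * R x ^ 2 * R' v)) (at x)"
    using has_derivative_power[OF assms(1), of 2] has_derivative_power[OF assms(2), of 2]
      has_derivative_power[OF assms(1), of 3] has_derivative_power[OF assms(2), of 3]
    by (simp_all add: ac_simps)
  show ?thesis
    by (rule has_derivative_eq_rhs, (rule derivative_intros assms 1)+)
      (simp add: fun_eq_iff algebra_simps)
qed

lemma has_derivative_within_finite_Union:
  assumes "finite I" "\<And>i. i \<in> I \<Longrightarrow> closed (S i)" "bounded_linear D"
    and "\<And>i. i \<in> I \<Longrightarrow> x \<in> S i \<Longrightarrow> (f has_derivative D) (at x within S i)"
  shows "(f has_derivative D) (at x within (\<Union>i\<in>I. S i))"
proof -
  have each: "((\<lambda>y. (1 / norm (y - x)) *\<^sub>R (f y - (f x + D (y - x)))) \<longlongrightarrow> 0) (at x within S i)" if i: "i \<in> I" for i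
  proof (cases "x \<in> S i")
    case True then show ?thesis using assms(4)[OF i] by (simp add: has_derivative_within)
  next
    case False
    then have "x \<notin> closure (S i - {x})" using assms(2)[OF i] by (metis Diff_empty Diff_insert0 closure_closed)
    then have "at x within S i = bot" by (simp add: at_within_eq_bot_iff)
    then show ?thesis by simp
  qed
  have "((\<lambda>y. (1 / norm (y - x)) *\<^sub>R (f y - (f x + D (y - x)))) \<longlongrightarrow> 0) (at x within (\<Union>i\<in>I. S i))"
    using assms(1) each
  proof (induction I rule: finite_induct)
    case (insert i I)
    then show ?case by (simp add: at_within_union filterlim_sup)
  qed simp
  then show ?thesis using assms(3) by (simp add: has_derivative_within)
qed

context subdivided_triangle
begin

text \<open>
  The pieces are restrictions of one function with one continuous gradient field, so that at a point of
  an interior edge the derivatives within the adjacent subtriangles agree, and a finite union of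
  closed sets inherits the derivative.
\<close>

lemma C1P3I:
  assumes loc: "\<And>l. \<exists>P\<in>polynomials 3. \<forall>x\<in>K l. f x = P x \<and> (P has_derivative blinfun_apply (D x)) (at x)"
    and c: "continuous_on T D"
  shows "(\<lambda>x. if x \<in> T then f x else 0) \<in> C1P3_form0 V W"
    and "d0 T (\<lambda>x. if x \<in> T then f x else 0) = (\<lambda>x. if x \<in> T then D x else 0)"
proof -
  have D: "(f has_derivative blinfun_apply (D x)) (at x within K l)" if x: "x \<in> K l" for l x
  proof -
    obtain P where P: "\<forall>x\<in>K l. f x = P x \<and> (P has_derivative blinfun_apply (D x)) (at x)"
      using loc by blast
    show ?thesis
    proof (rule has_derivative_transform[OF x])
      show "(P has_derivative blinfun_apply (D x)) (at x within K l)"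
        by (rule has_derivative_at_withinI) (use P x in simp)
    qed (use P in simp)
  qed
  let ?f = "\<lambda>x. if x \<in> T then f x else 0" and ?D = "\<lambda>x. if x \<in> T then D x else 0"
  have d: "(?f has_derivative blinfun_apply (?D x)) (at x within T)" if x: "x \<in> T" for x
  proof -
    have "(f has_derivative blinfun_apply (D x)) (at x within (\<Union>l\<in>UNIV. K l))"
      by (rule has_derivative_within_finite_Union)
        (use D compact_imp_closed[OF compact_K] in \<open>auto simp: blinfun.bounded_linear_right\<close>)
    then have "(f has_derivative blinfun_apply (?D x)) (at x within T)" using x by (simp add: T_eq_K)
    then show ?thesis by (rule has_derivative_transform[OF x, rotated]) simp
  qed
  have c': "continuous_on T ?D" using c by (subst continuous_on_cong[OF refl, of _ _ D]) auto
  note C = C1_form0I[of ?f ?D, OF _ _ d c']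
  show "d0 T ?f = ?D" by (rule C(2)) auto
  have "?f \<in> C1_form0 T" by (rule C(1)) auto
  moreover have "piecewise_poly 3 (subtriangles V W) ?f"
    unfolding piecewise_poly_iff
  proof
    fix l
    obtain q where "q \<in> polynomials 3" "\<forall>x\<in>K l. f x = q x" using loc[of l] by blast
    then show "\<exists>p\<in>polynomials 3. \<forall>x\<in>K l. ?f x = p x" using K_subset_T[of l] by (intro bexI[of _ q]) auto
  qed
  ultimately show "?f \<in> C1P3_form0 V W" by (simp add: C1P3_form0_def)
qed

text \<open>
  The function is \<open>\<integral>\<^sub>0\<^sup>1 u(y + t(x - y))(x - y) dt\<close> for \<open>u = p d\<lambda>\<^sub>1 + q d\<lambda>\<^sub>2\<close>, the usual primitive of a closed
  form: the integrand is quadratic in \<open>t\<close>, and Simpson's rule is exact for it. Without an integral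
  sign the derivative is a computation with the six coefficients of \<open>p\<close> and of \<open>q\<close>, for which
  closedness is the three relations \<open>rel\<close>.
\<close>

lemma closed_quadratic_form_primitive:
  fixes p q :: "'a \<Rightarrow> real"
  assumes p: "p \<in> polynomials 2" and q: "q \<in> polynomials 2"
    and p': "\<And>x. (p has_derivative p' x) (at x)" and q': "\<And>x. (q has_derivative q' x) (at x)"
    and closed: "\<And>x. q' x e1 = p' x e2"
  shows "((\<lambda>x. ((p y + 4 * p ((1/2) *\<^sub>R (x + y)) + p x) * dlam 1 (x - y) +
        (q y + 4 * q ((1/2) *\<^sub>R (x + y)) + q x) * dlam 2 (x - y)) / 6)
      has_derivative (\<lambda>v. p x * dlam 1 v + q x * dlam 2 v)) (at x)"
proof -
  obtain c :: "nat \<Rightarrow> nat \<Rightarrow> real" where c: "\<And>s t. p (y + s *\<^sub>R e1 + t *\<^sub>R e2) = (\<Sum>a\<le>2. \<Sum>b\<le>2 - a. c a b * s ^ a * t ^ b)"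
    using polynomials_normal_form[OF p, where ?x0.0 = y and e = e1 and e' = e2] by blast
  obtain d :: "nat \<Rightarrow> nat \<Rightarrow> real" where d: "\<And>s t. q (y + s *\<^sub>R e1 + t *\<^sub>R e2) = (\<Sum>a\<le>2. \<Sum>b\<le>2 - a. d a b * s ^ a * t ^ b)"
    using polynomials_normal_form[OF q, where ?x0.0 = y and e = e1 and e' = e2] by blast
  have P: "p (y + s *\<^sub>R e1 + t *\<^sub>R e2) = c 0 0 + c 0 1 * t + c 0 2 * t ^ 2 + c 1 0 * s + c 1 1 * s * t + c 2 0 * s ^ 2" for s t
    unfolding c by (simp add: numeral_2_eq_2)
  have Q: "q (y + s *\<^sub>R e1 + t *\<^sub>R e2) = d 0 0 + d 0 1 * t + d 0 2 * t ^ 2 + d 1 0 * s + d 1 1 * s * t + d 2 0 * s ^ 2" for s t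
    unfolding d by (simp add: numeral_2_eq_2)
  have coord: "z = y + dlam 1 (z - y) *\<^sub>R e1 + dlam 2 (z - y) *\<^sub>R e2" for z
    using dlam_rep[of "z - y"] by (simp add: algebra_simps)
  have dP: "p' (y + s *\<^sub>R e1 + t *\<^sub>R e2) e2 = c 0 1 + 2 * c 0 2 * t + c 1 1 * s" for s t
  proof -
    have "((\<lambda>r. p (y + s *\<^sub>R e1 + r *\<^sub>R e2)) has_real_derivative p' (y + s *\<^sub>R e1 + t *\<^sub>R e2) e2) (at t)"
      by (rule DERIV_compose_has_derivative[OF p']) (auto intro!: derivative_eq_intros)
    moreover have "((\<lambda>r. p (y + s *\<^sub>R e1 + r *\<^sub>R e2)) has_real_derivative c 0 1 + 2 * c 0 2 * t + c 1 1 * s) (at t)"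
      unfolding P by (auto intro!: derivative_eq_intros)
    ultimately show ?thesis by (rule DERIV_unique)
  qed
  have dQ: "q' (y + s *\<^sub>R e1 + t *\<^sub>R e2) e1 = d 1 0 + d 1 1 * t + 2 * d 2 0 * s" for s t
  proof -
    have "((\<lambda>r. q (y + r *\<^sub>R e1 + t *\<^sub>R e2)) has_real_derivative q' (y + s *\<^sub>R e1 + t *\<^sub>R e2) e1) (at s)"
      by (rule DERIV_compose_has_derivative[OF q']) (auto intro!: derivative_eq_intros)
    moreover have "((\<lambda>r. q (y + r *\<^sub>R e1 + t *\<^sub>R e2)) has_real_derivative d 1 0 + d 1 1 * t + 2 * d 2 0 * s) (at s)"
      unfolding Q by (auto intro!: derivative_eq_intros)
    ultimately show ?thesis by (rule DERIV_unique)
  qed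
  have rel: "d 1 0 = c 0 1" "d 1 1 = 2 * c 0 2" "c 1 1 = 2 * d 2 0"
    using closed[of "y + 0 *\<^sub>R e1 + 0 *\<^sub>R e2"] closed[of "y + 1 *\<^sub>R e1 + 0 *\<^sub>R e2"] closed[of "y + 0 *\<^sub>R e1 + 1 *\<^sub>R e2"]
    unfolding dP dQ by simp_all
  let ?s = "\<lambda>z. dlam 1 (z - y)" and ?t = "\<lambda>z. dlam 2 (z - y)"
  have Pz: "p z = c 0 0 + c 0 1 * ?t z + c 0 2 * ?t z ^ 2 + c 1 0 * ?s z + c 1 1 * ?s z * ?t z + c 2 0 * ?s z ^ 2" for z
    using P[of "?s z" "?t z"] coord[of z] by simp
  have Qz: "q z = d 0 0 + d 0 1 * ?t z + d 0 2 * ?t z ^ 2 + d 1 0 * ?s z + d 1 1 * ?s z * ?t z + d 2 0 * ?s z ^ 2" for z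
    using Q[of "?s z" "?t z"] coord[of z] by simp
  have mid: "dlam i ((1/2) *\<^sub>R (z + y) - y) = dlam i (z - y) / 2" for i z
    by (simp add: dlam_diff scaleR_right_distrib lam_affine field_simps)
  have simpson: "(k00 + 0 + 0 + 0 + 0 + 0) + 4 * (k00 + k01 * (t / 2) + k02 * (t / 2)\<^sup>2 + k10 * (s / 2) + k11 * (s / 2) * (t / 2) + k20 * (s / 2)\<^sup>2)
      + (k00 + k01 * t + k02 * t\<^sup>2 + k10 * s + k11 * s * t + k20 * s\<^sup>2) =
      6 * k00 + 3 * k01 * t + 2 * k02 * t\<^sup>2 + 3 * k10 * s + 2 * k11 * s * t + 2 * k20 * s\<^sup>2" for k00 k01 k02 k10 k11 k20 s t :: real
    by (simp add: algebra_simps power2_eq_square)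
  have sumP: "p y + 4 * p ((1/2) *\<^sub>R (z + y)) + p z = 6 * c 0 0 + 3 * c 0 1 * ?t z + 2 * c 0 2 * (?t z)\<^sup>2 +
      3 * c 1 0 * ?s z + 2 * c 1 1 * ?s z * ?t z + 2 * c 2 0 * (?s z)\<^sup>2" for z
    using simpson[of "c 0 0" "c 0 1" "?t z" "c 0 2" "c 1 0" "?s z" "c 1 1" "c 2 0"]
      Pz[of y] Pz[of z] Pz[of "(1/2) *\<^sub>R (z + y)"] unfolding mid by simp
  have sumQ: "q y + 4 * q ((1/2) *\<^sub>R (z + y)) + q z = 6 * d 0 0 + 3 * d 0 1 * ?t z + 2 * d 0 2 * (?t z)\<^sup>2 +
      3 * d 1 0 * ?s z + 2 * d 1 1 * ?s z * ?t z + 2 * d 2 0 * (?s z)\<^sup>2" for z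
    using simpson[of "d 0 0" "d 0 1" "?t z" "d 0 2" "d 1 0" "?s z" "d 1 1" "d 2 0"]
      Qz[of y] Qz[of z] Qz[of "(1/2) *\<^sub>R (z + y)"] unfolding mid by simp
  have alg: "((6 * c 0 0 + 3 * c 0 1 * t + 2 * c 0 2 * t\<^sup>2 + 3 * c 1 0 * s + 2 * c 1 1 * s * t + 2 * c 2 0 * s\<^sup>2) * s +
      (6 * d 0 0 + 3 * d 0 1 * t + 2 * d 0 2 * t\<^sup>2 + 3 * d 1 0 * s + 2 * d 1 1 * s * t + 2 * d 2 0 * s\<^sup>2) * t) / 6 =
      c 0 0 * s + d 0 0 * t + c 1 0 / 2 * s ^ 2 + c 0 1 * s * t + d 0 1 / 2 * t ^ 2 +
      c 2 0 / 3 * s ^ 3 + d 2 0 * s ^ 2 * t + c 0 2 * s * t ^ 2 + d 0 2 / 3 * t ^ 3" for s t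
    unfolding rel by (simp add: algebra_simps power2_eq_square power3_eq_cube add_divide_distrib)
  have eq: "((p y + 4 * p ((1/2) *\<^sub>R (z + y)) + p z) * ?s z + (q y + 4 * q ((1/2) *\<^sub>R (z + y)) + q z) * ?t z) / 6 =
      c 0 0 * ?s z + d 0 0 * ?t z + c 1 0 / 2 * ?s z ^ 2 + c 0 1 * ?s z * ?t z + d 0 1 / 2 * ?t z ^ 2 +
      c 2 0 / 3 * ?s z ^ 3 + d 2 0 * ?s z ^ 2 * ?t z + c 0 2 * ?s z * ?t z ^ 2 + d 0 2 / 3 * ?t z ^ 3" for z
    unfolding sumP sumQ by (rule alg)
  have s': "(?s has_derivative dlam 1) (at x)" and t': "(?t has_derivative dlam 2) (at x)"
    by (auto intro!: derivative_eq_intros)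
  show ?thesis
    unfolding eq
    by (rule has_derivative_eq_rhs[OF cubic_has_derivative[OF s' t']])
      (unfold Pz[of x] Qz[of x] rel, simp add: fun_eq_iff ac_simps)
qed

lemma polynomials_1_zero_on_K:
  assumes r: "r \<in> polynomials 1" and 0: "\<And>x. x \<in> K l \<Longrightarrow> r x = 0"
  shows "r x = 0"
proof -
  have aff: "r y = lam l y * r (V l)" for y
    using polynomials_1_affine[OF r, of y] sum_cyclic[of "\<lambda>i. lam i y * r (V i)" l] 0 by simp
  have "a l * r (V l) = 0" using aff[of W] 0[OF W_in_K] by (simp add: a_def)
  then have "r (V l) = 0" using a_pos[of l] by simp
  then show ?thesis using aff[of x] by simp
qed

text \<open>
  The segments from \<open>W\<close> stay in one subtriangle, so one formula gives the primitive on all three, and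
  no constants have to be matched along the interior edges.
\<close>

lemma d0_exact:
  assumes u: "u \<in> C0dP2_form1 V W" and 0: "d1 V u = 0"
  shows "\<exists>f\<in>C1P3_form0 V W. d0 T f = u"
proof -
  have uC: "u \<in> C0d_form1 V" using u by (simp add: C0dP2_form1_def)
  define f where "f x = (u W (x - W) + 4 * u ((1/2) *\<^sub>R (x + W)) (x - W) + u x (x - W)) / 6" for x
  have loc: "\<exists>P\<in>polynomials 3. \<forall>x\<in>K l. f x = P x \<and> (P has_derivative blinfun_apply (u x)) (at x)" for l
  proof -
    obtain p q p' q' where pq: "p \<in> polynomials 2" "q \<in> polynomials 2"
      "\<And>x. x \<in> K l \<Longrightarrow> u x e1 = p x" "\<And>x. x \<in> K l \<Longrightarrow> u x e2 = q x"
      "\<And>x. (p has_derivative p' x) (at x)" "\<And>x. (q has_derivative q' x) (at x)"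
      "(\<lambda>x. q' x e1 - p' x e2) \<in> polynomials 1"
      "\<And>x. x \<in> K l \<Longrightarrow> d1 V u x e1 e2 = q' x e1 - p' x e2"
      by (rule C0dP2_local[OF u, of l]) blast
    have "q' x e1 - p' x e2 = 0" for x
      by (rule polynomials_1_zero_on_K[OF pq(7), of l]) (use pq(8) 0 in \<open>simp add: zero_fun_def\<close>)
    then have closed: "q' x e1 = p' x e2" for x by simp
    define P where "P x = ((p W + 4 * p ((1/2) *\<^sub>R (x + W)) + p x) * dlam 1 (x - W) +
        (q W + 4 * q ((1/2) *\<^sub>R (x + W)) + q x) * dlam 2 (x - W)) / 6" for x
    have dP: "(P has_derivative (\<lambda>v. p x * dlam 1 v + q x * dlam 2 v)) (at x)" for x
      unfolding P_def[abs_def] by (rule closed_quadratic_form_primitive[OF pq(1,2,5,6) closed])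
    have uK: "u x v = p x * dlam 1 v + q x * dlam 2 v" if "x \<in> K l" for x v
      using form1_rep[of "u x" v] pq(3,4) that by simp
    have mid: "(1/2) *\<^sub>R (x + W) \<in> K l" if "x \<in> K l" for x
      using convexD[OF convex_K that W_in_K, of "1/2" "1/2"] by (simp add: scaleR_right_distrib)
    have "f x = P x" if "x \<in> K l" for x
      using uK[OF that] uK[OF mid[OF that]] uK[OF W_in_K] by (simp add: f_def P_def algebra_simps)
    moreover have "(P has_derivative blinfun_apply (u x)) (at x)" if "x \<in> K l" for x
      by (rule has_derivative_eq_rhs[OF dP]) (rule ext, rule uK[OF that, symmetric])
    moreover have "P \<in> polynomials 3"
    proof -
      have m: "(\<lambda>x. r ((1/2) *\<^sub>R (x + W))) \<in> polynomials 2" if "r \<in> polynomials 2" for r :: "'a \<Rightarrow> real"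
        using polynomials_compose_affine[OF _ that, of "\<lambda>x. (1/2) *\<^sub>R x" "(1/2) *\<^sub>R W"]
        by (simp add: scaleR_right_distrib linear_scale_self)
      have "(\<lambda>x. (r W + 4 * r ((1/2) *\<^sub>R (x + W)) + r x) * dlam i (x - W)) \<in> polynomials (2 + 1)"
        if "r \<in> polynomials 2" for r :: "'a \<Rightarrow> real" and i
        by (intro polynomials_mult polynomials_add polynomials_const polynomials_cmult m linear_form_polynomial that)
      from polynomials_cmult[OF polynomials_add[OF this[OF pq(1), of 1] this[OF pq(2), of 2]], of "1/6"]
      show ?thesis by (simp add: P_def[abs_def])
    qed
    ultimately show ?thesis by blast
  qed
  have "continuous_on T u" using uC by (simp add: C0d_form1_def)
  note C1P3I[OF loc this]
  moreover have "(\<lambda>x. if x \<in> T then u x else 0) = u"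
    using uC by (auto simp: C0d_form1_def zero_off_def)
  ultimately show ?thesis by auto
qed

end

section \<open>Degrees of freedom of the 0-forms\<close>

text \<open>
  The polynomial is \<open>\<integral>\<^sub>0\<^sup>M (A - c s)(B - b s) ds\<close>; the coefficient of \<open>M'\<close> is the integrand at \<open>s = M\<close>.
\<close>

lemma bubble_polynomial_has_derivative:
  fixes M A B :: "'b::real_normed_vector \<Rightarrow> real"
  assumes "(M has_derivative M') (at x)" "(A has_derivative A') (at x)" "(B has_derivative B') (at x)"
  shows "((\<lambda>x. M x * A x * B x - 1 / 2 * ((M x)\<^sup>2 * (b * A x + c * B x)) + c * b / 3 * M x ^ 3) has_derivative
    (\<lambda>v. (A x - c * M x) * (B x - b * M x) * M' v + (M x * B x - (M x)\<^sup>2 / 2 * b) * A' v +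
      (M x * A x - (M x)\<^sup>2 / 2 * c) * B' v)) (at x)"
proof -
  have 1: "((\<lambda>z. (M z)\<^sup>2) has_derivative (\<lambda>v. 2 * M x * M' v)) (at x)"
    "((\<lambda>z. M z ^ 3) has_derivative (\<lambda>v. 3 * (M x)\<^sup>2 * M' v)) (at x)"
    using has_derivative_power[OF assms(1), of 2] has_derivative_power[OF assms(1), of 3]
    by (simp_all add: ac_simps)
  show ?thesis
    by (rule has_derivative_eq_rhs,
        (rule 1 assms has_derivative_add has_derivative_diff has_derivative_mult_right has_derivative_mult)+)
      (simp add: fun_eq_iff algebra_simps power2_eq_square add_divide_distrib diff_divide_distrib)
qed

locale hct_element = subdivided_triangle V W for V :: "3 \<Rightarrow> 'a::euclidean_space" and W :: 'a +
  fixes WE \<nu> :: "3 \<Rightarrow> 'a"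
  assumes WE_segment: "WE i \<in> open_segment (V (i + 1)) (V (i + 2))"
    and \<nu>_transverse: "\<nu> i \<notin> span {V (i + 2) - V (i + 1)}"
begin

lemma vector_along_edge:
  assumes "dlam i v = 0"
  shows "v = dlam (i + 2) v *\<^sub>R (V (i + 2) - V (i + 1))"
proof (rule dlam_inject)
  fix j
  have "dlam i v + dlam (i + 1) v + dlam (i + 2) v = 0"
    using sum_cyclic[of "\<lambda>j. dlam j v" i] dlam_sum[of v] by (simp add: sum_mod3)
  then have 1: "dlam (i + 1) v = - dlam (i + 2) v" using assms by simp
  show "dlam j v = dlam j (dlam (i + 2) v *\<^sub>R (V (i + 2) - V (i + 1)))"
    using cases_mod3[of j i] assms 1 by (auto simp: blinfun.scaleR_right dlam_diff)
qed

lemma dlam_\<nu>: "dlam i (\<nu> i) \<noteq> 0"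
proof
  assume "dlam i (\<nu> i) = 0"
  from vector_along_edge[OF this] have "\<nu> i \<in> span {V (i + 2) - V (i + 1)}"
    by (metis insertI1 span_base span_scale)
  then show False using \<nu>_transverse by blast
qed

lemma WE_coords:
  obtains t where "0 < t" "t < 1" "WE i = V (i + 1) + t *\<^sub>R (V (i + 2) - V (i + 1))"
    "lam i (WE i) = 0" "lam (i + 1) (WE i) = 1 - t" "lam (i + 2) (WE i) = t"
proof -
  obtain t where t: "0 < t" "t < 1" "WE i = (1 - t) *\<^sub>R V (i + 1) + t *\<^sub>R V (i + 2)"
    using WE_segment[of i] by (auto simp: in_segment)
  show thesis
    by (rule that[OF t(1,2)]) (simp_all add: t(3) lam_affine, simp add: algebra_simps)
qed

lemma WE_in_K: "WE i \<in> K i"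
proof -
  obtain t where t: "0 < t" "t < 1" "lam i (WE i) = 0" "lam (i + 1) (WE i) = 1 - t" "lam (i + 2) (WE i) = t"
    by (rule WE_coords[of i])
  then show ?thesis unfolding K_iff forall_cyclic[where l = i] using a_pos[of "i + 1"] a_pos[of "i + 2"] by simp
qed

lemma WE_in_T: "WE i \<in> T"
  using WE_in_K K_subset_T by blast

lemma hat_WE: "hat (WE i) = 0"
proof -
  have "lam i (WE i) = 0" by (rule WE_coords[of i])
  then show ?thesis by (simp add: hat_K[OF WE_in_K])
qed

text \<open>
  This is \<open>\<integral>\<^sub>0\<^sup>m (\<lambda>\<^sub>i - a\<^sub>i s)(\<lambda>\<^sub>j - a\<^sub>j s) ds\<close> with \<open>m\<close> the hat function. Its gradient is continuous since the
  partial derivative in \<open>m\<close> vanishes wherever the gradient of \<open>m\<close> jumps.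
\<close>

definition bubble :: "3 \<Rightarrow> 'a \<Rightarrow> real" where
  "bubble k x = (let i = k + 1; j = k + 2; m = hat x in
     m * lam i x * lam j x - 1 / 2 * (m\<^sup>2 * (a j * lam i x + a i * lam j x)) + a i * a j / 3 * m ^ 3)"

text \<open>
  The gradient of \<open>m\<close> appears as \<open>d\<lambda>\<^sub>k / a\<^sub>k\<close>, its value on \<open>K k\<close>. On the two other subtriangles the
  coefficient in front of it is zero.
\<close>

definition dbubble :: "3 \<Rightarrow> 'a \<Rightarrow> 'a \<Rightarrow>\<^sub>L real" where
  "dbubble k x = (let i = k + 1; j = k + 2; m = hat x in
     ((lam i x - a i * m) * (lam j x - a j * m) / a k) *\<^sub>R dlam k +
     (m * lam j x - m\<^sup>2 / 2 * a j) *\<^sub>R dlam i + (m * lam i x - m\<^sup>2 / 2 * a i) *\<^sub>R dlam j)"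

lemma continuous_dbubble: "continuous_on S (dbubble k)"
  unfolding dbubble_def Let_def using a_pos[of k]
  by (intro continuous_intros continuous_hat) simp_all

text \<open>
  On \<open>K l\<close> the hat function is \<open>\<lambda>\<^sub>l / a\<^sub>l\<close>. If \<open>l \<noteq> k\<close> then one of the two nodal functions in the coefficient
  of its gradient vanishes on \<open>K l\<close>, and this gradient can be replaced by that of \<open>\<lambda>\<^sub>k / a\<^sub>k\<close>.
\<close>

lemma bubble_local:
  "\<exists>P\<in>polynomials 3. \<forall>x\<in>K l. bubble k x = P x \<and> (P has_derivative blinfun_apply (dbubble k x)) (at x)"
proof -
  let ?M = "\<lambda>x. 1 / a l * lam l x"
  define P where "P x = ?M x * lam (k + 1) x * lam (k + 2) x -
      1 / 2 * ((?M x)\<^sup>2 * (a (k + 2) * lam (k + 1) x + a (k + 1) * lam (k + 2) x)) + a (k + 1) * a (k + 2) / 3 * ?M x ^ 3" for x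
  have M: "?M \<in> polynomials 1" by (intro polynomials_cmult lam_polynomial)
  have M2: "(\<lambda>x. (?M x)\<^sup>2) \<in> polynomials 2" and M3: "(\<lambda>x. ?M x ^ 3) \<in> polynomials 3"
    using polynomials_power[OF M, of 2] polynomials_power[OF M, of 3] by simp_all
  have "P \<in> polynomials 3"
  proof -
    have "(\<lambda>x. ?M x * (lam (k + 1) x * lam (k + 2) x)) \<in> polynomials (1 + (1 + 1))"
      by (intro polynomials_mult M lam_polynomial)
    moreover have "(\<lambda>x. (?M x)\<^sup>2 * ((- a (k + 2) / 2) * lam (k + 1) x + (- a (k + 1) / 2) * lam (k + 2) x)) \<in> polynomials (2 + 1)"
      by (intro polynomials_mult polynomials_add polynomials_cmult M2 lam_polynomial)
    ultimately have "(\<lambda>x. ?M x * (lam (k + 1) x * lam (k + 2) x) +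
        ((?M x)\<^sup>2 * ((- a (k + 2) / 2) * lam (k + 1) x + (- a (k + 1) / 2) * lam (k + 2) x) +
          (a (k + 1) * a (k + 2) / 3) * ?M x ^ 3)) \<in> polynomials 3"
      by (intro polynomials_add polynomials_cmult M3) (simp_all add: numeral_3_eq_3 numeral_2_eq_2)
    moreover have "P x = ?M x * (lam (k + 1) x * lam (k + 2) x) +
        ((?M x)\<^sup>2 * ((- a (k + 2) / 2) * lam (k + 1) x + (- a (k + 1) / 2) * lam (k + 2) x) +
          (a (k + 1) * a (k + 2) / 3) * ?M x ^ 3)" for x
      by (simp add: P_def algebra_simps add_divide_distrib)
    ultimately show ?thesis by presburger
  qed
  moreover have "bubble k x = P x \<and> (P has_derivative blinfun_apply (dbubble k x)) (at x)" if x: "x \<in> K l" for x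
  proof
    have h: "hat x = ?M x" using hat_K[OF x] by simp
    show "bubble k x = P x" unfolding bubble_def Let_def P_def h by (simp only: mult.assoc)
    have dM: "(?M has_derivative (\<lambda>v. 1 / a l * dlam l v)) (at x)"
      by (intro has_derivative_mult_right lam_has_derivative)
    have z: "lam l x - a l * ?M x = 0" using a_pos[of l] by simp
    have "(lam (k + 1) x - a (k + 1) * ?M x) * (lam (k + 2) x - a (k + 2) * ?M x) * (1 / a l * dlam l v) =
        (lam (k + 1) x - a (k + 1) * ?M x) * (lam (k + 2) x - a (k + 2) * ?M x) / a k * dlam k v" for v
      using cases_mod3[of l k] z by auto
    then show "(P has_derivative blinfun_apply (dbubble k x)) (at x)"
      unfolding P_def[abs_def]
      by (intro has_derivative_eq_rhs[OF bubble_polynomial_has_derivative[OF dM lam_has_derivative lam_has_derivative]])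
        (simp only: fun_eq_iff dbubble_def Let_def h blinfun.bilinear_simps real_scaleR_def simp_thms)
  qed
  ultimately show ?thesis by blast
qed

lemma bubble_V: "bubble k (V r) = 0" and dbubble_V: "dbubble k (V r) = 0"
  by (auto simp: bubble_def dbubble_def Let_def)

text \<open>
  The bubbles are dual to the edge functionals up to factors: at \<open>WE r\<close> the gradient of bubble \<open>k\<close>
  is \<open>\<lambda>\<^sub>i \<lambda>\<^sub>j d\<lambda>\<^sub>k / a\<^sub>k\<close>, where \<open>\<lambda>\<^sub>i \<lambda>\<^sub>j\<close> is zero on the two other edges, and \<open>\<nu> k\<close> is transverse to edge \<open>k\<close>.
\<close>

lemma dbubble_WE: "dbubble k (WE r) (\<nu> r) = 0 \<longleftrightarrow> k \<noteq> r"
proof -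
  obtain t where t: "0 < t" "t < 1" "lam r (WE r) = 0" "lam (r + 1) (WE r) = 1 - t" "lam (r + 2) (WE r) = t"
    by (rule WE_coords[of r])
  have "dbubble k (WE r) (\<nu> r) = lam (k + 1) (WE r) * lam (k + 2) (WE r) / a k * dlam k (\<nu> r)"
    by (simp add: dbubble_def Let_def hat_WE blinfun.bilinear_simps)
  then show ?thesis using cases_mod3[of k r] t dlam_\<nu>[of r] a_pos[of r] by auto
qed

text \<open>
  The weights \<open>\<lambda>\<^sub>i\<^sup>2\<close> vanish to second order at the two other vertices, so that the three Hermite
  problems decouple.
\<close>

definition hermite :: "(3 \<Rightarrow> real) \<Rightarrow> (3 \<Rightarrow> 'a \<Rightarrow>\<^sub>L real) \<Rightarrow> 'a \<Rightarrow> real" where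
  "hermite c g x = (\<Sum>i\<in>UNIV. (lam i x)\<^sup>2 * (3 - 2 * lam i x) * c i + (lam i x)\<^sup>2 * g i (x - V i))"

definition dhermite :: "(3 \<Rightarrow> real) \<Rightarrow> (3 \<Rightarrow> 'a \<Rightarrow>\<^sub>L real) \<Rightarrow> 'a \<Rightarrow> 'a \<Rightarrow>\<^sub>L real" where
  "dhermite c g x = (\<Sum>i\<in>UNIV. (6 * lam i x * (1 - lam i x) * c i) *\<^sub>R dlam i +
     ((2 * lam i x * g i (x - V i)) *\<^sub>R dlam i + (lam i x)\<^sup>2 *\<^sub>R g i))"

lemma hermite_polynomial: "hermite c g \<in> polynomials 3"
proof -
  have l2: "(\<lambda>x. (lam i x)\<^sup>2) \<in> polynomials 2" for i
    using polynomials_power[OF lam_polynomial, where n = 2] by simp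
  have "(\<lambda>x. c i * ((lam i x)\<^sup>2 * (3 + (- 2) * lam i x)) + (lam i x)\<^sup>2 * g i (x - V i)) \<in> polynomials (2 + 1)" for i
    by (intro polynomials_add polynomials_cmult polynomials_mult l2 polynomials_const lam_polynomial linear_form_polynomial)
  then have "(\<lambda>x. \<Sum>i\<in>UNIV. c i * ((lam i x)\<^sup>2 * (3 + (- 2) * lam i x)) + (lam i x)\<^sup>2 * g i (x - V i)) \<in> polynomials 3"
    by (intro polynomials_sum) simp
  then show ?thesis by (simp add: hermite_def[abs_def] mult.commute mult.left_commute)
qed

lemma hermite_has_derivative: "(hermite c g has_derivative blinfun_apply (dhermite c g x)) (at x within S)"
proof -
  have 1: "((\<lambda>z. (lam i z)\<^sup>2) has_derivative (\<lambda>v. 2 * lam i x * dlam i v)) (at x)" for i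
    using has_derivative_power[OF lam_has_derivative, where n = 2] by (simp add: ac_simps)
  have 2: "((\<lambda>z. g i (z - V i)) has_derivative g i) (at x)" for i
    by (auto intro!: derivative_eq_intros)
  have "((\<lambda>x. (lam i x)\<^sup>2 * (3 - 2 * lam i x) * c i + (lam i x)\<^sup>2 * g i (x - V i)) has_derivative
      (\<lambda>v. ((6 * lam i x * (1 - lam i x) * c i) *\<^sub>R dlam i +
     ((2 * lam i x * g i (x - V i)) *\<^sub>R dlam i + (lam i x)\<^sup>2 *\<^sub>R g i)) v)) (at x)" for i
    by (rule has_derivative_eq_rhs, (rule derivative_intros 1 2 lam_has_derivative)+)
      (simp only: fun_eq_iff blinfun.add_left blinfun.scaleR_left real_scaleR_def, simp add: algebra_simps power2_eq_square)
  from has_derivative_sum[of UNIV, OF this]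
  have "(hermite c g has_derivative (\<lambda>v. \<Sum>i\<in>UNIV. ((6 * lam i x * (1 - lam i x) * c i) *\<^sub>R dlam i +
     ((2 * lam i x * g i (x - V i)) *\<^sub>R dlam i + (lam i x)\<^sup>2 *\<^sub>R g i)) v)) (at x)"
    by (simp add: hermite_def[abs_def])
  then have "(hermite c g has_derivative blinfun_apply (dhermite c g x)) (at x)"
    by (rule has_derivative_eq_rhs) (simp add: dhermite_def blinfun.sum_left fun_eq_iff)
  then show ?thesis by (rule has_derivative_at_withinI)
qed

lemma continuous_dhermite: "continuous_on S (dhermite c g)"
  unfolding dhermite_def by (intro continuous_intros)

lemma hermite_V: "hermite c g (V r) = c r" and dhermite_V: "dhermite c g (V r) = g r"
proof -
  show "hermite c g (V r) = c r"
    unfolding hermite_def sum_cyclic[of _ r] by simp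
  show "dhermite c g (V r) = g r"
    unfolding dhermite_def sum_cyclic[of _ r] by simp
qed

lemma dof0_surj: "\<exists>u\<in>C1P3_form0 V W. dof0 V WE \<nu> u = (c, g, m)"
proof -
  define b where "b k = (m k - dhermite c g (WE k) (\<nu> k)) / dbubble k (WE k) (\<nu> k)" for k
  define f where "f x = hermite c g x + (\<Sum>k\<in>UNIV. b k * bubble k x)" for x
  define D where "D x = dhermite c g x + (\<Sum>k\<in>UNIV. b k *\<^sub>R dbubble k x)" for x
  have loc: "\<exists>P\<in>polynomials 3. \<forall>x\<in>K l. f x = P x \<and> (P has_derivative blinfun_apply (D x)) (at x)" for l
  proof -
    obtain P where P: "\<And>k. P k \<in> polynomials 3" "\<And>k x. x \<in> K l \<Longrightarrow> bubble k x = P k x"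
      "\<And>k x. x \<in> K l \<Longrightarrow> (P k has_derivative blinfun_apply (dbubble k x)) (at x)"
      using bubble_local[of l] by metis
    show ?thesis
    proof (intro bexI[of _ "\<lambda>x. hermite c g x + (\<Sum>k\<in>UNIV. b k * P k x)"] ballI conjI)
      fix x assume x: "x \<in> K l"
      show "f x = hermite c g x + (\<Sum>k\<in>UNIV. b k * P k x)" using P(2)[OF x] by (simp add: f_def)
      have "((\<lambda>x. hermite c g x + (\<Sum>k\<in>UNIV. b k * P k x)) has_derivative
          (\<lambda>v. dhermite c g x v + (\<Sum>k\<in>UNIV. b k * dbubble k x v))) (at x)"
        by (intro has_derivative_add has_derivative_sum has_derivative_mult_right hermite_has_derivative P(3)[OF x])
      then show "((\<lambda>x. hermite c g x + (\<Sum>k\<in>UNIV. b k * P k x)) has_derivative blinfun_apply (D x)) (at x)"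
        by (rule has_derivative_eq_rhs)
          (simp add: D_def fun_eq_iff blinfun.add_left blinfun.sum_left blinfun.scaleR_left)
    qed (intro polynomials_add polynomials_sum polynomials_cmult hermite_polynomial P(1))
  qed
  let ?u = "\<lambda>x. if x \<in> T then f x else 0"
  have cD: "continuous_on T D"
    unfolding D_def[abs_def] by (intro continuous_intros continuous_dhermite continuous_dbubble)
  have C: "?u \<in> C1P3_form0 V W" "d0 T ?u = (\<lambda>x. if x \<in> T then D x else 0)"
    by (rule C1P3I[OF loc cD])+
  have "D (WE i) (\<nu> i) = m i" for i
  proof -
    have "(\<Sum>k\<in>UNIV. b k * dbubble k (WE i) (\<nu> i)) = b i * dbubble i (WE i) (\<nu> i)"
      using dbubble_WE[of "i + 1" i] dbubble_WE[of "i + 2" i] by (simp add: sum_cyclic[of _ i])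
    also have "\<dots> = m i - dhermite c g (WE i) (\<nu> i)"
      using dbubble_WE[of i i] by (simp add: b_def)
    finally show ?thesis by (simp add: D_def blinfun.add_left blinfun.sum_left blinfun.scaleR_left)
  qed
  then have "dof0 V WE \<nu> ?u = (c, g, m)"
    unfolding dof0_def C(2) edge_eval_def
    by (simp add: WE_in_T) (simp add: f_def D_def hermite_V dhermite_V bubble_V dbubble_V)
  then show ?thesis using C(1) by blast
qed

text \<open>
  In coordinates \<open>s\<close> along edge \<open>l\<close> and \<open>t = hat\<close>, the trace of the cubic on the edge has a double zero at
  both ends and vanishes. A transverse derivative is a quadratic on the edge that vanishes at both ends
  and at \<open>WE l\<close>. So all terms of order less than two in \<open>t\<close> are zero. The remaining affine factor is
  written in the nodal functions of \<open>V (l + 1)\<close>, \<open>V (l + 2)\<close> and \<open>W\<close>.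
\<close>

lemma cubic_divisible_by_hat_square:
  assumes u: "u \<in> C1P3_form0 V W"
    and V0: "\<And>i. u (V i) = 0" "\<And>i. d0 T u (V i) = 0" and E0: "d0 T u (WE l) (\<nu> l) = 0"
  obtains A B C where "\<And>x. x \<in> K l \<Longrightarrow> u x = (hat x)\<^sup>2 * (A * (lam (l + 1) x - a (l + 1) * hat x) +
      B * (lam (l + 2) x - a (l + 2) * hat x) + C * hat x)"
proof -
  obtain p p' where p: "p \<in> polynomials 3" "\<And>x. x \<in> K l \<Longrightarrow> u x = p x"
    "\<And>x. (p has_derivative p' x) (at x)" "\<And>x. x \<in> K l \<Longrightarrow> blinfun_apply (d0 T u x) = p' x"
    by (rule C1P3_local[OF u, of l]) blast
  let ?x0 = "V (l + 1)" and ?e = "V (l + 2) - V (l + 1)" and ?f = "W - V (l + 1)"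
  obtain c :: "nat \<Rightarrow> nat \<Rightarrow> real" where c: "\<And>s t. p (?x0 + s *\<^sub>R ?e + t *\<^sub>R ?f) = (\<Sum>a\<le>3. \<Sum>b\<le>3 - a. c a b * s ^ a * t ^ b)"
    using polynomials_normal_form[OF p(1), where ?x0.0 = ?x0 and e = ?e and e' = ?f] by blast
  have P: "p (?x0 + s *\<^sub>R ?e + t *\<^sub>R ?f) = c 0 0 + c 0 1 * t + c 0 2 * t ^ 2 + c 0 3 * t ^ 3 +
      c 1 0 * s + c 1 1 * s * t + c 1 2 * s * t ^ 2 + c 2 0 * s ^ 2 + c 2 1 * s ^ 2 * t + c 3 0 * s ^ 3" for s t
    unfolding c by (simp add: numeral_3_eq_3 numeral_2_eq_2)
  have ds: "p' (?x0 + s *\<^sub>R ?e) ?e = c 1 0 + 2 * c 2 0 * s + 3 * c 3 0 * s ^ 2" for s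
  proof -
    have "((\<lambda>r. p (?x0 + r *\<^sub>R ?e + 0 *\<^sub>R ?f)) has_real_derivative p' (?x0 + s *\<^sub>R ?e + 0 *\<^sub>R ?f) ?e) (at s)"
      by (rule DERIV_compose_has_derivative[OF p(3)]) (auto intro!: derivative_eq_intros)
    moreover have "((\<lambda>r. p (?x0 + r *\<^sub>R ?e + 0 *\<^sub>R ?f)) has_real_derivative c 1 0 + 2 * c 2 0 * s + 3 * c 3 0 * s ^ 2) (at s)"
      unfolding P by (auto intro!: derivative_eq_intros)
    ultimately show ?thesis using DERIV_unique by fastforce
  qed
  have dt: "p' (?x0 + s *\<^sub>R ?e) ?f = c 0 1 + c 1 1 * s + c 2 1 * s ^ 2" for s
  proof -
    have "((\<lambda>r. p (?x0 + s *\<^sub>R ?e + r *\<^sub>R ?f)) has_real_derivative p' (?x0 + s *\<^sub>R ?e + 0 *\<^sub>R ?f) ?f) (at 0)"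
      by (rule DERIV_compose_has_derivative[OF p(3)]) (auto intro!: derivative_eq_intros)
    moreover have "((\<lambda>r. p (?x0 + s *\<^sub>R ?e + r *\<^sub>R ?f)) has_real_derivative c 0 1 + c 1 1 * s + c 2 1 * s ^ 2) (at 0)"
      unfolding P by (auto intro!: derivative_eq_intros)
    ultimately show ?thesis using DERIV_unique by fastforce
  qed
  have pV: "p (V (l + 1)) = 0" "p (V (l + 2)) = 0" "p' (V (l + 1)) v = 0" "p' (V (l + 2)) v = 0" for v
    using V0 p(2)[of "V (l + 1)"] p(2)[of "V (l + 2)"] p(4)[of "V (l + 1)"] p(4)[of "V (l + 2)"]
    by (simp_all, metis zero_blinfun.rep_eq, metis zero_blinfun.rep_eq)
  have c1: "c 0 0 = 0" "c 1 0 = 0" "c 0 1 = 0"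
    using P[of 0 0] ds[of 0] dt[of 0] pV by simp_all
  have c2: "c 0 0 + c 1 0 + c 2 0 + c 3 0 = 0" "c 1 0 + 2 * c 2 0 + 3 * c 3 0 = 0" "c 0 1 + c 1 1 + c 2 1 = 0"
    using P[of 1 0] ds[of 1] dt[of 1] pV by simp_all
  have c3: "c 2 0 = 0" "c 3 0 = 0" using c1 c2 by linarith+
  have edge: "c 1 1 = 0 \<and> c 2 1 = 0"
  proof -
    obtain t where t: "0 < t" "t < 1" "WE l = ?x0 + t *\<^sub>R ?e" by (rule WE_coords[of l])
    define \<beta> where "\<beta> = dlam l (\<nu> l) / a l"
    have \<beta>: "\<beta> \<noteq> 0" using dlam_\<nu>[of l] a_pos[of l] by (simp add: \<beta>_def)
    have f: "dlam l ?f = a l" by (simp add: dlam_diff a_def)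
    have "dlam l (\<nu> l - \<beta> *\<^sub>R ?f) = dlam l (\<nu> l) - \<beta> * dlam l ?f"
      by (simp only: blinfun.diff_right[of _ "\<nu> l"] blinfun.scaleR_right real_scaleR_def)
    then have "dlam l (\<nu> l - \<beta> *\<^sub>R ?f) = 0" unfolding f using a_pos[of l] by (simp add: \<beta>_def)
    from vector_along_edge[OF this] obtain \<alpha> where "\<nu> l - \<beta> *\<^sub>R ?f = \<alpha> *\<^sub>R ?e" by blast
    then have \<nu>: "\<nu> l = \<alpha> *\<^sub>R ?e + \<beta> *\<^sub>R ?f" by (simp add: diff_eq_eq)
    have lin: "linear (p' (WE l))" by (rule has_derivative_linear[OF p(3)])
    have "0 = p' (WE l) (\<nu> l)" using E0 p(4)[OF WE_in_K] by simp
    also have "\<dots> = \<alpha> * p' (WE l) ?e + \<beta> * p' (WE l) ?f"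
      unfolding \<nu> by (simp only: linear_add[OF lin] linear_scale[OF lin] real_scaleR_def)
    also have "p' (WE l) ?e = 0" unfolding t(3) ds using c1 c3 by simp
    finally have "p' (WE l) ?f = 0" using \<beta> by simp
    then have "c 1 1 * t + c 2 1 * t ^ 2 = 0" unfolding t(3) dt using c1 by simp
    then have "c 2 1 * (t * (t - 1)) = 0"
      using c2(3) c1 by (simp add: algebra_simps power2_eq_square eq_neg_iff_add_eq_0[symmetric])
    then have "c 2 1 = 0" using t by simp
    then show ?thesis using c2(3) c1 by simp
  qed
  have "u x = (hat x)\<^sup>2 * (c 0 2 * (lam (l + 1) x - a (l + 1) * hat x) +
      (c 0 2 + c 1 2) * (lam (l + 2) x - a (l + 2) * hat x) + (c 0 2 + c 0 3) * hat x)" if x: "x \<in> K l" for x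
  proof -
    define t where "t = hat x"
    define s where "s = lam (l + 2) x - a (l + 2) * hat x"
    have sum: "lam l x + lam (l + 1) x + lam (l + 2) x = 1" "a l + a (l + 1) + a (l + 2) = 1"
      using lam_sum_cyclic[of l x] lam_sum_cyclic[of l W] by (simp_all add: a_def)
    have lt: "lam l x = a l * t" using hat_K[OF x] a_pos[of l] by (simp add: t_def)
    have al: "a l = 1 - a (l + 1) - a (l + 2)" using sum(2) by linarith
    have n: "lam (l + 1) x - a (l + 1) * hat x = 1 - s - t"
      using sum(1) unfolding lt s_def t_def[symmetric] al by (simp add: algebra_simps)
    have xx: "x = ?x0 + s *\<^sub>R ?e + t *\<^sub>R ?f"
    proof (rule lam_inject)
      fix i
      have "lam i (?x0 + s *\<^sub>R ?e + t *\<^sub>R ?f) = lam i ?x0 + s * (lam i (V (l + 2)) - lam i ?x0) + t * (a i - lam i ?x0)"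
        by (simp only: lam_add blinfun.scaleR_right dlam_diff a_def real_scaleR_def)
      then show "lam i x = lam i (?x0 + s *\<^sub>R ?e + t *\<^sub>R ?f)"
        using cases_mod3[of i l] lt n by (auto simp: s_def t_def algebra_simps)
    qed
    have "u x = p (?x0 + s *\<^sub>R ?e + t *\<^sub>R ?f)" using p(2)[OF x] xx by simp
    also have "\<dots> = t\<^sup>2 * (c 0 2 + c 1 2 * s + c 0 3 * t)"
      unfolding P using c1 c3 edge by (simp add: algebra_simps power2_eq_square power3_eq_cube)
    also have "\<dots> = t\<^sup>2 * (c 0 2 * (1 - s - t) + (c 0 2 + c 1 2) * s + (c 0 2 + c 0 3) * t)"
      by (simp add: algebra_simps)
    finally show ?thesis unfolding n by (simp add: s_def t_def)
  qed
  then show thesis by (rule that)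
qed

text \<open>
  The affine factors on the subtriangles have common values at \<open>W\<close> and, by the values of \<open>u\<close> at the
  midpoints \<open>M i\<close> of the interior edges, at the vertices. This gives the global form \<open>m\<^sup>2 \<Lambda> + E m\<^sup>3\<close>. Its
  gradient jumps across an interior edge by \<open>2 m \<Lambda> + 3 E m\<^sup>2\<close> times the jump of the gradient of \<open>m\<close>,
  and the vanishing of this factor at \<open>W\<close> and at the \<open>M i\<close> leaves only \<open>u = 0\<close>.
\<close>

lemma unisolvence0:
  assumes u: "u \<in> C1P3_form0 V W"
    and V0: "\<And>i. u (V i) = 0" "\<And>i. d0 T u (V i) = 0" and E0: "\<And>i. d0 T u (WE i) (\<nu> i) = 0"
  shows "u = 0"
proof -
  define M where "M i = (1/2) *\<^sub>R W + (1/2) *\<^sub>R V i" for i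
  have M_in_K: "M (l + 1) \<in> K l" "M (l + 2) \<in> K l" for l
    unfolding M_def by (intro convexD[OF convex_K]; simp)+
  have lam_M: "lam r (M i) = a r / 2 + (if r = i then 1/2 else 0)" for r i
    by (simp add: M_def lam_affine a_def)
  have hat_M: "hat (M i) = 1/2" for i
  proof -
    have "M i \<in> K (i + 2)" using M_in_K(1)[of "i + 2"] by simp
    from hat_K[OF this] show ?thesis using a_pos[of "i + 2"] by (simp add: lam_M)
  qed
  define C where "C = u W"
  \<comment> \<open>at \<open>M i\<close> the hat is 1/2 and the affine factor is \<open>(L i + C) / 2\<close>, so \<open>u (M i) = (L i + C) / 8\<close>\<close>
  define L where "L i = 8 * u (M i) - C" for i
  have rep: "u x = (hat x)\<^sup>2 * (L (l + 1) * (lam (l + 1) x - a (l + 1) * hat x) +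
      L (l + 2) * (lam (l + 2) x - a (l + 2) * hat x) + C * hat x)" if x: "x \<in> K l" for x l
  proof -
    obtain A B C' where ABC: "\<And>x. x \<in> K l \<Longrightarrow> u x = (hat x)\<^sup>2 * (A * (lam (l + 1) x - a (l + 1) * hat x) +
      B * (lam (l + 2) x - a (l + 2) * hat x) + C' * hat x)"
      by (rule cubic_divisible_by_hat_square[OF u V0 E0, of l]) blast
    have "C' = C" using ABC[OF W_in_K] by (simp add: C_def a_def)
    moreover have "A = L (l + 1)" using ABC[OF M_in_K(1)] \<open>C' = C\<close>
      by (simp add: L_def hat_M lam_M power2_eq_square field_simps)
    moreover have "B = L (l + 2)" using ABC[OF M_in_K(2)] \<open>C' = C\<close>
      by (simp add: L_def hat_M lam_M power2_eq_square field_simps)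
    ultimately show ?thesis using ABC[OF x] by simp
  qed
  define S where "S = (\<Sum>i\<in>UNIV. L i * a i)"
  define \<Lambda> where "\<Lambda> x = (\<Sum>i\<in>UNIV. L i * lam i x)" for x
  define E where "E = C - S"
  have glob: "u x = (hat x)\<^sup>2 * \<Lambda> x + E * hat x ^ 3" if x: "x \<in> K l" for x l
  proof -
    have "L l * (lam l x - a l * hat x) = 0" using hat_K[OF x] a_pos[of l] by simp
    then have "u x = (hat x)\<^sup>2 * ((L l * (lam l x - a l * hat x) + L (l + 1) * (lam (l + 1) x - a (l + 1) * hat x) +
      L (l + 2) * (lam (l + 2) x - a (l + 2) * hat x)) + C * hat x)"
      using rep[OF x] by simp
    also have "\<dots> = (hat x)\<^sup>2 * \<Lambda> x + E * hat x ^ 3"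
      unfolding \<Lambda>_def E_def S_def sum_cyclic[of _ l] by (simp add: algebra_simps power2_eq_square power3_eq_cube)
    finally show ?thesis .
  qed
  have du: "d0 T u x v = (2 * hat x * \<Lambda> x + 3 * E * (hat x)\<^sup>2) * (dlam l v / a l) + (hat x)\<^sup>2 * (\<Sum>i\<in>UNIV. L i * dlam i v)"
    if x: "x \<in> K l" for x l v
  proof -
    let ?M = "\<lambda>x. 1 / a l * lam l x"
    let ?D = "\<lambda>v. (2 * ?M x * \<Lambda> x + 3 * E * (?M x)\<^sup>2) * (1 / a l * dlam l v) + (?M x)\<^sup>2 * (\<Sum>i\<in>UNIV. L i * dlam i v)"
    have dM: "(?M has_derivative (\<lambda>v. 1 / a l * dlam l v)) (at x)"
      by (intro has_derivative_mult_right lam_has_derivative)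
    have 1: "((\<lambda>z. (?M z)\<^sup>2) has_derivative (\<lambda>v. 2 * ?M x * (1 / a l * dlam l v))) (at x)"
      "((\<lambda>z. ?M z ^ 3) has_derivative (\<lambda>v. 3 * (?M x)\<^sup>2 * (1 / a l * dlam l v))) (at x)"
      using has_derivative_power[OF dM, of 2] has_derivative_power[OF dM, of 3]
      by (simp_all add: ac_simps)
    have dL: "(\<Lambda> has_derivative (\<lambda>v. \<Sum>i\<in>UNIV. L i * dlam i v)) (at x)"
      unfolding \<Lambda>_def[abs_def] by (intro has_derivative_sum has_derivative_mult_right lam_has_derivative)
    have "((\<lambda>x. (?M x)\<^sup>2 * \<Lambda> x + E * ?M x ^ 3) has_derivative ?D) (at x)"
      by (rule has_derivative_eq_rhs, (rule has_derivative_add has_derivative_mult has_derivative_mult_right 1 dL)+)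
        (simp add: fun_eq_iff algebra_simps)
    then have "((\<lambda>x. (?M x)\<^sup>2 * \<Lambda> x + E * ?M x ^ 3) has_derivative ?D) (at x within K l)"
      by (rule has_derivative_at_withinI)
    then have "(u has_derivative ?D) (at x within K l)"
      by (rule has_derivative_transform[OF x, rotated]) (simp add: glob hat_K)
    moreover have "(u has_derivative d0 T u x) (at x within K l)"
      using u x K_subset_T
      by (intro has_derivative_subset[OF C1_form0_has_derivative]) (auto simp: C1P3_form0_def)
    ultimately have "blinfun_apply (d0 T u x) = ?D"
      using has_derivative_unique_within_convex[OF convex_K interior_K_nonempty x] by blast
    then show ?thesis using hat_K[OF x] by simp
  qed
  have jump: "2 * hat x * \<Lambda> x + 3 * E * (hat x)\<^sup>2 = 0" if "x \<in> K (i + 1)" "x \<in> K (i + 2)" for x i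
  proof -
    let ?v = "V i - V (i + 1)"
    have v: "dlam (i + 1) ?v = -1" "dlam (i + 2) ?v = 0" by (simp_all add: dlam_diff)
    show ?thesis using du[OF that(1), of ?v] du[OF that(2), of ?v] a_pos[of "i + 1"] unfolding v by simp
  qed
  have \<Lambda>W: "\<Lambda> W = S" by (simp add: \<Lambda>_def S_def a_def)
  have W: "2 * S + 3 * E = 0" using jump[OF W_in_K W_in_K] \<Lambda>W by simp
  have L0: "L i = 0" for i
  proof -
    have "M i \<in> K (i + 1)" "M i \<in> K (i + 2)" using M_in_K(2)[of "i + 1"] M_in_K(1)[of "i + 2"] by simp_all
    from jump[OF this] have "\<Lambda> (M i) + 3/4 * E = 0" by (simp add: hat_M power2_eq_square)
    moreover have "\<Lambda> (M i) = S / 2 + L i / 2"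
      unfolding \<Lambda>_def S_def sum_cyclic[of _ i] by (simp add: lam_M algebra_simps add_divide_distrib)
    ultimately show ?thesis using W by simp
  qed
  then have "S = 0" by (simp add: S_def)
  then have "E = 0" "\<Lambda> x = 0" for x using W L0 by (simp_all add: \<Lambda>_def)
  then have "u x = 0" if "x \<in> T" for x using that glob T_eq_K by auto
  moreover have "u x = 0" if "x \<notin> T" for x using that u by (simp add: C1P3_form0_def C1_form0_def zero_off_def)
  ultimately show ?thesis by (auto simp: fun_eq_iff)
qed

end

section \<open>The exact sequence and the interpolators\<close>

context triangle
begin

lemma edge_integral_d0:
  assumes f: "f \<in> C1_form0 T"
  shows "edge_integral V i (d0 T f) = f (V (i + 2)) - f (V (i + 1))"
proof -
  let ?l = "linepath (V (i + 1)) (V (i + 2))"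
  have img: "?l ` {0..1} \<subseteq> T"
    using convex_T closed_segment_subset[OF V_in_T V_in_T convex_T] by (simp add: linepath_image_01)
  have "((\<lambda>t. d0 T f (?l t) (V (i + 2) - V (i + 1))) has_integral f (?l 1) - f (?l 0)) {0..1}"
  proof (rule fundamental_theorem_of_calculus)
    fix t :: real assume t: "t \<in> {0..1}"
    have l: "(?l has_derivative (\<lambda>h. h *\<^sub>R (V (i + 2) - V (i + 1)))) (at t within {0..1})"
      using has_vector_derivative_linepath_within by (simp add: has_vector_derivative_def)
    have "(f has_derivative d0 T f (?l t)) (at (?l t) within T)"
      by (rule C1_form0_has_derivative[OF f]) (use img t in blast)
    then have "(f has_derivative d0 T f (?l t)) (at (?l t) within ?l ` {0..1})"
      by (rule has_derivative_subset[OF _ img])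
    from diff_chain_within[OF l this]
    show "((\<lambda>t. f (?l t)) has_vector_derivative d0 T f (?l t) (V (i + 2) - V (i + 1))) (at t within {0..1})"
      by (simp add: has_vector_derivative_def o_def blinfun.scaleR_right)
  qed simp
  then show ?thesis by (simp add: edge_integral_def integral_unique linepath_0' linepath_1')
qed

lemma const_form_C1:
  "const_form T c \<in> C1_form0 T" "d0 T (const_form T c) = 0"
proof -
  have D: "(const_form T c has_derivative blinfun_apply (0 x)) (at x within T)" if x: "x \<in> T" for x
  proof -
    have "((\<lambda>_. c) has_derivative (\<lambda>_. 0)) (at x within T)" by simp
    then have "(const_form T c has_derivative (\<lambda>_. 0)) (at x within T)"
      by (rule has_derivative_transform[OF x, rotated]) (simp add: const_form_def)
    then show ?thesis by (simp add: zero_fun_def zero_blinfun.rep_eq[abs_def])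
  qed
  have z: "const_form T c x = 0" "(0 :: 'a form1) x = 0" if "x \<notin> T" for x using that by (simp_all add: const_form_def)
  show "const_form T c \<in> C1_form0 T" "d0 T (const_form T c) = 0"
    using C1_form0I[OF z D] by (auto simp: zero_fun_def)
qed

lemma closed_form0_const:
  assumes u: "u \<in> C1_form0 T" and 0: "d0 T u = 0"
  shows "u = const_form T (u (V 0))"
proof
  fix x
  show "u x = const_form T (u (V 0)) x"
  proof (cases "x \<in> T")
    case True
    have "(u has_derivative (\<lambda>_. 0)) (at y within T)" if "y \<in> T" for y
      using C1_form0_has_derivative[OF u that] by (simp add: 0 zero_blinfun.rep_eq[abs_def])
    from has_derivative_zero_unique[OF convex_T this True V_in_T]
    show ?thesis using True by (simp add: const_form_def)
  next
    case False then show ?thesis using u by (simp add: const_form_def C1_form0_def zero_off_def)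
  qed
qed

lemma integral2_d1:
  "u \<in> C0d_form1 V \<Longrightarrow> integral2 V (d1 V u) = (\<Sum>i\<in>UNIV. edge_integral V i u)"
  by (rule stokes[OF has_d1_d1]) (auto simp: C0d_form1_def)

lemma edge_integral_add:
  assumes "u \<in> C0d_form1 V" "v \<in> C0d_form1 V"
  shows "edge_integral V i (c *\<^sub>R u + d *\<^sub>R v) = c * edge_integral V i u + d * edge_integral V i v"
proof -
  have I: "(\<lambda>t. w (linepath (V (i + 1)) (V (i + 2)) t) (V (i + 2) - V (i + 1))) integrable_on {0..1}"
    if "continuous_on T w" for w :: "'a form1"
  proof (rule integrable_continuous_real)
    have "linepath (V (i + 1)) (V (i + 2)) ` {0..1} \<subseteq> T"
      using closed_segment_subset[OF V_in_T V_in_T convex_T] by (simp add: linepath_image_01)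
    then show "continuous_on {0..1} (\<lambda>t. w (linepath (V (i + 1)) (V (i + 2)) t) (V (i + 2) - V (i + 1)))"
      by (intro continuous_intros continuous_on_compose2[OF that continuous_on_linepath])
  qed
  have c: "continuous_on T u" "continuous_on T v" using assms by (simp_all add: C0d_form1_def)
  show ?thesis
    unfolding edge_integral_def plus_fun_def scaleR_fun_def blinfun.add_left blinfun.scaleR_left real_scaleR_def
    by (subst integral_add) (auto intro!: integrable_on_mult_right I c)
qed

text \<open>
  Identifies covectors with vectors, so that the values of the degrees of freedom fill a Euclidean space
  and the dimension of the element can be read off.
\<close>

definition riesz :: "('a \<Rightarrow>\<^sub>L real) \<Rightarrow> 'a" where
  "riesz f = (\<Sum>b\<in>Basis. f b *\<^sub>R b)"

lemma bij_riesz: "bij riesz"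
proof (rule bijI')
  have inner: "riesz f \<bullet> v = f v" for f v
  proof -
    have "f v = f (\<Sum>b\<in>Basis. (v \<bullet> b) *\<^sub>R b)" by (simp add: euclidean_representation)
    also have "\<dots> = (\<Sum>b\<in>Basis. f b * (b \<bullet> v))"
      by (simp add: blinfun.sum_right blinfun.scaleR_right inner_commute mult.commute)
    finally show ?thesis by (simp add: riesz_def inner_sum_left)
  qed
  show "(riesz f = riesz g) = (f = g)" for f g
    using inner by (metis blinfun_eqI)
  show "\<exists>f. y = riesz f" for y
  proof
    show "y = riesz (blinfun_inner_right y)"
      by (simp add: riesz_def euclidean_representation)
  qed
qed

lemma riesz_add: "riesz (f + g) = riesz f + riesz g" and riesz_scaleR: "riesz (c *\<^sub>R f) = c *\<^sub>R riesz f"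
  by (simp_all add: riesz_def blinfun.bilinear_simps scaleR_left_distrib sum.distrib scaleR_sum_right)

end

lemma unique_interpolant:
  assumes "bij_betw F S A" "y \<in> A"
  shows "\<exists>!v. v \<in> S \<and> F v = y"
  using assms unfolding bij_betw_def inj_on_def by (metis (no_types, lifting) imageE)

lemma bij_vec_lambda: "bij h \<Longrightarrow> bij (\<lambda>f. \<chi> i. h (f i))"
proof (rule bijI')
  assume h: "bij h"
  show "((\<chi> i. h (f i)) = (\<chi> i. h (g i))) = (f = g)" for f g
    using bij_is_inj[OF h] by (auto simp: vec_eq_iff inj_eq fun_eq_iff)
  show "\<exists>f. y = (\<chi> i. h (f i))" for y
    using bij_is_surj[OF h] by (intro exI[of _ "\<lambda>i. inv h (y $ i)"]) (simp add: vec_eq_iff surj_f_inv_f)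
qed

context hct_element
begin

lemma C1P3_C1: "u \<in> C1P3_form0 V W \<Longrightarrow> u \<in> C1_form0 T"
  by (simp add: C1P3_form0_def)

lemma C0dP2_C0d: "u \<in> C0dP2_form1 V W \<Longrightarrow> u \<in> C0d_form1 V"
  by (simp add: C0dP2_form1_def)

lemma const_form_C1P3: "const_form T c \<in> C1P3_form0 V W"
proof -
  have "piecewise_poly 3 (subtriangles V W) (const_form T c)"
    unfolding piecewise_poly_iff const_form_def
    using K_subset_T by (intro allI bexI[of _ "\<lambda>_. c"] polynomials_const) auto
  then show ?thesis using const_form_C1 by (simp add: C1P3_form0_def)
qed

lemma dof0_inj: "inj_on (dof0 V WE \<nu>) (C1P3_form0 V W)"
proof (rule inj_onI)
  fix u v assume u: "u \<in> C1P3_form0 V W" and v: "v \<in> C1P3_form0 V W" and eq: "dof0 V WE \<nu> u = dof0 V WE \<nu> v"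
  let ?z = "u + (- 1) *\<^sub>R v"
  have d: "d0 T ?z = d0 T u + (- 1) *\<^sub>R d0 T v"
    using C1_form0_add(2)[OF C1P3_C1[OF u] C1_form0_scaleR(1)[OF C1P3_C1[OF v], of "-1"]]
      C1_form0_scaleR(2)[OF C1P3_C1[OF v], of "-1"] by simp
  have e: "u (V i) = v (V i)" "d0 T u (V i) = d0 T v (V i)" "d0 T u (WE i) (\<nu> i) = d0 T v (WE i) (\<nu> i)" for i
    using eq unfolding dof0_def edge_eval_def prod.inject by metis+
  have "?z = 0"
  proof (rule unisolvence0)
    show "?z \<in> C1P3_form0 V W" using u v subspace_C1P3 by (intro subspace_add subspace_scale)
  qed (simp_all only: d, simp_all add: e plus_fun_def scaleR_fun_def blinfun.bilinear_simps)
  then show "u = v" by (auto simp: fun_eq_iff plus_fun_def scaleR_fun_def)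
qed

lemma dof0_bij: "bij_betw (dof0 V WE \<nu>) (C1P3_form0 V W) UNIV"
  using dof0_inj dof0_surj unfolding bij_betw_def by (auto simp: image_iff) (metis prod_cases3)

lemma dof1_range: "u \<in> C0d_form1 V \<Longrightarrow> dof1 V WE \<nu> u \<in> UNIV \<times> {b. range b \<subseteq> alternating} \<times> UNIV \<times> UNIV"
  using d1_C0_form2 by (auto simp: dof1_def C0_form2_def)

text \<open>
  Injectivity: a form with zero data has an exterior derivative with zero vertex values and, by Stokes,
  zero integral; so it is closed, hence the gradient of some \<open>f\<close>. The edge integrals are the differences of
  the vertex values of \<open>f\<close>, and after subtraction of a constant \<open>f\<close> has zero data. Surjectivity reverses
  these steps.
\<close>

lemma dof1_bij: "bij_betw (dof1 V WE \<nu>) (C0dP2_form1 V W) (UNIV \<times> {b. range b \<subseteq> alternating} \<times> UNIV \<times> UNIV)"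
proof (rule bij_betw_imageI)
  show "inj_on (dof1 V WE \<nu>) (C0dP2_form1 V W)"
  proof (rule inj_onI)
    fix u v assume u: "u \<in> C0dP2_form1 V W" and v: "v \<in> C0dP2_form1 V W" and eq: "dof1 V WE \<nu> u = dof1 V WE \<nu> v"
    define z where "z = 1 *\<^sub>R u + (- 1) *\<^sub>R v"
    have z: "z \<in> C0dP2_form1 V W"
      unfolding z_def using u v subspace_C0dP2 by (intro subspace_add subspace_scale)
    note zC = C0dP2_C0d[OF z]
    have e: "u (V i) = v (V i)" "d1 V u (V i) = d1 V v (V i)" "u (WE i) (\<nu> i) = v (WE i) (\<nu> i)"
      "edge_integral V i u = edge_integral V i v" for i
      using eq unfolding dof1_def edge_eval_def prod.inject by metis+
    have dz: "d1 V z = 1 *\<^sub>R d1 V u + (- 1) *\<^sub>R d1 V v"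
      unfolding z_def by (rule C0d_form1_lincomb(2)[OF C0dP2_C0d[OF u] C0dP2_C0d[OF v]])
    have ez: "edge_integral V i z = 0" for i
      unfolding z_def edge_integral_add[OF C0dP2_C0d[OF u] C0dP2_C0d[OF v]] e by simp
    have z0: "z (V i) = 0" "d1 V z (V i) = 0" "z (WE i) (\<nu> i) = 0" for i
      using e unfolding dz by (simp_all add: z_def plus_fun_def scaleR_fun_def blinfun.bilinear_simps)
    have "dof2 V (d1 V z) = dof2 V 0"
    proof -
      have "integral2 V (0 :: 'a form2) = 0" by (simp add: integral2_def tri_integral_Pt zero_fun_def)
      then show ?thesis using integral2_d1[OF zC] z0 ez by (simp add: dof2_def)
    qed
    then have "d1 V z = 0"
      using dof2_bij d1_C0dP2[OF z] subspace_0[OF subspace_C0P1] unfolding bij_betw_def inj_on_def by blast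
    then obtain f where f: "f \<in> C1P3_form0 V W" "d0 T f = z" using d0_exact[OF z] by blast
    have "f (V (i + 2)) = f (V (i + 1))" for i
      using edge_integral_d0[OF C1P3_C1[OF f(1)], of i] ez[of i] f(2) by simp
    from this[of 0] this[of 1] this[of 2] have fV: "\<forall>i. f (V i) = f (V 0)" unfolding forall_mod3 by simp
    let ?g = "f + (- 1) *\<^sub>R const_form T (f (V 0))"
    have dg: "d0 T ?g = z"
      using C1_form0_add(2)[OF C1P3_C1[OF f(1)] C1_form0_scaleR(1)[OF const_form_C1(1), of "-1" "f (V 0)"]]
        C1_form0_scaleR(2)[OF const_form_C1(1), of "-1" "f (V 0)"] f(2) by (simp add: const_form_C1(2))
    have "?g = 0"
    proof (rule unisolvence0)
      show "?g \<in> C1P3_form0 V W" using f const_form_C1P3 subspace_C1P3 by (intro subspace_add subspace_scale)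
      show "?g (V i) = 0" for i using fV by (simp add: plus_fun_def scaleR_fun_def const_form_def)
    qed (simp_all only: dg z0)
    then have "z = d0 T 0" using dg by simp
    also have "\<dots> = 0" using C1_form0_scaleR(2)[OF zero_forms(1), of 0] by simp
    finally show "u = v" by (auto simp: z_def fun_eq_iff plus_fun_def scaleR_fun_def)
  qed
  show "dof1 V WE \<nu> ` C0dP2_form1 V W = UNIV \<times> {b. range b \<subseteq> alternating} \<times> UNIV \<times> UNIV"
  proof (intro antisym subsetI)
    fix y assume "y \<in> dof1 V WE \<nu> ` C0dP2_form1 V W"
    then show "y \<in> UNIV \<times> {b. range b \<subseteq> alternating} \<times> UNIV \<times> UNIV" using dof1_range C0dP2_C0d by blast
  next
    fix y :: "(3 \<Rightarrow> 'a \<Rightarrow>\<^sub>L real) \<times> (3 \<Rightarrow> 'a \<Rightarrow>\<^sub>L 'a \<Rightarrow>\<^sub>L real) \<times> (3 \<Rightarrow> real) \<times> (3 \<Rightarrow> real)"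
    assume y: "y \<in> UNIV \<times> {b. range b \<subseteq> alternating} \<times> UNIV \<times> UNIV"
    obtain g B m r where yy: "y = (g, B, m, r)" by (cases y)
    have "(B, \<Sum>i\<in>UNIV. r i) \<in> dof2 V ` C0P1_form2 V W"
      using dof2_bij y unfolding bij_betw_def yy by auto
    then obtain w where w: "w \<in> C0P1_form2 V W" "dof2 V w = (B, \<Sum>i\<in>UNIV. r i)" by auto
    obtain u1 where u1: "u1 \<in> C0dP2_form1 V W" "d1 V u1 = w" using d1_surj[OF w(1)] by blast
    note u1C = C0dP2_C0d[OF u1(1)]
    define s where "s i = r i - edge_integral V i u1" for i
    have s: "s 0 + s 1 + s 2 = 0"
      using integral2_d1[OF u1C] w(2) u1(2) by (simp add: dof2_def s_def sum_mod3)
    \<comment> \<open>vertex values whose differences along the edges are the residues\<close>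
    define c where "c i = (if i = 0 then 0 else if i = 1 then s 2 else - s 1)" for i :: 3
    have "\<forall>i. c (i + 2) - c (i + 1) = s i" unfolding forall_mod3 using s by (simp add: c_def)
    then have c: "c (i + 2) - c (i + 1) = s i" for i by blast
    obtain f where f: "f \<in> C1P3_form0 V W"
      "dof0 V WE \<nu> f = (c, \<lambda>i. g i - u1 (V i), \<lambda>i. m i - u1 (WE i) (\<nu> i))"
      using dof0_surj by blast
    have fe: "f (V i) = c i" "d0 T f (V i) = g i - u1 (V i)" "d0 T f (WE i) (\<nu> i) = m i - u1 (WE i) (\<nu> i)" for i
      using f(2) unfolding dof0_def edge_eval_def prod.inject by metis+
    let ?u = "1 *\<^sub>R u1 + 1 *\<^sub>R d0 T f"
    have dC: "d0 T f \<in> C0d_form1 V" "d1 V (d0 T f) = 0" using d0_C0d[OF C1P3_C1[OF f(1)]] by auto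
    have "d1 V ?u = w" using C0d_form1_lincomb(2)[OF u1C dC(1), of 1 1] dC(2) u1(2) by simp
    moreover have "edge_integral V i ?u = r i" for i
      using edge_integral_add[OF u1C dC(1), of i 1 1] edge_integral_d0[OF C1P3_C1[OF f(1)], of i] c[of i]
      by (simp add: fe s_def)
    ultimately have "dof1 V WE \<nu> ?u = y"
      using w(2) by (auto simp: dof1_def dof2_def yy edge_eval_def fun_eq_iff plus_fun_def scaleR_fun_def
          blinfun.bilinear_simps fe)
    moreover have "?u \<in> C0dP2_form1 V W"
      using u1(1) d0_C1P3[OF f(1)] subspace_C0dP2 by (intro subspace_add subspace_scale)
    ultimately show "y \<in> dof1 V WE \<nu> ` C0dP2_form1 V W" by blast
  qed
qed

lemma dim_C1P3: "dim (C1P3_form0 V W) = 12"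
proof -
  let ?enc = "\<lambda>y. (\<chi> i. (fst y :: 3 \<Rightarrow> real) i, \<chi> i. riesz (fst (snd y) i), \<chi> i. (snd (snd y) :: 3 \<Rightarrow> real) i)"
  let ?F = "\<lambda>u. ?enc (dof0 V WE \<nu> u)"
  have enc: "bij ?enc"
  proof -
    have eq: "?enc = map_prod (\<lambda>f. \<chi> i. id (f i)) (map_prod (\<lambda>f. \<chi> i. riesz (f i)) (\<lambda>f. \<chi> i. id (f i)))"
      by (auto simp: fun_eq_iff)
    have "bij_betw ?enc (UNIV \<times> UNIV \<times> UNIV) (UNIV \<times> UNIV \<times> UNIV)"
      unfolding eq
      by (intro bij_betw_map_prod bij_vec_lambda bij_riesz bij_id)
    then show ?thesis by (simp only: UNIV_Times_UNIV)
  qed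
  have "bij_betw ?F (C1P3_form0 V W) UNIV"
    using bij_betw_trans[OF dof0_bij enc] by (simp add: o_def)
  then have "dim (C1P3_form0 V W) = DIM((real^3) \<times> ('a^3) \<times> (real^3))"
  proof (rule dim_linear_bij[OF subspace_C1P3, rotated 2])
    fix u v assume u: "u \<in> C1P3_form0 V W" and v: "v \<in> C1P3_form0 V W"
    show "?F (u + v) = ?F u + ?F v"
      unfolding dof0_def edge_eval_def C1_form0_add(2)[OF C1P3_C1[OF u] C1P3_C1[OF v]]
      by (simp add: plus_fun_def riesz_add vec_eq_iff blinfun.bilinear_simps)
  next
    fix c u assume u: "u \<in> C1P3_form0 V W"
    show "?F (c *\<^sub>R u) = c *\<^sub>R ?F u"
      unfolding dof0_def edge_eval_def C1_form0_scaleR(2)[OF C1P3_C1[OF u]]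
      by (simp add: scaleR_fun_def riesz_scaleR vec_eq_iff blinfun.bilinear_simps)
  qed
  then show ?thesis using dim2 by simp
qed

lemma bij_alternating: "bij_betw (\<lambda>B :: 3 \<Rightarrow> 'a \<Rightarrow>\<^sub>L 'a \<Rightarrow>\<^sub>L real. \<chi> i. B i e1 e2) {b. range b \<subseteq> alternating} UNIV"
proof (rule bij_betw_imageI)
  show "inj_on (\<lambda>B :: 3 \<Rightarrow> 'a \<Rightarrow>\<^sub>L 'a \<Rightarrow>\<^sub>L real. \<chi> i. B i e1 e2) {b. range b \<subseteq> alternating}"
  proof (rule inj_onI)
    fix B B' :: "3 \<Rightarrow> 'a \<Rightarrow>\<^sub>L 'a \<Rightarrow>\<^sub>L real"
    assume B: "B \<in> {b. range b \<subseteq> alternating}" "B' \<in> {b. range b \<subseteq> alternating}"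
      and eq: "(\<chi> i. B i e1 e2) = (\<chi> i. B' i e1 e2)"
    show "B = B'"
    proof
      fix i
      have "B i e1 e2 = B' i e1 e2" using eq by (simp add: vec_eq_iff)
      moreover have "B i \<in> alternating" "B' i \<in> alternating" using B by auto
      ultimately show "B i = B' i" using alternating_eq_vol by metis
    qed
  qed
  show "(\<lambda>B :: 3 \<Rightarrow> 'a \<Rightarrow>\<^sub>L 'a \<Rightarrow>\<^sub>L real. \<chi> i. B i e1 e2) ` {b. range b \<subseteq> alternating} = UNIV"
  proof (intro antisym subsetI)
    fix y :: "real^3"
    show "y \<in> (\<lambda>B :: 3 \<Rightarrow> 'a \<Rightarrow>\<^sub>L 'a \<Rightarrow>\<^sub>L real. \<chi> i. B i e1 e2) ` {b. range b \<subseteq> alternating}"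
      by (rule image_eqI[of _ _ "\<lambda>i. (y $ i) *\<^sub>R vol"])
        (auto simp: vec_eq_iff blinfun.bilinear_simps vol_alternating)
  qed simp
qed

lemma dim_C0dP2: "dim (C0dP2_form1 V W) = 15"
proof -
  let ?enc = "\<lambda>y. (\<chi> i. riesz ((fst y :: 3 \<Rightarrow> 'a \<Rightarrow>\<^sub>L real) i), \<chi> i. ((fst (snd y) :: 3 \<Rightarrow> 'a \<Rightarrow>\<^sub>L 'a \<Rightarrow>\<^sub>L real) i) e1 e2,
     \<chi> i. (fst (snd (snd y)) :: 3 \<Rightarrow> real) i, \<chi> i. (snd (snd (snd y)) :: 3 \<Rightarrow> real) i)"
  let ?F = "\<lambda>u. ?enc (dof1 V WE \<nu> u)"
  have enc: "bij_betw ?enc (UNIV \<times> {b. range b \<subseteq> alternating} \<times> UNIV \<times> UNIV) UNIV"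
  proof -
    have eq: "?enc = map_prod (\<lambda>f. \<chi> i. riesz (f i)) (map_prod (\<lambda>B :: 3 \<Rightarrow> 'a \<Rightarrow>\<^sub>L 'a \<Rightarrow>\<^sub>L real. \<chi> i. B i e1 e2)
        (map_prod (\<lambda>f. \<chi> i. id (f i)) (\<lambda>f. \<chi> i. id (f i))))"
      by (auto simp: fun_eq_iff)
    have "bij_betw ?enc (UNIV \<times> {b. range b \<subseteq> alternating} \<times> UNIV \<times> UNIV) (UNIV \<times> UNIV \<times> UNIV \<times> UNIV)"
      unfolding eq
      by (intro bij_betw_map_prod bij_vec_lambda bij_riesz bij_id bij_alternating)
    then show ?thesis by (simp only: UNIV_Times_UNIV)
  qed
  have "bij_betw ?F (C0dP2_form1 V W) UNIV"
    using bij_betw_trans[OF dof1_bij enc] by (simp add: o_def)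
  then have "dim (C0dP2_form1 V W) = DIM(('a^3) \<times> (real^3) \<times> (real^3) \<times> (real^3))"
  proof (rule dim_linear_bij[OF subspace_C0dP2, rotated 2])
    fix u v assume u: "u \<in> C0dP2_form1 V W" and v: "v \<in> C0dP2_form1 V W"
    have "edge_integral V i (u + v) = edge_integral V i u + edge_integral V i v" for i
      using edge_integral_add[OF C0dP2_C0d[OF u] C0dP2_C0d[OF v], of i 1 1] by simp
    then show "?F (u + v) = ?F u + ?F v"
      unfolding dof1_def edge_eval_def C0d_form1_add(2)[OF C0dP2_C0d[OF u] C0dP2_C0d[OF v]]
      by (simp add: plus_fun_def riesz_add vec_eq_iff blinfun.bilinear_simps)
  next
    fix c u assume u: "u \<in> C0dP2_form1 V W"
    have "edge_integral V i (c *\<^sub>R u) = c * edge_integral V i u" for i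
      using edge_integral_add[OF C0dP2_C0d[OF u] C0dP2_C0d[OF u], of i c 0] by simp
    then show "?F (c *\<^sub>R u) = c *\<^sub>R ?F u"
      unfolding dof1_def edge_eval_def C0d_form1_scaleR(2)[OF C0dP2_C0d[OF u]]
      by (simp add: scaleR_fun_def riesz_scaleR vec_eq_iff blinfun.bilinear_simps)
  qed
  then show ?thesis using dim2 by simp
qed

lemma dim_C0P1: "dim (C0P1_form2 V W) = 4"
proof -
  let ?enc = "\<lambda>y. (\<chi> i. ((fst y :: 3 \<Rightarrow> 'a \<Rightarrow>\<^sub>L 'a \<Rightarrow>\<^sub>L real) i) e1 e2, snd y :: real)"
  let ?F = "\<lambda>w. ?enc (dof2 V w)"
  have enc: "bij_betw ?enc ({b. range b \<subseteq> alternating} \<times> UNIV) UNIV"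
  proof -
    have eq: "?enc = map_prod (\<lambda>B :: 3 \<Rightarrow> 'a \<Rightarrow>\<^sub>L 'a \<Rightarrow>\<^sub>L real. \<chi> i. B i e1 e2) id" by (auto simp: fun_eq_iff)
    have "bij_betw ?enc ({b. range b \<subseteq> alternating} \<times> UNIV) (UNIV \<times> UNIV)"
      unfolding eq
      by (intro bij_betw_map_prod bij_id bij_alternating)
    then show ?thesis by (simp only: UNIV_Times_UNIV)
  qed
  have "bij_betw ?F (C0P1_form2 V W) UNIV"
    using bij_betw_trans[OF dof2_bij enc] by (simp add: o_def)
  then have "dim (C0P1_form2 V W) = DIM((real^3) \<times> real)"
  proof (rule dim_linear_bij[OF subspace_C0P1, rotated 2])
    have I: "(\<lambda>p. w (Pt p) e1 e2) integrable_on Tref" if "w \<in> C0P1_form2 V W" for w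
      using that by (intro integrable_Tref C0_form2_rep(2)) (simp add: C0P1_form2_def)
    fix w w' assume w: "w \<in> C0P1_form2 V W" and w': "w' \<in> C0P1_form2 V W"
    have "integral2 V (w + w') = integral2 V w + integral2 V w'"
      unfolding integral2_def tri_integral_Pt plus_fun_def blinfun.add_left
      by (rule integral_add[OF I[OF w] I[OF w']])
    then show "?F (w + w') = ?F w + ?F w'"
      by (simp add: dof2_def plus_fun_def vec_eq_iff blinfun.bilinear_simps)
  next
    fix c w assume w: "w \<in> C0P1_form2 V W"
    have "integral2 V (c *\<^sub>R w) = c * integral2 V w"
      unfolding integral2_def tri_integral_Pt scaleR_fun_def blinfun.scaleR_left by simp
    then show "?F (c *\<^sub>R w) = c *\<^sub>R ?F w"
      by (simp add: dof2_def scaleR_fun_def vec_eq_iff blinfun.bilinear_simps)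
  qed
  then show ?thesis by simp
qed

lemma linear_between_maps:
  "linear_between UNIV (C1P3_form0 V W) (const_form T)"
  "linear_between (C1P3_form0 V W) (C0dP2_form1 V W) (d0 T)"
  "linear_between (C0dP2_form1 V W) (C0P1_form2 V W) (d1 V)"
proof -
  show "linear_between UNIV (C1P3_form0 V W) (const_form T)"
    using subspace_C1P3 const_form_C1P3
    by (auto simp: linear_between_def const_form_def plus_fun_def scaleR_fun_def fun_eq_iff)
  show "linear_between (C1P3_form0 V W) (C0dP2_form1 V W) (d0 T)"
    using subspace_C1P3 subspace_C0dP2 d0_C1P3 C1_form0_add(2) C1_form0_scaleR(2) C1P3_C1
    by (auto simp: linear_between_def)
  show "linear_between (C0dP2_form1 V W) (C0P1_form2 V W) (d1 V)"
    using subspace_C0P1 subspace_C0dP2 d1_C0dP2 C0d_form1_add(2) C0d_form1_scaleR(2) C0dP2_C0d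
    by (auto simp: linear_between_def)
qed

lemma exact_sequence:
  "inj (const_form T)"
  "range (const_form T) = {u \<in> C1P3_form0 V W. d0 T u = 0}"
  "d0 T ` C1P3_form0 V W = {u \<in> C0dP2_form1 V W. d1 V u = 0}"
  "d1 V ` C0dP2_form1 V W = C0P1_form2 V W"
proof -
  show "inj (const_form T)"
    by (rule injI) (metis const_form_def V_in_T)
  show "range (const_form T) = {u \<in> C1P3_form0 V W. d0 T u = 0}"
    using const_form_C1P3 const_form_C1(2) closed_form0_const C1P3_C1 by blast
  show "d0 T ` C1P3_form0 V W = {u \<in> C0dP2_form1 V W. d1 V u = 0}"
    using d0_C1P3 d0_C0d(2) C1P3_C1 d0_exact by blast
  show "d1 V ` C0dP2_form1 V W = C0P1_form2 V W"
    using d1_C0dP2 d1_surj by blast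
qed

lemma interpolants:
  "\<exists>!v. v \<in> C1P3_form0 V W \<and> dof0 V WE \<nu> v = dof0 V WE \<nu> u0"
  "u1 \<in> C0d_form1 V \<Longrightarrow> \<exists>!v. v \<in> C0dP2_form1 V W \<and> dof1 V WE \<nu> v = dof1 V WE \<nu> u1"
  "u2 \<in> C0_form2 T \<Longrightarrow> \<exists>!v. v \<in> C0P1_form2 V W \<and> dof2 V v = dof2 V u2"
proof -
  show "\<exists>!v. v \<in> C1P3_form0 V W \<and> dof0 V WE \<nu> v = dof0 V WE \<nu> u0"
    by (rule unique_interpolant[OF dof0_bij]) simp
  show "u1 \<in> C0d_form1 V \<Longrightarrow> \<exists>!v. v \<in> C0dP2_form1 V W \<and> dof1 V WE \<nu> v = dof1 V WE \<nu> u1"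
    by (rule unique_interpolant[OF dof1_bij dof1_range])
  show "u2 \<in> C0_form2 T \<Longrightarrow> \<exists>!v. v \<in> C0P1_form2 V W \<and> dof2 V v = dof2 V u2"
    by (rule unique_interpolant[OF dof2_bij]) (auto simp: dof2_def C0_form2_def)
qed

text \<open>
  Both sides have the same degrees of freedom: the edge integrals of a gradient are differences of vertex
  values, and its exterior derivative is zero.
\<close>

lemma I0_commutes:
  assumes u: "u \<in> C1_form0 T"
  shows "d0 T (I0 V W WE \<nu> u) = I1 V W WE \<nu> (d0 T u)"
proof -
  have I: "I0 V W WE \<nu> u \<in> C1P3_form0 V W \<and> dof0 V WE \<nu> (I0 V W WE \<nu> u) = dof0 V WE \<nu> u"
    unfolding I0_def by (rule theI'[OF interpolants(1)])
  let ?f = "I0 V W WE \<nu> u"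
  have e: "?f (V i) = u (V i)" "d0 T ?f (V i) = d0 T u (V i)" "edge_eval WE \<nu> i (d0 T ?f) = edge_eval WE \<nu> i (d0 T u)" for i
    using I unfolding dof0_def prod.inject by metis+
  have fC: "?f \<in> C1_form0 T" using I C1P3_C1 by blast
  have "d0 T ?f \<in> C0dP2_form1 V W \<and> dof1 V WE \<nu> (d0 T ?f) = dof1 V WE \<nu> (d0 T u)"
    using I d0_C1P3 by (auto simp: dof1_def e d0_C0d(2)[OF fC] d0_C0d(2)[OF u] edge_integral_d0[OF fC] edge_integral_d0[OF u])
  then show ?thesis
    unfolding I1_def by (intro the1_equality[symmetric] interpolants(2) d0_C0d(1)[OF u])
qed

text \<open>
  The integral of the exterior derivative is preserved since Stokes' theorem expresses it by edge
  integrals, for the interpolant and for the interpolated form.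
\<close>

lemma I1_commutes:
  assumes u: "u \<in> C0d_form1 V"
  shows "d1 V (I1 V W WE \<nu> u) = I2 V W (d1 V u)"
proof -
  let ?v = "I1 V W WE \<nu> u"
  have I: "?v \<in> C0dP2_form1 V W \<and> dof1 V WE \<nu> ?v = dof1 V WE \<nu> u"
    unfolding I1_def by (rule theI'[OF interpolants(2)[OF u]])
  have e: "d1 V ?v (V i) = d1 V u (V i)" "edge_integral V i ?v = edge_integral V i u" for i
    using I unfolding dof1_def prod.inject by metis+
  have vC: "?v \<in> C0d_form1 V" using I C0dP2_C0d by blast
  have "d1 V ?v \<in> C0P1_form2 V W \<and> dof2 V (d1 V ?v) = dof2 V (d1 V u)"
    using I d1_C0dP2 by (auto simp: dof2_def e integral2_d1[OF vC] integral2_d1[OF u])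
  then show ?thesis
    unfolding I2_def by (intro the1_equality[symmetric] interpolants(3) d1_C0_form2[OF u])
qed

end

theorem proposition3p1:
  fixes V :: "3 \<Rightarrow> 'a::euclidean_space" and W :: 'a
    and WE :: "3 \<Rightarrow> 'a" and \<nu> :: "3 \<Rightarrow> 'a"
  assumes "DIM('a) = 2"
    and "\<not> collinear (range V)"
    and "W \<in> interior (closed_triangle V)"
    and "\<And>i. WE i \<in> open_segment (V (i + 1)) (V (i + 2))"
    and "\<And>i. \<nu> i \<notin> span {V (i + 2) - V (i + 1)}"
  shows
    "(linear_between UNIV (C1P3_form0 V W) (const_form (closed_triangle V)) \<and>
      linear_between (C1P3_form0 V W) (C0dP2_form1 V W) (d0 (closed_triangle V)) \<and>
      linear_between (C0dP2_form1 V W) (C0P1_form2 V W) (d1 V) \<and>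
      inj (const_form (closed_triangle V)) \<and>
      range (const_form (closed_triangle V)) = {u \<in> C1P3_form0 V W. d0 (closed_triangle V) u = 0} \<and>
      d0 (closed_triangle V) ` C1P3_form0 V W = {u \<in> C0dP2_form1 V W. d1 V u = 0} \<and>
      d1 V ` C0dP2_form1 V W = C0P1_form2 V W)
     \<and>
     (dim (C1P3_form0 V W) = 12 \<and>
      bij_betw (dof0 V WE \<nu>) (C1P3_form0 V W) UNIV)
     \<and>
     (dim (C0dP2_form1 V W) = 15 \<and>
      bij_betw (dof1 V WE \<nu>) (C0dP2_form1 V W)
        (UNIV \<times> {b. range b \<subseteq> alternating} \<times> UNIV \<times> UNIV))
     \<and>
     (dim (C0P1_form2 V W) = 4 \<and>
      bij_betw (dof2 V) (C0P1_form2 V W) ({a. range a \<subseteq> alternating} \<times> UNIV))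
     \<and>
     ((\<forall>u \<in> C1_form0 (closed_triangle V).
        \<exists>!v. v \<in> C1P3_form0 V W \<and> dof0 V WE \<nu> v = dof0 V WE \<nu> u) \<and>
      (\<forall>u \<in> C0d_form1 V.
        \<exists>!v. v \<in> C0dP2_form1 V W \<and> dof1 V WE \<nu> v = dof1 V WE \<nu> u) \<and>
      (\<forall>u \<in> C0_form2 (closed_triangle V).
        \<exists>!v. v \<in> C0P1_form2 V W \<and> dof2 V v = dof2 V u) \<and>
      (\<forall>u \<in> C1_form0 (closed_triangle V).
        d0 (closed_triangle V) u \<in> C0d_form1 V \<and>
        d0 (closed_triangle V) (I0 V W WE \<nu> u) = I1 V W WE \<nu> (d0 (closed_triangle V) u)) \<and>
      (\<forall>u \<in> C0d_form1 V.
        d1 V u \<in> C0_form2 (closed_triangle V) \<and>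
        d1 V (I1 V W WE \<nu> u) = I2 V W (d1 V u)))"
proof -
  interpret hct_element V W WE \<nu>
    using assms by unfold_locales
  show ?thesis
    by (intro conjI ballI linear_between_maps exact_sequence dim_C1P3 dof0_bij dim_C0dP2 dof1_bij
        dim_C0P1 dof2_bij interpolants I0_commutes I1_commutes d0_C0d(1) d1_C0_form2)
qed

end
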